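(* Suppose $E:\mathcal{P}_{2,\omega_0}(\mathbb{R}^d)\to\mathbb{R}\cup\{+\infty\}$ is proper, coercive, lower semicontinuous and $\lambda$-convex along generalized geodesics for some $\lambda\in\mathbb{R}$, and let $\mu\in D(|\partial E|)$. For $t>0$ and a partition $0=t_0<t_1<\dots<t_m=t$ with time steps $h_i=t_i-t_{i-1}$ and $|\boldsymbol h|=\max_{1\le i\le m}h_i$, the discrete gradient flow $J_{h_m}\circ\cdots\circ J_{h_1}\mu$ converges in $W_2$ to the gradient flow $S(t)\mu=\lim_{n\to\infty}J^n_{t/n}\mu$ as $|\boldsymbol h|\to0$, uniformly in $t$ on compact subsets of $[0,+\infty)$. Moreover, when $|\boldsymbol h|\le\frac1{2\lambda^-}$, $$W_2\big(S(t)\mu,J_{h_m}\circ\cdots\circ J_{h_1}\mu\big)\le2\big[|\boldsymbol h|^2+3|\boldsymbol h|t\big]^{1/2}e^{4\lambda^-t}|\partial E|(\mu).$$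
   Context: Fix a probability measure $\omega_0$ on $\mathbb{R}^d$. $W_2$ is the quadratic Wasserstein distance, $\Gamma_0$ the optimal couplings; $\mathcal{P}_{2,\omega_0}(\mathbb{R}^d)=\{\mu:W_2(\mu,\omega_0)<\infty\}$. A transport plan from $\mu_0$ to $\mu_1$ with base $\omega$ is $\boldsymbol\omega\in\mathcal{P}((\mathbb{R}^d)^3)$ with $\pi^{1,2}\#\boldsymbol\omega\in\Gamma_0(\omega,\mu_0)$, $\pi^{1,3}\#\boldsymbol\omega\in\Gamma_0(\omega,\mu_1)$; generalized geodesic $\mu_\alpha=((1-\alpha)\pi^2+\alpha\pi^3)\#\boldsymbol\omega$; $W_{2,\boldsymbol\omega}(\mu_0,\mu_1)=(\int|x_2-x_3|^2d\boldsymbol\omega)^{1/2}$. $D(E)=\{E<\infty\}$; proper: $D(E)\ne\emptyset$; coercive: $\exists\tau_0>0,u_0$ with $\inf_v\{\frac1{2\tau_0}W_2^2(u_0,v)+E(v)\}>-\infty$; lower semicontinuous w.r.t. $W_2$; $\lambda$-convex along generalized geodesics: for all $\mu_0,\mu_1,\omega$ there is a generalized geodesic from $\mu_0$ to $\mu_1$ with base $\omega$ (induced by some $\boldsymbol\omega$) with $E(\mu_\alpha)\le(1-\alpha)E(\mu_0)+\alpha E(\mu_1)-\alpha(1-\alpha)\frac\lambda2W^2_{2,\boldsymbol\omega}(\mu_0,\mu_1)$. $\lambda^-=\max\{0,-\lambda\}$, $1/\lambda^-=+\infty$ if $\lambda^-=0$. $J_\tau\mu=\operatorname{argmin}_\nu\{\frac1{2\tau}W_2^2(\mu,\nu)+E(\nu)\}$,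 $J^n_\tau$ its $n$-fold iterate; the limit $S(t)\mu=\lim_{n\to\infty}J^n_{t/n}\mu$ exists and is the Wasserstein gradient flow of $E$ from $\mu$. Metric slope $|\partial E|(\mu)=\limsup_{\nu\to\mu}(E(\mu)-E(\nu))^+/W_2(\mu,\nu)$; $D(|\partial E|)=\{\mu\in D(E):|\partial E|(\mu)<\infty\}$. *)

theory Defs
  imports "HOL-Probability.Probability"
begin

definition Pm :: "'a::euclidean_space measure set" where
  "Pm = {\<mu>. prob_space \<mu> \<and> sets \<mu> = sets borel}"

definition couplings :: "'a::euclidean_space measure \<Rightarrow> 'a measure \<Rightarrow> ('a \<times> 'a) measure set" where
  "couplings \<mu> \<nu> = {\<gamma>. prob_space \<gamma> \<and> sets \<gamma> = sets borel \<and>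
      distr \<gamma> borel fst = \<mu> \<and> distr \<gamma> borel snd = \<nu>}"

definition cost2 :: "('a::euclidean_space \<times> 'a) measure \<Rightarrow> ennreal" where
  "cost2 \<gamma> = (\<integral>\<^sup>+ p. ennreal ((norm (fst p - snd p))\<^sup>2) \<partial>\<gamma>)"

definition W2sq :: "'a::euclidean_space measure \<Rightarrow> 'a measure \<Rightarrow> ennreal" where
  "W2sq \<mu> \<nu> = (INF \<gamma>\<in>couplings \<mu> \<nu>. cost2 \<gamma>)"

definition W2 :: "'a::euclidean_space measure \<Rightarrow> 'a measure \<Rightarrow> ennreal" where
  "W2 \<mu> \<nu> = (if W2sq \<mu> \<nu> = \<infinity> then \<infinity> else ennreal (sqrt (enn2real (W2sq \<mu> \<nu>))))"

definition optimal_couplings :: "'a::euclidean_space measure \<Rightarrow> 'a measure \<Rightarrow> ('a \<times> 'a) measure set" where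
  "optimal_couplings \<mu> \<nu> = {\<gamma>\<in>couplings \<mu> \<nu>. cost2 \<gamma> = W2sq \<mu> \<nu>}"

definition P2 :: "'a::euclidean_space measure \<Rightarrow> 'a measure set" where
  "P2 \<omega>0 = {\<mu>\<in>Pm. W2 \<mu> \<omega>0 < \<infinity>}"

definition transport_plans :: "'a::euclidean_space measure \<Rightarrow> 'a measure \<Rightarrow> 'a measure \<Rightarrow> ('a \<times> 'a \<times> 'a) measure set" where
  "transport_plans \<omega> \<mu>0 \<mu>1 = {w. prob_space w \<and> sets w = sets borel \<and>
      distr w borel (\<lambda>(x1,x2,x3). (x1,x2)) \<in> optimal_couplings \<omega> \<mu>0 \<and>
      distr w borel (\<lambda>(x1,x2,x3). (x1,x3)) \<in> optimal_couplings \<omega> \<mu>1}"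

definition gen_geod :: "('a::euclidean_space \<times> 'a \<times> 'a) measure \<Rightarrow> real \<Rightarrow> 'a measure" where
  "gen_geod w \<alpha> = distr w borel (\<lambda>(x1,x2,x3). (1 - \<alpha>) *\<^sub>R x2 + \<alpha> *\<^sub>R x3)"

definition W2plan_sq :: "('a::euclidean_space \<times> 'a \<times> 'a) measure \<Rightarrow> ennreal" where
  "W2plan_sq w = (\<integral>\<^sup>+ p. ennreal ((norm (fst (snd p) - snd (snd p)))\<^sup>2) \<partial>w)"

definition proper_fun :: "'a::euclidean_space measure \<Rightarrow> ('a measure \<Rightarrow> ereal) \<Rightarrow> bool" where
  "proper_fun \<omega>0 E \<longleftrightarrow> (\<exists>\<mu>\<in>P2 \<omega>0. E \<mu> < \<infinity>)"

definition coercive :: "'a::euclidean_space measure \<Rightarrow> ('a measure \<Rightarrow> ereal) \<Rightarrow> bool" where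
  "coercive \<omega>0 E \<longleftrightarrow> (\<exists>\<tau>0>0. \<exists>u0\<in>P2 \<omega>0.
      (INF v\<in>P2 \<omega>0. ereal (1 / (2 * \<tau>0)) * enn2ereal (W2sq u0 v) + E v) > - \<infinity>)"

definition W2_lsc :: "'a::euclidean_space measure \<Rightarrow> ('a measure \<Rightarrow> ereal) \<Rightarrow> bool" where
  "W2_lsc \<omega>0 E \<longleftrightarrow> (\<forall>\<mu>s \<mu>. (\<forall>n. \<mu>s n \<in> P2 \<omega>0) \<and> \<mu> \<in> P2 \<omega>0 \<and>
      (\<lambda>n. W2 (\<mu>s n) \<mu>) \<longlonglongrightarrow> 0 \<longrightarrow> E \<mu> \<le> liminf (\<lambda>n. E (\<mu>s n)))"

definition lambda_convex_gg :: "'a::euclidean_space measure \<Rightarrow> ('a measure \<Rightarrow> ereal) \<Rightarrow> real \<Rightarrow> bool" where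
  "lambda_convex_gg \<omega>0 E lam \<longleftrightarrow>
     (\<forall>\<mu>0\<in>P2 \<omega>0. \<forall>\<mu>1\<in>P2 \<omega>0. \<forall>\<omega>\<in>P2 \<omega>0. \<exists>w\<in>transport_plans \<omega> \<mu>0 \<mu>1.
        \<forall>\<alpha>\<in>{0..1}. E (gen_geod w \<alpha>) \<le>
          ereal (1 - \<alpha>) * E \<mu>0 + ereal \<alpha> * E \<mu>1
          - ereal (\<alpha> * (1 - \<alpha>) * lam / 2) * enn2ereal (W2plan_sq w))"

definition Jstep :: "'a::euclidean_space measure \<Rightarrow> ('a measure \<Rightarrow> ereal) \<Rightarrow> real \<Rightarrow> 'a measure \<Rightarrow> 'a measure" where
  "Jstep \<omega>0 E \<tau> \<mu> = (SOME \<nu>. \<nu> \<in> P2 \<omega>0 \<and>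
      (\<forall>\<nu>'\<in>P2 \<omega>0. ereal (1 / (2 * \<tau>)) * enn2ereal (W2sq \<mu> \<nu>) + E \<nu>
                   \<le> ereal (1 / (2 * \<tau>)) * enn2ereal (W2sq \<mu> \<nu>') + E \<nu>'))"

definition Sflow :: "'a::euclidean_space measure \<Rightarrow> ('a measure \<Rightarrow> ereal) \<Rightarrow> real \<Rightarrow> 'a measure \<Rightarrow> 'a measure" where
  "Sflow \<omega>0 E t \<mu> = (THE \<nu>. \<nu> \<in> P2 \<omega>0 \<and>
      (\<lambda>n. W2 ((Jstep \<omega>0 E (t / real n) ^^ n) \<mu>) \<nu>) \<longlonglongrightarrow> 0)"

definition slope :: "'a::euclidean_space measure \<Rightarrow> ('a measure \<Rightarrow> ereal) \<Rightarrow> 'a measure \<Rightarrow> ereal" where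
  "slope \<omega>0 E \<mu> = (INF \<delta>\<in>{0::real<..}. sup 0 (SUP \<nu>\<in>{\<nu>\<in>P2 \<omega>0. 0 < W2 \<mu> \<nu> \<and> W2 \<mu> \<nu> < ennreal \<delta>}.
       max 0 (E \<mu> - E \<nu>) / enn2ereal (W2 \<mu> \<nu>)))"

definition disc_flow :: "'a::euclidean_space measure \<Rightarrow> ('a measure \<Rightarrow> ereal) \<Rightarrow> real list \<Rightarrow> 'a measure \<Rightarrow> 'a measure" where
  "disc_flow \<omega>0 E hs \<mu> = foldl (\<lambda>\<nu> h. Jstep \<omega>0 E h \<nu>) \<mu> hs"

definition admissible_steps :: "real \<Rightarrow> real list \<Rightarrow> bool" where
  "admissible_steps t hs \<longleftrightarrow> hs \<noteq> [] \<and> (\<forall>h\<in>set hs. 0 < h) \<and> sum_list hs = t"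

end

theory Submission
  imports Defs "HOL-Real_Asymp.Real_Asymp"
begin

text \<open>
  Convexity along generalized geodesics with base \<open>x\<close> makes \<open>v \<mapsto> W\<^sub>2(x,v)\<^sup>2/(2h) + E v\<close> uniformly convex,
  so the minimizer \<open>y = J\<^sub>h x\<close> exists in the complete space \<open>P2 \<omega>0\<close> and satisfies, with \<open>a = \<lambda>\<^sup>-\<close>,
  the variational inequality
  \<open>(1 - a h) W\<^sub>2(y,v)\<^sup>2 - W\<^sub>2(x,v)\<^sup>2 + W\<^sub>2(x,y)\<^sup>2 \<le> 2 h (E v - E y)\<close>.
  For two discrete flows \<open>x\<^sub>i, y\<^sub>j\<close> with steps \<open>h, k\<close>, add \<open>k\<close> times the inequality for \<open>x\<^sub>i\<close> tested
  with \<open>y\<^sub>j\<close> to \<open>h\<close> times the one for \<open>y\<^sub>j\<close> tested with \<open>x\<^sub>i\<close>. The energies cancel and the squared distances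
  \<open>D\<^sub>i\<^sub>j\<close> obey the Crandall-Liggett-Kobayashi recursion
  \<open>(h + k - 2 a h k) D\<^sub>i\<^sub>j \<le> k D\<^sub>i\<^sub>-\<^sub>1\<^sub>j + h D\<^sub>i\<^sub>j\<^sub>-\<^sub>1\<close>. The slope at \<open>\<mu>\<close> controls the boundary values, and a supersolution
  gives \<open>D\<^sub>i\<^sub>j \<le> |\<partial>E|(\<mu>)\<^sup>2 ((t - s)\<^sup>2 + |h| t + |k| s) exp (4 a (t + s))\<close>
  at times \<open>t\<close> and \<open>s\<close>. At \<open>s = t\<close> this shows that \<open>J\<^sub>t\<^sub>/\<^sub>n\<^sup>n \<mu>\<close> is Cauchy and bounds the distance of
  its limit to any discrete flow by \<open>|\<partial>E|(\<mu>) sqrt (|h| t) exp (4 a t)\<close>.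
\<close>

text \<open>In dimension above one the squared Wasserstein distance from a point is not uniformly
  convex along ordinary geodesics, so the Lipschitz bound for resolvents that drives the Banach
  space argument is not at hand. A generalized geodesic repairs this for one point only, its base.
  Basing it at the start \<open>x\<close> of each step gives the variational inequality, and testing
  one flow against the other takes over the role of the Lipschitz bound. Elements of
  \<open>P2 \<omega>0\<close> may have infinite second moment. Tightness therefore has to be
  inherited from \<open>\<omega>0\<close> through couplings of bounded cost, and membership of
  generalized geodesics in \<open>P2 \<omega>0\<close> needs an argument of its own. Since
  minimizers come from uniform convexity, weak compactness serves completeness of the space alone;
  the space-filling curve reduces that compactness to the real line. The slope at
  \<open>\<mu>\<close> does double duty: together with convexity it bounds the energy below by a
  quadratic, which makes the minimization problems bounded below for steps with
  \<open>a h \<le> 1/2\<close>.\<close>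

subsection \<open>Schoenberg's space-filling curve\<close>

text \<open>The triangle wave of period 2, written with \<open>arccos\<close> and \<open>cos\<close>
  so that continuity and periodicity come for free.\<close>

definition tri_wave :: "real \<Rightarrow> real" where
  "tri_wave t = arccos (cos (pi * t)) / pi"

lemma tri_wave_ident: "0 \<le> t \<Longrightarrow> t \<le> 1 \<Longrightarrow> tri_wave t = t"
  by (simp add: tri_wave_def arccos_cos)

lemma tri_wave_periodic: "tri_wave (2 * real n + t) = tri_wave t"
proof -
  have "cos (pi * (2 * real n + t)) = cos (pi * t)"
    using cos.plus_of_nat[of "pi * t" n] by (simp add: algebra_simps)
  then show ?thesis by (simp add: tri_wave_def)
qed

lemma continuous_on_tri_wave: "continuous_on UNIV tri_wave"
  unfolding tri_wave_def by (intro continuous_intros) auto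

text \<open>Schoenberg's function: it is 0 on [0, 1/3] and 1 on [2/3, 1], so it reads the leading
  ternary digit of a point of the Cantor set.\<close>

definition clamp_wave :: "real \<Rightarrow> real" where
  "clamp_wave t = max 0 (min 1 (3 * tri_wave t - 1))"

lemma clamp_wave_periodic: "clamp_wave (2 * real n + t) = clamp_wave t"
  by (simp add: clamp_wave_def tri_wave_periodic)

lemma continuous_on_clamp_wave: "continuous_on UNIV clamp_wave"
  unfolding clamp_wave_def
  by (intro continuous_intros continuous_on_tri_wave)

lemma clamp_wave_bounds: "0 \<le> clamp_wave t" "clamp_wave t \<le> 1"
  by (auto simp: clamp_wave_def)

text \<open>Coordinate \<open>i\<close> of a curve in dimension \<open>m\<close>. For
  \<open>t\<close> in the Cantor set, its binary digits are half the ternary digits of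
  \<open>t\<close> at the positions congruent to \<open>i\<close> modulo \<open>m\<close>.\<close>

definition schoenberg :: "nat \<Rightarrow> nat \<Rightarrow> real \<Rightarrow> real" where
  "schoenberg m i t = (\<Sum>k. (1/2) ^ Suc k * clamp_wave (3 ^ (m * k + i) * t))"

lemma summable_half_powers: "summable (\<lambda>k. (1/2::real) ^ Suc k)"
  using power_half_series by (rule sums_summable)

lemma continuous_on_schoenberg: "continuous_on UNIV (schoenberg m i)"
proof -
  have lim: "uniform_limit UNIV (\<lambda>n t. \<Sum>k<n. (1/2) ^ Suc k * clamp_wave (3 ^ (m * k + i) * t))
     (\<lambda>t. schoenberg m i t) sequentially"
    unfolding schoenberg_def
    by (rule Weierstrass_m_test[OF _ summable_half_powers])
       (use clamp_wave_bounds in \<open>auto simp: abs_mult\<close>)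
  have "continuous_on UNIV (\<lambda>t. \<Sum>k<n. (1/2::real) ^ Suc k * clamp_wave (3 ^ (m * k + i) * t))" for n
    by (intro continuous_intros continuous_on_compose2[OF continuous_on_clamp_wave]) auto
  then show ?thesis
    by (intro uniform_limit_theorem[OF _ lim]) auto
qed

lemma schoenberg_periodic: "schoenberg m i (2 * real n + t) = schoenberg m i t"
proof -
  have "clamp_wave (3 ^ k * (2 * real n + t)) = clamp_wave (3 ^ k * t)" for k :: nat
    using clamp_wave_periodic[of "3 ^ k * n" "3 ^ k * t"] by (simp add: algebra_simps)
  then show ?thesis by (simp add: schoenberg_def)
qed

text \<open>The witness is the Cantor point with ternary digits \<open>2 * b k\<close>.
  Multiplication by \<open>3 ^ k\<close> shifts its expansion and adds an even integer, which the
  period 2 removes; the leading digit of the shifted point then decides the value.\<close>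

lemma clamp_wave_digits:
  fixes b :: "nat \<Rightarrow> nat"
  assumes b: "\<And>k. b k \<le> 1"
  obtains t where "0 \<le> t" "t \<le> 1" "\<And>k. clamp_wave (3 ^ k * t) = real (b k)"
proof -
  have geo: "(\<lambda>j. 2 * (1/3) ^ Suc j) sums (1::real)"
  proof -
    have "(\<lambda>j. (2/3) * (1/3) ^ j) sums ((2/3) * (1 / (1 - 1/3::real)))"
      by (intro sums_mult geometric_sums) auto
    then show ?thesis by (simp add: field_simps)
  qed
  define U where "U k = (\<Sum>j. 2 * real (b (k + j)) * (1/3) ^ Suc j)" for k
  have le: "2 * real (b (k + j)) * (1/3) ^ Suc j \<le> 2 * (1/3) ^ Suc j" for k j
    using b[of "k + j"] by (intro mult_right_mono) auto
  have summ: "summable (\<lambda>j. 2 * real (b (k + j)) * (1/3) ^ Suc j)" for k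
    by (rule summable_comparison_test'[OF sums_summable[OF geo]])
       (use le in \<open>auto simp: abs_mult\<close>)
  have U0: "0 \<le> U k" for k
    unfolding U_def by (intro suminf_nonneg summ) auto
  have U1: "U k \<le> 1" for k
    using suminf_le[OF le summ sums_summable[OF geo]] sums_unique[OF geo] by (simp add: U_def)
  have Urec: "U k = 2 * real (b k) / 3 + U (Suc k) / 3" for k
  proof -
    have "U k = (\<Sum>j. 2 * real (b (k + Suc j)) * (1/3) ^ Suc (Suc j)) + 2 * real (b (k + 0)) * (1/3) ^ Suc 0"
      unfolding U_def using suminf_split_head[OF summ[of k]] by simp
    also have "(\<Sum>j. 2 * real (b (k + Suc j)) * (1/3) ^ Suc (Suc j)) = U (Suc k) / 3"
      unfolding U_def using suminf_divide[OF summ[of "Suc k"], of 3] by simp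
    finally show ?thesis by simp
  qed
  have shift: "\<exists>n. 3 ^ k * U 0 = 2 * real n + U k" for k
  proof (induction k)
    case 0
    then show ?case by (auto intro: exI[of _ 0])
  next
    case (Suc k)
    then obtain n where "3 ^ k * U 0 = 2 * real n + U k" by blast
    then have "3 ^ Suc k * U 0 = 2 * real (3 * n + b k) + U (Suc k)"
      using Urec[of k] by simp
    then show ?case by blast
  qed
  have "clamp_wave (3 ^ k * U 0) = real (b k)" for k
  proof -
    obtain n where "3 ^ k * U 0 = 2 * real n + U k" using shift by blast
    then have "clamp_wave (3 ^ k * U 0) = max 0 (min 1 (3 * U k - 1))"
      by (simp add: clamp_wave_periodic) (simp add: clamp_wave_def tri_wave_ident U0 U1)
    also have "\<dots> = real (b k)"
    proof (cases "b k = 0")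
      case True
      then show ?thesis using Urec[of k] U1[of "Suc k"] by simp
    next
      case False
      then have "b k = 1" using b[of k] by simp
      then show ?thesis using Urec[of k] U0[of "Suc k"] by simp
    qed
    finally show ?thesis .
  qed
  then show ?thesis using that U0 U1 by blast
qed

lemma binary_digits:
  fixes y :: real
  assumes "0 \<le> y" "y < 1"
  obtains b :: "nat \<Rightarrow> nat" where "\<And>k. b k \<le> 1" "(\<lambda>k. (1/2) ^ Suc k * real (b k)) sums y"
proof -
  define b where "b k = nat (\<lfloor>2 ^ Suc k * y\<rfloor> - 2 * \<lfloor>2 ^ k * y\<rfloor>)" for k
  have fl: "0 \<le> \<lfloor>2 ^ Suc k * y\<rfloor> - 2 * \<lfloor>2 ^ k * y\<rfloor> \<and> \<lfloor>2 ^ Suc k * y\<rfloor> - 2 * \<lfloor>2 ^ k * y\<rfloor> \<le> 1" for k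
  proof -
    have "2 ^ Suc k * y = 2 * (2 ^ k * y)" by simp
    then show ?thesis by linarith
  qed
  \<comment> \<open>The digits telescope, so the partial sums are the dyadic truncations of
    \<open>y\<close>; at \<open>n = 0\<close> this uses \<open>y < 1\<close>.\<close>
  have part: "(\<Sum>k<n. (1/2) ^ Suc k * real (b k)) = of_int \<lfloor>2 ^ n * y\<rfloor> / 2 ^ n" for n
  proof (induction n)
    case 0
    then show ?case using assms by (simp add: floor_eq_iff)
  next
    case (Suc n)
    have "real (b n) = of_int \<lfloor>2 ^ Suc n * y\<rfloor> - 2 * of_int \<lfloor>2 ^ n * y\<rfloor>"
      using fl[of n] by (simp add: b_def)
    then show ?case using Suc by (simp add: field_simps)
  qed
  have "(\<lambda>n. of_int \<lfloor>2 ^ n * y\<rfloor> / 2 ^ n) \<longlonglongrightarrow> y"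
  proof (rule real_tendsto_sandwich)
    show "\<forall>\<^sub>F n in sequentially. y - (1/2) ^ n \<le> of_int \<lfloor>2 ^ n * y\<rfloor> / 2 ^ n"
    proof (rule always_eventually, rule allI)
      fix n
      have "2 ^ n * y - 1 \<le> of_int \<lfloor>2 ^ n * y\<rfloor>" by linarith
      then show "y - (1/2) ^ n \<le> of_int \<lfloor>2 ^ n * y\<rfloor> / 2 ^ n"
        using divide_right_mono[of "2 ^ n * y - 1" "of_int \<lfloor>2 ^ n * y\<rfloor>" "2 ^ n"]
        by (simp add: diff_divide_distrib power_one_over)
    qed
    show "\<forall>\<^sub>F n in sequentially. of_int \<lfloor>2 ^ n * y\<rfloor> / 2 ^ n \<le> y"
    proof (rule always_eventually, rule allI)
      fix n
      have "of_int \<lfloor>2 ^ n * y\<rfloor> \<le> 2 ^ n * y" by linarith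
      then show "of_int \<lfloor>2 ^ n * y\<rfloor> / 2 ^ n \<le> y" by (simp add: field_simps)
    qed
    have "(\<lambda>n. y - (1/2) ^ n) \<longlonglongrightarrow> y - 0"
      by (intro tendsto_intros LIMSEQ_realpow_zero) auto
    then show "(\<lambda>n. y - (1/2) ^ n) \<longlonglongrightarrow> y" by simp
  qed auto
  then have "(\<lambda>k. (1/2) ^ Suc k * real (b k)) sums y"
    by (simp only: sums_def part)
  moreover have "b k \<le> 1" for k using fl[of k] unfolding b_def by linarith
  ultimately show ?thesis using that by blast
qed

lemma schoenberg_surj:
  fixes y :: "nat \<Rightarrow> real"
  assumes "m > 0" and y: "\<And>i. i < m \<Longrightarrow> 0 \<le> y i \<and> y i < 1"
  obtains t where "0 \<le> t" "t \<le> 1" "\<And>i. i < m \<Longrightarrow> schoenberg m i t = y i"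
proof -
  have "\<forall>i. \<exists>b :: nat \<Rightarrow> nat. i < m \<longrightarrow> (\<forall>k. b k \<le> 1) \<and> (\<lambda>k. (1/2) ^ Suc k * real (b k)) sums y i"
    using y binary_digits by metis
  then obtain b :: "nat \<Rightarrow> nat \<Rightarrow> nat" where
    b: "\<And>i k. i < m \<Longrightarrow> b i k \<le> 1" "\<And>i. i < m \<Longrightarrow> (\<lambda>k. (1/2) ^ Suc k * real (b i k)) sums y i"
    by metis
  \<comment> \<open>Interleaving: position \<open>j\<close> carries digit \<open>j div m\<close> of
    coordinate \<open>j mod m\<close>.\<close>
  obtain t where t: "0 \<le> t" "t \<le> 1" "\<And>j. clamp_wave (3 ^ j * t) = real (b (j mod m) (j div m))"
    using clamp_wave_digits[of "\<lambda>j. b (j mod m) (j div m)"] b(1) \<open>m > 0\<close> by auto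
  have "schoenberg m i t = y i" if "i < m" for i
    using b(2)[OF that] that \<open>m > 0\<close> by (simp add: schoenberg_def t(3) sums_iff)
  then show ?thesis using that t by blast
qed

text \<open>The bound \<open>B\<close>, uniform over a ball, says more than surjectivity: bounded
  sets are covered by bounded parameter intervals, and this is what carries tightness to the
  line.\<close>

lemma space_filling_curve:
  obtains f :: "real \<Rightarrow> 'a::euclidean_space" where "continuous_on UNIV f"
    "\<And>R. \<exists>B. \<forall>x. norm x \<le> R \<longrightarrow> (\<exists>t\<in>{0..B}. f t = x)"
proof -
  define m where "m = DIM('a)"
  have "m > 0" by (simp add: m_def)
  obtain idx where idx: "bij_betw idx (Basis :: 'a set) {0..<m}"
    using ex_bij_betw_finite_nat[OF finite_Basis] unfolding m_def by blast
  \<comment> \<open>\<open>t - tri_wave t\<close> equals \<open>2 j\<close> on \<open>[2 j, 2 j + 1]\<close>, where \<open>f\<close> therefore covers the cube of half-width \<open>2 j\<close>.\<close>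
  define f :: "real \<Rightarrow> 'a" where
    "f t = (t - tri_wave t) *\<^sub>R (\<Sum>b\<in>Basis. (2 * schoenberg m (idx b) t - 1) *\<^sub>R b)" for t
  have "continuous_on UNIV f"
    unfolding f_def by (intro continuous_intros continuous_on_tri_wave continuous_on_schoenberg)
  moreover have "\<exists>B. \<forall>x. norm x \<le> R \<longrightarrow> (\<exists>t\<in>{0..B}. f t = x)" for R
  proof -
    obtain j where j: "real j > \<bar>R\<bar>" using reals_Archimedean2 by blast
    have "\<exists>t\<in>{0..2 * real j + 1}. f t = x" if x: "norm x \<le> R" for x
    proof -
      \<comment> \<open>The position of \<open>x\<close> in the cube of half-width
        \<open>2 * j\<close>, rescaled to the unit cube; \<open>j > \<bar>R\<bar>\<close> keeps
        every coordinate strictly below 1, as binary digits require.\<close>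
      define y where "y i = (1 + (x \<bullet> inv_into Basis idx i) / (2 * real j)) / 2" for i
      have "0 \<le> y i \<and> y i < 1" if "i < m" for i
      proof -
        have "inv_into Basis idx i \<in> Basis"
          using idx that by (metis atLeastLessThan_iff bij_betw_def inv_into_into zero_le)
        then have "\<bar>x \<bullet> inv_into Basis idx i\<bar> \<le> norm x" by (rule Basis_le_norm)
        then have "\<bar>x \<bullet> inv_into Basis idx i\<bar> < 2 * real j" using x j by linarith
        then have "\<bar>(x \<bullet> inv_into Basis idx i) / (2 * real j)\<bar> < 1" by simp
        then show ?thesis unfolding y_def abs_less_iff by auto
      qed
      then obtain t where t: "0 \<le> t" "t \<le> 1" "\<And>i. i < m \<Longrightarrow> schoenberg m i t = y i"
        using schoenberg_surj[OF \<open>m > 0\<close>] by blast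
      have "f (2 * real j + t) = (2 * real j) *\<^sub>R (\<Sum>b\<in>Basis. (2 * y (idx b) - 1) *\<^sub>R b)"
      proof -
        have "idx b < m" if "b \<in> Basis" for b using idx that by (auto simp: bij_betw_def)
        then show ?thesis
          using t by (simp add: f_def tri_wave_periodic tri_wave_ident schoenberg_periodic)
      qed
      also have "\<dots> = (\<Sum>b\<in>Basis. (x \<bullet> b) *\<^sub>R b)"
      proof -
        have "inv_into Basis idx (idx b) = b" if "b \<in> Basis" for b
          using idx that by (auto simp: bij_betw_def)
        moreover have "real j > 0" using j by linarith
        ultimately show ?thesis
          by (intro trans[OF scaleR_sum_right] sum.cong) (auto simp: y_def field_simps)
      qed
      also have "\<dots> = x" by (rule euclidean_representation)
      finally show ?thesis using t by (intro bexI[of _ "2 * real j + t"]) auto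
    qed
    then show ?thesis by blast
  qed
  ultimately show ?thesis using that by blast
qed

subsection \<open>Weak compactness of tight sequences\<close>

definition weakly_converges :: "(nat \<Rightarrow> 'a::euclidean_space measure) \<Rightarrow> 'a measure \<Rightarrow> bool" where
  "weakly_converges \<mu>s \<mu> \<longleftrightarrow> (\<forall>f :: 'a \<Rightarrow> real. continuous_on UNIV f \<and> bounded (range f) \<longrightarrow>
     (\<lambda>n. integral\<^sup>L (\<mu>s n) f) \<longlonglongrightarrow> integral\<^sup>L \<mu> f)"

definition uniformly_tight :: "('a::euclidean_space measure) set \<Rightarrow> bool" where
  "uniformly_tight K \<longleftrightarrow> (\<forall>\<epsilon>>0. \<exists>R. \<forall>\<mu>\<in>K. measure \<mu> {x. norm x > R} < \<epsilon>)"

lemma uniformly_tight_subset: "uniformly_tight K \<Longrightarrow> K' \<subseteq> K \<Longrightarrow> uniformly_tight K'"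
  unfolding uniformly_tight_def by (meson subsetD)

text \<open>A Borel right inverse of the space-filling curve moves the measures to the real line, where
  Helly's selection theorem applies; continuity of the curve carries the weak limit back.\<close>

lemma prokhorov:
  fixes \<mu>s :: "nat \<Rightarrow> 'a::euclidean_space measure"
  assumes prob: "\<And>n. prob_space (\<mu>s n)" and sets: "\<And>n. sets (\<mu>s n) = sets borel"
    and tight: "uniformly_tight (range \<mu>s)"
  obtains r \<mu> where "strict_mono r" "prob_space \<mu>" "sets \<mu> = sets borel"
    "weakly_converges (\<mu>s \<circ> r) \<mu>"
proof -
  obtain f :: "real \<Rightarrow> 'a" where f: "continuous_on UNIV f"
    and onto: "\<And>R. \<exists>B. \<forall>x. norm x \<le> R \<longrightarrow> (\<exists>t\<in>{0..B}. f t = x)"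
    using space_filling_curve by blast
  have fm[measurable]: "f \<in> borel_measurable borel"
    using f by (rule borel_measurable_continuous_onI)
  \<comment> \<open>Taking the least nonnegative parameter makes the inverse Borel: the set where
    \<open>s\<close> is at most \<open>c\<close> is the image of the compact interval
    [0, c].\<close>
  define s where "s x = Inf {t. 0 \<le> t \<and> f t = x}" for x
  have cl: "closed {t. 0 \<le> t \<and> f t = x}" for x
  proof -
    have "{t. 0 \<le> t \<and> f t = x} = {0..} \<inter> f -` {x}" by auto
    then show ?thesis using f by (auto intro!: closed_Int closed_vimage simp: continuous_on_eq_continuous_at)
  qed
  have s: "0 \<le> s x \<and> f (s x) = x" for x
  proof -
    have "{t. 0 \<le> t \<and> f t = x} \<noteq> {}" using onto[of "norm x"] by fastforce
    then have "s x \<in> {t. 0 \<le> t \<and> f t = x}"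
      unfolding s_def by (intro closed_contains_Inf cl) (auto intro: bdd_belowI[of _ 0])
    then show ?thesis by simp
  qed
  have sle: "s x \<le> t" if "0 \<le> t" "f t = x" for x t
    unfolding s_def using that by (intro cInf_lower) (auto intro: bdd_belowI[of _ 0])
  have sm[measurable]: "s \<in> borel_measurable borel"
  proof (rule borel_measurableI_le)
    fix c
    have "{x. s x \<le> c} = f ` {0..c}"
    proof safe
      fix x assume "s x \<le> c"
      then show "x \<in> f ` {0..c}" using s[of x] by (intro image_eqI[of _ _ "s x"]) auto
    next
      fix t assume "t \<in> {0..c}"
      then show "s (f t) \<le> c" using sle[of t "f t"] by auto
    qed
    moreover have "compact (f ` {0..c})"
      using f by (intro compact_continuous_image) (auto intro: continuous_on_subset)
    ultimately show "{x \<in> space borel. s x \<le> c} \<in> sets borel"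
      by (auto intro: borel_closed compact_imp_closed)
  qed
  define \<nu> where "\<nu> n = distr (\<mu>s n) borel s" for n
  have sm'[measurable]: "s \<in> borel_measurable (\<mu>s n)" for n
    using sm measurable_cong_sets[OF sets refl] by blast
  have rd: "real_distribution (\<nu> n)" for n
    unfolding \<nu>_def using prob_space.real_distribution_distr[OF prob sm'] .
  have "tight \<nu>"
    unfolding tight_def
  proof (intro conjI allI impI rd)
    fix e :: real assume "e > 0"
    then obtain R where R: "\<And>n. measure (\<mu>s n) {x. norm x > R} < e"
      using tight unfolding uniformly_tight_def by blast
    obtain B where B: "\<And>x :: 'a. norm x \<le> R \<Longrightarrow> \<exists>t\<in>{0..B}. f t = x" using onto by blast
    \<comment> \<open>The library's \<open>tight\<close> asks for half-open intervals with
      \<open>a < b\<close>. The left end -1 keeps the parameter 0 inside, and the maximum keeps the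
      interval nonempty.\<close>
    have "measure (\<nu> n) {-1<..max 0 B} > 1 - e" for n
    proof -
      interpret prob_space "\<mu>s n" by (rule prob)
      have sp: "space (\<mu>s n) = UNIV" using sets_eq_imp_space_eq[OF sets] by simp
      have m: "{x. norm x > R} \<in> sets (\<mu>s n)" "{x. \<not> norm x > R} \<in> sets (\<mu>s n)" unfolding sets by measurable
      have "1 - e < prob {x. \<not> norm x > R}"
        using R[of n] prob_neg[of "\<lambda>x. norm x > R"] m sp by simp
      also have "\<dots> \<le> prob (s -` {-1<..max 0 B} \<inter> space (\<mu>s n))"
      proof (rule finite_measure_mono)
        show "{x. \<not> norm x > R} \<subseteq> s -` {-1<..max 0 B} \<inter> space (\<mu>s n)"
        proof
          fix x :: 'a assume "x \<in> {x. \<not> norm x > R}"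
          then obtain t where "t \<in> {0..B}" "f t = x" using B[of x] by auto
          then show "x \<in> s -` {-1<..max 0 B} \<inter> space (\<mu>s n)"
            using sle[of t x] s[of x] by (auto simp: sp)
        qed
        show "s -` {-1<..max 0 B} \<inter> space (\<mu>s n) \<in> events" by measurable
      qed
      also have "\<dots> = measure (\<nu> n) {-1<..max 0 B}"
        unfolding \<nu>_def by (simp add: measure_distr)
      finally show ?thesis .
    qed
    then show "\<exists>a b. a < b \<and> (\<forall>n. 1 - e < measure (\<nu> n) {a<..b})"
      by (intro exI[of _ "-1"] exI[of _ "max 0 B"]) auto
  qed
  then obtain r N where r: "strict_mono (r :: nat \<Rightarrow> nat)" and N: "real_distribution N"
    and conv: "weak_conv_m (\<nu> \<circ> id \<circ> r) N"
    using tight_imp_convergent_subsubsequence[of \<nu> id] strict_mono_id by blast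
  interpret N: real_distribution N by (rule N)
  have "weakly_converges (\<mu>s \<circ> r) (distr N borel f)"
    unfolding weakly_converges_def
  proof (intro allI impI, elim conjE)
    fix g :: "'a \<Rightarrow> real" assume g: "continuous_on UNIV g" "bounded (range g)"
    have gm[measurable]: "g \<in> borel_measurable borel"
      using g(1) by (rule borel_measurable_continuous_onI)
    obtain B where B: "\<And>x. norm (g x) \<le> B" using g(2) by (auto simp: bounded_iff)
    have "continuous_on UNIV (g \<circ> f)"
      using f g(1) by (intro continuous_on_compose) (auto intro: continuous_on_subset)
    then have "isCont (\<lambda>x. g (f x)) x" for x
      by (simp add: continuous_on_eq_continuous_at o_def)
    then have "(\<lambda>n. integral\<^sup>L ((\<nu> \<circ> id \<circ> r) n) (\<lambda>x. g (f x))) \<longlonglongrightarrow> integral\<^sup>L N (\<lambda>x. g (f x))"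
      using weak_conv_imp_integral_bdd_continuous_conv[OF _ N conv, of "\<lambda>x. g (f x)" B] rd B by auto
    moreover have "integral\<^sup>L ((\<nu> \<circ> id \<circ> r) n) (\<lambda>x. g (f x)) = integral\<^sup>L ((\<mu>s \<circ> r) n) g" for n
      by (simp add: \<nu>_def integral_distr s)
    moreover have "integral\<^sup>L N (\<lambda>x. g (f x)) = integral\<^sup>L (distr N borel f) g"
      by (simp add: integral_distr)
    ultimately show "(\<lambda>n. integral\<^sup>L ((\<mu>s \<circ> r) n) g) \<longlonglongrightarrow> integral\<^sup>L (distr N borel f) g"
      by simp
  qed
  moreover have "prob_space (distr N borel f)" by (intro N.prob_space_distr) simp
  ultimately show ?thesis using that r by auto
qed

text \<open>Closed sets form an intersection-stable generator, and the indicator of a nonempty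
  closed set is the pointwise limit of the cut-offs
  \<open>max 0 (1 - n * infdist x C)\<close>.\<close>

lemma measure_eqI_bounded_continuous:
  fixes \<mu> \<nu> :: "'a::euclidean_space measure"
  assumes "prob_space \<mu>" "prob_space \<nu>" and sets: "sets \<mu> = sets borel" "sets \<nu> = sets borel"
    and eq: "\<And>f :: 'a \<Rightarrow> real. continuous_on UNIV f \<Longrightarrow> bounded (range f) \<Longrightarrow> integral\<^sup>L \<mu> f = integral\<^sup>L \<nu> f"
  shows "\<mu> = \<nu>"
proof -
  interpret M: prob_space \<mu> by fact
  interpret N: prob_space \<nu> by fact
  have closed_eq: "emeasure \<mu> C = emeasure \<nu> C" if "closed C" for C
  \<comment> \<open>\<open>infdist\<close> to the empty set is 0 by convention, so the cut-offs
    would converge to 1 there.\<close>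
  proof (cases "C = {}")
    case False
    define f :: "nat \<Rightarrow> 'a \<Rightarrow> real" where "f n x = max 0 (1 - real n * infdist x C)" for n x
    have cont: "continuous_on UNIV (f n)" for n
      unfolding f_def by (intro continuous_intros)
    have fb: "0 \<le> f n x \<and> f n x \<le> 1" for n x
      by (auto simp: f_def infdist_nonneg)
    have bdd: "bounded (range (f n))" for n
      using fb by (intro boundedI[of _ 1]) auto
    have lim: "(\<lambda>n. f n x) \<longlonglongrightarrow> indicator C x" for x
    proof (cases "x \<in> C")
      case True
      then show ?thesis by (simp add: f_def)
    next
      case False
      then have pos: "infdist x C > 0"
        using \<open>closed C\<close> \<open>C \<noteq> {}\<close> infdist_pos_not_in_closed by blast
      obtain n0 :: nat where n0: "real n0 * infdist x C > 1"
        using reals_Archimedean3[OF pos] by blast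
      have "f n x = 0" if "n \<ge> n0" for n
      proof -
        have "real n0 * infdist x C \<le> real n * infdist x C"
          using that by (intro mult_right_mono) (auto simp: infdist_nonneg)
        then show ?thesis using n0 by (simp add: f_def)
      qed
      then show ?thesis
        using False by (intro tendsto_eventually eventually_sequentiallyI[of n0]) auto
    qed
    have "(\<lambda>n. integral\<^sup>L M (f n)) \<longlonglongrightarrow> measure M C" if "prob_space M" "sets M = sets borel" for M
    proof -
      interpret prob_space M by fact
      have C: "C \<in> sets M" using that \<open>closed C\<close> by simp
      have m: "f n \<in> borel_measurable M" for n
        using borel_measurable_continuous_onI[OF cont] measurable_cong_sets[OF that(2) refl] by blast
      have "(\<lambda>n. integral\<^sup>L M (f n)) \<longlonglongrightarrow> integral\<^sup>L M (indicator C)"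
        by (rule integral_dominated_convergence[where w = "\<lambda>_. 1"]) (use m C lim fb in auto)
      then show ?thesis using C by simp
    qed
    from LIMSEQ_unique[OF this[of \<mu>]] this[of \<nu>] assms eq[OF cont bdd]
    have "measure \<mu> C = measure \<nu> C" by simp
    then show ?thesis by (simp add: M.emeasure_eq_measure N.emeasure_eq_measure)
  qed simp
  show ?thesis
  proof (rule measure_eqI_generator_eq[where E = "Collect closed" and \<Omega> = UNIV and A = "\<lambda>_. UNIV"])
    show "Int_stable (Collect closed :: 'a set set)" by (auto simp: Int_stable_def)
    show "sets \<mu> = sigma_sets UNIV (Collect closed)" "sets \<nu> = sigma_sets UNIV (Collect closed)"
      by (simp_all add: sets borel_eq_closed)
  qed (use closed_eq in auto)
qed

lemma weakly_converges_distr: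
  fixes \<mu>s :: "nat \<Rightarrow> 'a::euclidean_space measure" and f :: "'a \<Rightarrow> 'b::euclidean_space"
  assumes conv: "weakly_converges \<mu>s \<mu>" and sets: "\<And>n. sets (\<mu>s n) = sets borel" "sets \<mu> = sets borel"
    and f: "continuous_on UNIV f"
  shows "weakly_converges (\<lambda>n. distr (\<mu>s n) borel f) (distr \<mu> borel f)"
  unfolding weakly_converges_def
proof (intro allI impI, elim conjE)
  fix g :: "'b \<Rightarrow> real" assume g: "continuous_on UNIV g" "bounded (range g)"
  have gm[measurable]: "g \<in> borel_measurable borel"
    using g(1) by (rule borel_measurable_continuous_onI)
  have fm: "f \<in> borel_measurable M" if "sets M = sets borel" for M
    using borel_measurable_continuous_onI[OF f] measurable_cong_sets[OF that refl] by blast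
  have "continuous_on UNIV (\<lambda>x. g (f x))"
    by (rule continuous_on_compose2[OF g(1) f]) auto
  moreover have "bounded (range (\<lambda>x. g (f x)))" using g(2) by (rule bounded_subset) auto
  ultimately have "(\<lambda>n. integral\<^sup>L (\<mu>s n) (\<lambda>x. g (f x))) \<longlonglongrightarrow> integral\<^sup>L \<mu> (\<lambda>x. g (f x))"
    using conv unfolding weakly_converges_def by blast
  then show "(\<lambda>n. integral\<^sup>L (distr (\<mu>s n) borel f) g) \<longlonglongrightarrow> integral\<^sup>L (distr \<mu> borel f) g"
    using sets fm by (simp add: integral_distr)
qed

lemma weakly_converges_unique:
  assumes "weakly_converges \<mu>s \<mu>" "weakly_converges \<mu>s \<nu>"
    and "prob_space \<mu>" "prob_space \<nu>" "sets \<mu> = sets borel" "sets \<nu> = sets borel"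
  shows "\<mu> = \<nu>"
  using assms by (intro measure_eqI_bounded_continuous) (auto simp: weakly_converges_def intro: LIMSEQ_unique)

lemma weakly_converges_subseq:
  "weakly_converges \<mu>s \<mu> \<Longrightarrow> strict_mono r \<Longrightarrow> weakly_converges (\<mu>s \<circ> r) \<mu>"
  unfolding weakly_converges_def using LIMSEQ_subseq_LIMSEQ by (fastforce simp: o_def)

subsection \<open>Couplings and the Wasserstein distance\<close>

lemma measurable_borelD:
  "f \<in> measurable borel N \<Longrightarrow> sets M = sets borel \<Longrightarrow> f \<in> measurable M N"
  using measurable_cong_sets[of M borel N N] by blast

lemma borel_measurable_coordinates [measurable]:
  "(fst :: 'a::euclidean_space \<times> 'b::euclidean_space \<Rightarrow> 'a) \<in> borel_measurable borel"
  "(snd :: 'a::euclidean_space \<times> 'b::euclidean_space \<Rightarrow> 'b) \<in> borel_measurable borel"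
  by (intro borel_measurable_continuous_onI continuous_intros)+

lemma couplings_distr_pair:
  fixes f g :: "'c::euclidean_space \<Rightarrow> 'a::euclidean_space"
  assumes w: "prob_space w" "sets w = sets borel"
    and f: "f \<in> borel_measurable borel" and g: "g \<in> borel_measurable borel"
  shows "distr w borel (\<lambda>p. (f p, g p)) \<in> couplings (distr w borel f) (distr w borel g)"
    and "cost2 (distr w borel (\<lambda>p. (f p, g p))) = (\<integral>\<^sup>+ p. ennreal ((norm (f p - g p))\<^sup>2) \<partial>w)"
proof -
  interpret prob_space w by fact
  note fg = measurable_borelD[OF f w(2)] measurable_borelD[OF g w(2)]
  have p: "(\<lambda>p. (f p, g p)) \<in> borel_measurable w" using fg by (intro borel_measurable_Pair)
  show "distr w borel (\<lambda>p. (f p, g p)) \<in> couplings (distr w borel f) (distr w borel g)"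
    unfolding couplings_def using p by (auto intro!: prob_space_distr simp: distr_distr comp_def)
  show "cost2 (distr w borel (\<lambda>p. (f p, g p))) = (\<integral>\<^sup>+ p. ennreal ((norm (f p - g p))\<^sup>2) \<partial>w)"
    unfolding cost2_def using p by (subst nn_integral_distr) auto
qed

text \<open>Two random variables on one probability space couple their laws. Upper bounds on
  distances are obtained by choosing that space: a coupling, a 3-plan or a glued measure.\<close>

lemma W2sq_le:
  fixes f g :: "'c::euclidean_space \<Rightarrow> 'a::euclidean_space"
  assumes w: "prob_space w" "sets w = sets borel"
    and f: "f \<in> borel_measurable borel" and g: "g \<in> borel_measurable borel"
  shows "W2sq (distr w borel f) (distr w borel g) \<le> (\<integral>\<^sup>+ p. ennreal ((norm (f p - g p))\<^sup>2) \<partial>w)"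
  unfolding W2sq_def using couplings_distr_pair[OF assms] by (metis INF_lower)

lemma W2sq_commute: "W2sq \<mu> \<nu> = W2sq \<nu> (\<mu> :: 'a::euclidean_space measure)"
proof -
  have "W2sq \<mu> \<nu> \<le> W2sq \<nu> \<mu>" for \<mu> \<nu> :: "'a measure"
    unfolding W2sq_def[of \<nu>]
  proof (rule INF_greatest)
    fix \<gamma> assume \<gamma>: "\<gamma> \<in> couplings \<nu> \<mu>"
    then have "W2sq (distr \<gamma> borel snd) (distr \<gamma> borel fst) \<le> (\<integral>\<^sup>+ p. ennreal ((norm (snd p - fst p))\<^sup>2) \<partial>\<gamma>)"
      by (intro W2sq_le) (auto simp: couplings_def)
    then show "W2sq \<mu> \<nu> \<le> cost2 \<gamma>"
      using \<gamma> by (simp add: couplings_def cost2_def norm_minus_commute)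
  qed
  then show ?thesis by (intro antisym)
qed

lemma W2sq_self: "\<mu> \<in> Pm \<Longrightarrow> W2sq \<mu> \<mu> = 0"
  using W2sq_le[of \<mu> "\<lambda>x. x" "\<lambda>x. x"] by (auto simp: Pm_def distr_id2)

text \<open>Attainment of the infimum is what turns a zero distance into a coupling of zero cost,
  which lives on the diagonal.\<close>

lemma W2sq_zero_imp_eq:
  assumes "\<gamma> \<in> optimal_couplings \<mu> \<nu>" "W2sq \<mu> \<nu> = 0"
  shows "\<mu> = \<nu>"
proof -
  have \<gamma>: "prob_space \<gamma>" "sets \<gamma> = sets borel" "distr \<gamma> borel fst = \<mu>" "distr \<gamma> borel snd = \<nu>" "cost2 \<gamma> = 0"
    using assms by (auto simp: optimal_couplings_def couplings_def)
  note [measurable] = measurable_borelD[OF borel_measurable_coordinates(1) \<gamma>(2)]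
    measurable_borelD[OF borel_measurable_coordinates(2) \<gamma>(2)]
  have "AE p in \<gamma>. ennreal ((norm (fst p - snd p))\<^sup>2) = 0"
    using \<gamma>(5) unfolding cost2_def by (subst (asm) nn_integral_0_iff_AE) auto
  then have "AE p in \<gamma>. fst p = snd p" by eventually_elim simp
  then have "distr \<gamma> borel fst = distr \<gamma> borel snd" by (intro distr_cong_AE) auto
  then show ?thesis using \<gamma> by simp
qed

section \<open>Three-marginal plans and the cost along generalized geodesics\<close>

lemma transport_plansD:
  assumes "w \<in> transport_plans \<omega> \<mu>0 \<mu>1"
  shows "prob_space w" "sets w = sets borel"
    "distr w borel fst = \<omega>" "distr w borel (\<lambda>p. fst (snd p)) = \<mu>0" "distr w borel (\<lambda>p. snd (snd p)) = \<mu>1"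
    "(\<integral>\<^sup>+ p. ennreal ((norm (fst p - fst (snd p)))\<^sup>2) \<partial>w) = W2sq \<omega> \<mu>0"
    "(\<integral>\<^sup>+ p. ennreal ((norm (fst p - snd (snd p)))\<^sup>2) \<partial>w) = W2sq \<omega> \<mu>1"
proof -
  show w: "prob_space w" "sets w = sets borel" using assms by (auto simp: transport_plans_def)
  have m: "fst \<in> borel_measurable (borel :: ('a \<times> 'a \<times> 'a) measure)"
     "(\<lambda>p. fst (snd p)) \<in> borel_measurable (borel :: ('a \<times> 'a \<times> 'a) measure)"
     "(\<lambda>p. snd (snd p)) \<in> borel_measurable (borel :: ('a \<times> 'a \<times> 'a) measure)"
    by measurable
  have o: "distr w borel (\<lambda>p. (fst p, fst (snd p))) \<in> optimal_couplings \<omega> \<mu>0"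
    "distr w borel (\<lambda>p. (fst p, snd (snd p))) \<in> optimal_couplings \<omega> \<mu>1"
    using assms by (simp_all add: transport_plans_def case_prod_beta')
  show "(\<integral>\<^sup>+ p. ennreal ((norm (fst p - fst (snd p)))\<^sup>2) \<partial>w) = W2sq \<omega> \<mu>0"
    using o(1) couplings_distr_pair(2)[OF w m(1,2)] by (simp add: optimal_couplings_def)
  show "(\<integral>\<^sup>+ p. ennreal ((norm (fst p - snd (snd p)))\<^sup>2) \<partial>w) = W2sq \<omega> \<mu>1"
    using o(2) couplings_distr_pair(2)[OF w m(1,3)] by (simp add: optimal_couplings_def)
  show "distr w borel fst = \<omega>" "distr w borel (\<lambda>p. fst (snd p)) = \<mu>0"
    using o(1) couplings_distr_pair(1)[OF w m(1,2)] by (simp_all add: optimal_couplings_def couplings_def)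
  show "distr w borel (\<lambda>p. snd (snd p)) = \<mu>1"
    using o(2) couplings_distr_pair(1)[OF w m(1,3)] by (simp_all add: optimal_couplings_def couplings_def)
qed

text \<open>The difference of the two sides is a square over \<open>X * Y\<close>. Integrated with
  \<open>X\<close> and \<open>Y\<close> close to the two L2 norms, it gives Minkowski's
  inequality.\<close>

lemma square_add_le_weighted:
  fixes a b X Y :: real
  assumes "X > 0" "Y > 0"
  shows "(a + b)\<^sup>2 \<le> (X + Y) / X * a\<^sup>2 + (X + Y) / Y * b\<^sup>2"
proof -
  have "(X + Y) / X * a\<^sup>2 + (X + Y) / Y * b\<^sup>2 - (a + b)\<^sup>2 = (a * Y - b * X)\<^sup>2 / (X * Y)"
    using assms by (simp add: field_simps power2_eq_square)
  moreover have "\<dots> \<ge> 0" using assms by simp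
  ultimately show ?thesis by linarith
qed

text \<open>The Hilbert space identity from which the squared distance to the base of a generalized
  geodesic gets its uniform convexity.\<close>

lemma norm_convex_combination:
  fixes x y z :: "'a::real_inner"
  shows "(norm (x - ((1 - \<alpha>) *\<^sub>R y + \<alpha> *\<^sub>R z)))\<^sup>2 =
    (1 - \<alpha>) * (norm (x - y))\<^sup>2 + \<alpha> * (norm (x - z))\<^sup>2 - \<alpha> * (1 - \<alpha>) * (norm (y - z))\<^sup>2"
  by (simp add: power2_norm_eq_inner inner_diff_left inner_diff_right inner_add_left inner_add_right
      inner_commute algebra_simps)

text \<open>A real-valued distance for use with \<open>Metric_space\<close>. It is 0 where the cost
  is infinite, so it is meaningful only between measures at finite distance.\<close>

definition W2d :: "'a::euclidean_space measure \<Rightarrow> 'a measure \<Rightarrow> real" where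
  "W2d \<mu> \<nu> = sqrt (enn2real (W2sq \<mu> \<nu>))"

lemma W2d_nonneg: "0 \<le> W2d \<mu> \<nu>"
  by (simp add: W2d_def)

lemma W2sq_eq_W2d: "W2sq \<mu> \<nu> < \<infinity> \<Longrightarrow> W2sq \<mu> \<nu> = ennreal ((W2d \<mu> \<nu>)\<^sup>2)"
  by (simp add: W2d_def)

lemma W2_eq_W2d: "W2sq \<mu> \<nu> < \<infinity> \<Longrightarrow> W2 \<mu> \<nu> = ennreal (W2d \<mu> \<nu>)"
  by (simp add: W2_def W2d_def)

lemma P2_iff: "\<mu> \<in> P2 \<omega>0 \<longleftrightarrow> \<mu> \<in> Pm \<and> W2sq \<mu> \<omega>0 < \<infinity>"
  by (auto simp: P2_def W2_def top.not_eq_extremum)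

text \<open>Each estimate integrates a pointwise relation between three points against
  \<open>w\<close>. The nonnegativity clause allows the bound on \<open>gen_geod\<close> to be read
  in the reals, since \<open>ennreal\<close> truncates negative numbers to 0.\<close>

lemma transport_plan_estimates:
  assumes w: "w \<in> transport_plans \<omega> \<mu>0 \<mu>1" and fin: "W2sq \<omega> \<mu>0 < \<infinity>" "W2sq \<omega> \<mu>1 < \<infinity>"
  obtains q where "q \<ge> 0" "W2plan_sq w = ennreal q" "W2sq \<mu>0 \<mu>1 \<le> ennreal q"
    "sqrt q \<le> W2d \<omega> \<mu>0 + W2d \<omega> \<mu>1"
    "\<And>\<alpha>. W2sq \<omega> (gen_geod w \<alpha>) \<le>
        ennreal ((1 - \<alpha>) * (W2d \<omega> \<mu>0)\<^sup>2 + \<alpha> * (W2d \<omega> \<mu>1)\<^sup>2 - \<alpha> * (1 - \<alpha>) * q)"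
    "\<And>\<alpha>. 0 \<le> (1 - \<alpha>) * (W2d \<omega> \<mu>0)\<^sup>2 + \<alpha> * (W2d \<omega> \<mu>1)\<^sup>2 - \<alpha> * (1 - \<alpha>) * q"
    "\<And>\<alpha>. gen_geod w \<alpha> \<in> Pm"
proof -
  note D = transport_plansD[OF w]
  interpret prob_space w by (rule D)
  define x1 x2 x3 where "x1 = (\<lambda>p :: 'a \<times> 'a \<times> 'a. fst p)"
    and "x2 = (\<lambda>p :: 'a \<times> 'a \<times> 'a. fst (snd p))" and "x3 = (\<lambda>p :: 'a \<times> 'a \<times> 'a. snd (snd p))"
  have m: "x1 \<in> borel_measurable borel" "x2 \<in> borel_measurable borel" "x3 \<in> borel_measurable borel"
    unfolding x1_def x2_def x3_def by measurable
  note [measurable] = m m[THEN measurable_borelD, OF D(2)]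
  have has: "integrable w (\<lambda>p. (norm (f p - g p))\<^sup>2) \<and> (\<integral>p. (norm (f p - g p))\<^sup>2 \<partial>w) = r"
    if "(\<integral>\<^sup>+ p. ennreal ((norm (f p - g p))\<^sup>2) \<partial>w) = ennreal r" "r \<ge> 0"
      "f \<in> borel_measurable w" "g \<in> borel_measurable w" for f g :: "'a \<times> 'a \<times> 'a \<Rightarrow> 'a" and r
  proof -
    have "integrable w (\<lambda>p. (norm (f p - g p))\<^sup>2)"
      using that by (intro integrableI_nn_integral_finite[where x = r]) auto
    moreover have "(\<integral>p. (norm (f p - g p))\<^sup>2 \<partial>w) = enn2real (\<integral>\<^sup>+ p. ennreal ((norm (f p - g p))\<^sup>2) \<partial>w)"
      using that by (intro integral_eq_nn_integral) auto
    ultimately show ?thesis using that by simp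
  qed
  have 12: "integrable w (\<lambda>p. (norm (x1 p - x2 p))\<^sup>2)" "(\<integral>p. (norm (x1 p - x2 p))\<^sup>2 \<partial>w) = (W2d \<omega> \<mu>0)\<^sup>2"
    using has[of x1 x2] D(6) W2sq_eq_W2d[OF fin(1)] m[THEN measurable_borelD, OF D(2)]
    by (auto simp: x1_def x2_def)
  have 13: "integrable w (\<lambda>p. (norm (x1 p - x3 p))\<^sup>2)" "(\<integral>p. (norm (x1 p - x3 p))\<^sup>2 \<partial>w) = (W2d \<omega> \<mu>1)\<^sup>2"
    using has[of x1 x3] D(7) W2sq_eq_W2d[OF fin(2)] m[THEN measurable_borelD, OF D(2)]
    by (auto simp: x1_def x3_def)
  have weighted: "(norm (x2 p - x3 p))\<^sup>2 \<le> (X + Y) / X * (norm (x1 p - x2 p))\<^sup>2 + (X + Y) / Y * (norm (x1 p - x3 p))\<^sup>2"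
    if "X > 0" "Y > 0" for X Y p
  proof -
    have "norm (x2 p - x3 p) \<le> norm (x1 p - x2 p) + norm (x1 p - x3 p)"
      using norm_triangle_ineq4[of "x1 p - x3 p" "x1 p - x2 p"] by simp
    then have "(norm (x2 p - x3 p))\<^sup>2 \<le> (norm (x1 p - x2 p) + norm (x1 p - x3 p))\<^sup>2"
      by (intro power_mono) auto
    then show ?thesis using square_add_le_weighted[OF that] order_trans by blast
  qed
  have 23: "integrable w (\<lambda>p. (norm (x2 p - x3 p))\<^sup>2)"
  proof (rule Bochner_Integration.integrable_bound)
    show "integrable w (\<lambda>p. (1 + 1) / 1 * (norm (x1 p - x2 p))\<^sup>2 + (1 + 1) / 1 * (norm (x1 p - x3 p))\<^sup>2)"
      by (intro Bochner_Integration.integrable_add integrable_mult_right 12 13)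
    show "AE p in w. norm ((norm (x2 p - x3 p))\<^sup>2) \<le>
        norm ((1 + 1) / 1 * (norm (x1 p - x2 p))\<^sup>2 + (1 + 1) / 1 * (norm (x1 p - x3 p))\<^sup>2)"
      using weighted[of 1 1] by (intro AE_I2) (simp add: order_trans[OF _ abs_ge_self])
  qed auto
  define q where "q = (\<integral>p. (norm (x2 p - x3 p))\<^sup>2 \<partial>w)"
  have q: "q \<ge> 0" unfolding q_def by (intro integral_nonneg_AE) auto
  have nq: "(\<integral>\<^sup>+ p. ennreal ((norm (x2 p - x3 p))\<^sup>2) \<partial>w) = ennreal q"
    unfolding q_def using 23 by (intro nn_integral_eq_integral) auto
  have plan: "W2plan_sq w = ennreal q" using nq by (simp add: W2plan_sq_def x2_def x3_def)
  have le: "W2sq \<mu>0 \<mu>1 \<le> ennreal q"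
    using W2sq_le[OF D(1,2) m(2,3)] nq D(4,5) by (simp add: x2_def x3_def)
  have "sqrt q \<le> W2d \<omega> \<mu>0 + W2d \<omega> \<mu>1"
  proof (rule field_le_epsilon)
    fix \<epsilon> :: real assume "\<epsilon> > 0"
    \<comment> \<open>The optimal weights would be the two distances; the added
      \<open>\<epsilon> / 2\<close> keeps them positive when a distance vanishes.\<close>
    define X Y where "X = W2d \<omega> \<mu>0 + \<epsilon> / 2" and "Y = W2d \<omega> \<mu>1 + \<epsilon> / 2"
    have XY: "X > 0" "Y > 0" "W2d \<omega> \<mu>0 \<le> X" "W2d \<omega> \<mu>1 \<le> Y"
      using \<open>\<epsilon> > 0\<close> W2d_nonneg[of \<omega> \<mu>0] W2d_nonneg[of \<omega> \<mu>1] by (auto simp: X_def Y_def)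
    have "q \<le> (\<integral>p. (X + Y) / X * (norm (x1 p - x2 p))\<^sup>2 + (X + Y) / Y * (norm (x1 p - x3 p))\<^sup>2 \<partial>w)"
      unfolding q_def
      by (intro integral_mono 23 Bochner_Integration.integrable_add integrable_mult_right 12 13 weighted XY)
    also have "\<dots> = (X + Y) / X * (W2d \<omega> \<mu>0)\<^sup>2 + (X + Y) / Y * (W2d \<omega> \<mu>1)\<^sup>2"
      by (subst Bochner_Integration.integral_add) (simp_all add: 12 13)
    also have "\<dots> \<le> (X + Y) / X * X\<^sup>2 + (X + Y) / Y * Y\<^sup>2"
      using XY by (intro add_mono mult_left_mono power_mono) (auto simp: W2d_nonneg)
    also have "\<dots> = (X + Y) * X + (X + Y) * Y" using XY by (simp add: power2_eq_square)
    also have "\<dots> = (X + Y)\<^sup>2" by (simp add: power2_eq_square algebra_simps)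
    finally have "sqrt q \<le> X + Y" using XY by (intro real_le_lsqrt) (auto simp: q)
    then show "sqrt q \<le> W2d \<omega> \<mu>0 + W2d \<omega> \<mu>1 + \<epsilon>" by (simp add: X_def Y_def)
  qed
  moreover have int: "(\<integral>p. (norm (x1 p - ((1 - \<alpha>) *\<^sub>R x2 p + \<alpha> *\<^sub>R x3 p)))\<^sup>2 \<partial>w) =
        (1 - \<alpha>) * (W2d \<omega> \<mu>0)\<^sup>2 + \<alpha> * (W2d \<omega> \<mu>1)\<^sup>2 - \<alpha> * (1 - \<alpha>) * q" for \<alpha>
    unfolding norm_convex_combination using 12 13 23 by (simp add: q_def)
  have "0 \<le> (1 - \<alpha>) * (W2d \<omega> \<mu>0)\<^sup>2 + \<alpha> * (W2d \<omega> \<mu>1)\<^sup>2 - \<alpha> * (1 - \<alpha>) * q" for \<alpha>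
    unfolding int[symmetric] by (intro integral_nonneg_AE) auto
  moreover have "W2sq \<omega> (gen_geod w \<alpha>) \<le>
        ennreal ((1 - \<alpha>) * (W2d \<omega> \<mu>0)\<^sup>2 + \<alpha> * (W2d \<omega> \<mu>1)\<^sup>2 - \<alpha> * (1 - \<alpha>) * q)" for \<alpha>
  proof -
    have "gen_geod w \<alpha> = distr w borel (\<lambda>p. (1 - \<alpha>) *\<^sub>R x2 p + \<alpha> *\<^sub>R x3 p)"
      by (simp add: gen_geod_def x2_def x3_def case_prod_beta')
    then have "W2sq \<omega> (gen_geod w \<alpha>) \<le> (\<integral>\<^sup>+ p. ennreal ((norm (x1 p - ((1 - \<alpha>) *\<^sub>R x2 p + \<alpha> *\<^sub>R x3 p)))\<^sup>2) \<partial>w)"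
      using W2sq_le[OF D(1,2) m(1), of "\<lambda>p. (1 - \<alpha>) *\<^sub>R x2 p + \<alpha> *\<^sub>R x3 p"] D(3) by (simp add: x1_def)
    also have "\<dots> = ennreal (\<integral>p. (norm (x1 p - ((1 - \<alpha>) *\<^sub>R x2 p + \<alpha> *\<^sub>R x3 p)))\<^sup>2 \<partial>w)"
      unfolding norm_convex_combination
      by (intro nn_integral_eq_integral Bochner_Integration.integrable_diff Bochner_Integration.integrable_add
          integrable_mult_right 12 13 23) (auto simp flip: norm_convex_combination)
    also note int
    finally show ?thesis .
  qed
  moreover have "gen_geod w \<alpha> \<in> Pm" for \<alpha>
  proof -
    have "gen_geod w \<alpha> = distr w borel (\<lambda>p. (1 - \<alpha>) *\<^sub>R x2 p + \<alpha> *\<^sub>R x3 p)"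
      by (simp add: gen_geod_def x2_def x3_def case_prod_beta')
    then show ?thesis by (auto simp: Pm_def intro!: prob_space_distr)
  qed
  ultimately show ?thesis using that q plan le by blast
qed

section \<open>Tightness of Wasserstein balls and lower semicontinuity under weak
  convergence\<close>

lemma emeasure_distance_gt_le:
  assumes "sets \<gamma> = sets borel" "R > 0" "cost2 \<gamma> \<le> ennreal C" "C \<ge> 0"
  shows "emeasure \<gamma> {p. norm (fst p - snd p) > R} \<le> ennreal (C / R\<^sup>2)"
proof -
  note [measurable] = measurable_borelD[OF borel_measurable_coordinates(1) assms(1)]
    measurable_borelD[OF borel_measurable_coordinates(2) assms(1)]
  have S: "{p. norm (fst p - snd p) > R} \<in> sets \<gamma>" unfolding assms(1) by measurable
  have "emeasure \<gamma> {p. norm (fst p - snd p) > R} =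
      (\<integral>\<^sup>+ p. indicator {p. norm (fst p - snd p) > R} p \<partial>\<gamma>)" using S by simp
  also have "\<dots> \<le> (\<integral>\<^sup>+ p. ennreal (1 / R\<^sup>2) * ennreal ((norm (fst p - snd p))\<^sup>2) \<partial>\<gamma>)"
  proof (intro nn_integral_mono)
    fix p :: "'a \<times> 'a"
    show "indicator {p. norm (fst p - snd p) > R} p \<le> ennreal (1 / R\<^sup>2) * ennreal ((norm (fst p - snd p))\<^sup>2)"
    proof (cases "norm (fst p - snd p) > R")
      case True
      then have "1 \<le> 1 / R\<^sup>2 * (norm (fst p - snd p))\<^sup>2"
        using \<open>R > 0\<close> power_mono[of R "norm (fst p - snd p)" 2] by simp
      then show ?thesis using True by (simp add: ennreal_mult[symmetric] ennreal_leI flip: ennreal_1)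
    qed auto
  qed
  also have "\<dots> = ennreal (1 / R\<^sup>2) * cost2 \<gamma>"
    unfolding cost2_def by (rule nn_integral_cmult) measurable
  also have "\<dots> \<le> ennreal (1 / R\<^sup>2) * ennreal C" using assms by (intro mult_left_mono) auto
  also have "\<dots> = ennreal (C / R\<^sup>2)" using assms by (simp add: ennreal_mult[symmetric])
  finally show ?thesis .
qed

text \<open>If the first entry of a coupling has norm above \<open>2 * n\<close>, then either the
  second has norm above \<open>n\<close> or the two differ by more than \<open>n\<close>. The first
  event is a tail of the fixed measure \<open>\<omega>\<close>, the second has mass at most
  \<open>C / n^2\<close> by Chebyshev's inequality.\<close>

lemma uniformly_tight_W2sq_bounded:
  fixes \<omega> :: "'a::euclidean_space measure"
  assumes \<omega>: "\<omega> \<in> Pm" and "C \<ge> 0"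
  shows "uniformly_tight {\<mu>. W2sq \<mu> \<omega> < ennreal C}"
  unfolding uniformly_tight_def
proof (intro allI impI)
  fix \<epsilon> :: real assume \<epsilon>: "\<epsilon> > 0"
  interpret O: prob_space \<omega> using \<omega> by (simp add: Pm_def)
  have sO: "sets \<omega> = sets borel" using \<omega> by (simp add: Pm_def)
  have "(\<lambda>n. measure \<omega> {x. norm x > real n}) \<longlonglongrightarrow> measure \<omega> (\<Inter>n. {x. norm x > real n})"
  proof (intro O.finite_Lim_measure_decseq)
    show "range (\<lambda>n. {x. norm x > real n}) \<subseteq> O.events" unfolding sO by auto
    show "decseq (\<lambda>n. {x :: 'a. norm x > real n})"
      by (rule decseq_SucI) (auto intro: less_trans)
  qed
  moreover have "(\<Inter>n. {x :: 'a. norm x > real n}) = {}"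
  proof -
    have "\<exists>n. \<not> norm x > real n" for x :: 'a using reals_Archimedean2[of "norm x"] less_asym by blast
    then show ?thesis by auto
  qed
  ultimately have "(\<lambda>n. measure \<omega> {x. norm x > real n}) \<longlonglongrightarrow> 0" by simp
  then have "\<forall>\<^sub>F n in sequentially. measure \<omega> {x. norm x > real n} < \<epsilon> / 2"
    using \<epsilon> by (intro order_tendstoD) auto
  moreover have "(\<lambda>n. C / (real n)\<^sup>2) \<longlonglongrightarrow> 0" by real_asymp
  then have "\<forall>\<^sub>F n in sequentially. C / (real n)\<^sup>2 < \<epsilon> / 2"
    using \<epsilon> by (intro order_tendstoD) auto
  moreover have "\<forall>\<^sub>F n in sequentially. n > (0::nat)" by (rule eventually_gt_at_top)
  ultimately have "\<forall>\<^sub>F n in sequentially. measure \<omega> {x. norm x > real n} < \<epsilon> / 2 \<and> C / (real n)\<^sup>2 < \<epsilon> / 2 \<and> n > 0"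
    by eventually_elim simp
  then obtain n where n: "measure \<omega> {x. norm x > real n} < \<epsilon> / 2" "C / (real n)\<^sup>2 < \<epsilon> / 2" "n > 0"
    using eventually_happens'[OF sequentially_bot] by blast
  show "\<exists>R. \<forall>\<mu>\<in>{\<mu>. W2sq \<mu> \<omega> < ennreal C}. measure \<mu> {x. norm x > R} < \<epsilon>"
  proof (rule exI[of _ "2 * real n"], rule ballI)
    fix \<mu> :: "'a measure" assume "\<mu> \<in> {\<mu>. W2sq \<mu> \<omega> < ennreal C}"
    then obtain \<gamma> where \<gamma>: "\<gamma> \<in> couplings \<mu> \<omega>" "cost2 \<gamma> < ennreal C"
      by (auto simp: W2sq_def INF_less_iff)
    have \<gamma>D: "sets \<gamma> = sets borel" "distr \<gamma> borel fst = \<mu>" "distr \<gamma> borel snd = \<omega>" "prob_space \<gamma>"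
      using \<gamma> by (auto simp: couplings_def)
    interpret G: prob_space \<gamma> by (rule \<gamma>D)
    note [measurable] = measurable_borelD[OF borel_measurable_coordinates(1) \<gamma>D(1)]
      measurable_borelD[OF borel_measurable_coordinates(2) \<gamma>D(1)]
    have sp: "space \<gamma> = UNIV" using sets_eq_imp_space_eq[OF \<gamma>D(1)] by simp
    have ev: "{p. norm (snd p) > real n} \<in> G.events" "{p. norm (fst p - snd p) > real n} \<in> G.events"
      unfolding \<gamma>D by measurable
    have "measure \<mu> {x. norm x > 2 * real n} = measure \<gamma> {p. norm (fst p) > 2 * real n}"
      unfolding \<gamma>D(2)[symmetric] by (subst measure_distr) (auto simp: sp vimage_def)
    also have "\<dots> \<le> measure \<gamma> ({p. norm (snd p) > real n} \<union> {p. norm (fst p - snd p) > real n})"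
    proof (intro G.finite_measure_mono)
      show "{p :: 'a \<times> 'a. norm (fst p) > 2 * real n} \<subseteq> {p. norm (snd p) > real n} \<union> {p. norm (fst p - snd p) > real n}"
      proof
        fix p :: "'a \<times> 'a" assume "p \<in> {p. norm (fst p) > 2 * real n}"
        then show "p \<in> {p. norm (snd p) > real n} \<union> {p. norm (fst p - snd p) > real n}"
          using norm_triangle_sub[of "fst p" "snd p"] by auto
      qed
    qed (use ev in auto)
    also have "\<dots> \<le> measure \<gamma> {p. norm (snd p) > real n} + measure \<gamma> {p. norm (fst p - snd p) > real n}"
      using ev by (rule measure_Un_le)
    also have "measure \<gamma> {p. norm (snd p) > real n} = measure \<omega> {x. norm x > real n}"
      unfolding \<gamma>D(3)[symmetric] by (subst measure_distr) (auto simp: sp vimage_def)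
    also have "measure \<gamma> {p. norm (fst p - snd p) > real n} \<le> C / (real n)\<^sup>2"
      using emeasure_distance_gt_le[OF \<gamma>D(1), of "real n" C] \<gamma>(2) n \<open>C \<ge> 0\<close>
      by (simp add: G.emeasure_eq_measure)
    finally show "measure \<mu> {x. norm x > 2 * real n} < \<epsilon>" using n by linarith
  qed
qed

lemma uniformly_tight_couplings:
  fixes \<gamma>s :: "nat \<Rightarrow> ('a::euclidean_space \<times> 'a) measure"
  assumes \<gamma>: "\<And>n. \<gamma>s n \<in> couplings (\<mu>s n) (\<nu>s n)"
    and t: "uniformly_tight (range \<mu>s)" "uniformly_tight (range \<nu>s)"
  shows "uniformly_tight (range \<gamma>s)"
  unfolding uniformly_tight_def
proof (intro allI impI)
  fix \<epsilon> :: real assume "\<epsilon> > 0"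
  then have "\<epsilon> / 2 > 0" by simp
  then obtain R R' where R: "\<And>n. measure (\<mu>s n) {x. norm x > R} < \<epsilon> / 2"
    and R': "\<And>n. measure (\<nu>s n) {x. norm x > R'} < \<epsilon> / 2"
    using t unfolding uniformly_tight_def by (metis rangeI)
  have "measure (\<gamma>s n) {p. norm p > R + R'} < \<epsilon>" for n
  proof -
    have \<gamma>D: "sets (\<gamma>s n) = sets borel" "distr (\<gamma>s n) borel fst = \<mu>s n" "distr (\<gamma>s n) borel snd = \<nu>s n" "prob_space (\<gamma>s n)"
      using \<gamma>[of n] by (auto simp: couplings_def)
    interpret G: prob_space "\<gamma>s n" by (rule \<gamma>D)
    note [measurable] = measurable_borelD[OF borel_measurable_coordinates(1) \<gamma>D(1)]
      measurable_borelD[OF borel_measurable_coordinates(2) \<gamma>D(1)]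
    have sp: "space (\<gamma>s n) = UNIV" using sets_eq_imp_space_eq[OF \<gamma>D(1)] by simp
    have ev: "{p. norm (fst p) > R} \<in> G.events" "{p. norm (snd p) > R'} \<in> G.events"
      unfolding \<gamma>D by measurable
    have "measure (\<gamma>s n) {p. norm p > R + R'} \<le> measure (\<gamma>s n) ({p. norm (fst p) > R} \<union> {p. norm (snd p) > R'})"
    proof (intro G.finite_measure_mono)
      show "{p. norm p > R + R'} \<subseteq> {p. norm (fst p) > R} \<union> {p :: 'a \<times> 'a. norm (snd p) > R'}"
      proof
        fix p :: "'a \<times> 'a" assume "p \<in> {p. norm p > R + R'}"
        moreover have "norm p \<le> norm (fst p) + norm (snd p)"
          unfolding norm_prod_def by (rule sqrt_sum_squares_le_sum) auto
        ultimately show "p \<in> {p. norm (fst p) > R} \<union> {p. norm (snd p) > R'}" by auto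
      qed
    qed (use ev in auto)
    also have "\<dots> \<le> measure (\<gamma>s n) {p. norm (fst p) > R} + measure (\<gamma>s n) {p. norm (snd p) > R'}"
      using ev by (rule measure_Un_le)
    also have "measure (\<gamma>s n) {p. norm (fst p) > R} = measure (\<mu>s n) {x. norm x > R}"
      unfolding \<gamma>D(2)[symmetric] by (subst measure_distr) (auto simp: sp vimage_def)
    also have "measure (\<gamma>s n) {p. norm (snd p) > R'} = measure (\<nu>s n) {x. norm x > R'}"
      unfolding \<gamma>D(3)[symmetric] by (subst measure_distr) (auto simp: sp vimage_def)
    finally show ?thesis using R[of n] R'[of n] by linarith
  qed
  then show "\<exists>R. \<forall>\<mu>\<in>range \<gamma>s. measure \<mu> {x. norm x > R} < \<epsilon>" by blast
qed

text \<open>The cost is continuous but unbounded. Its truncations at \<open>N\<close> are admissible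
  test functions, and monotone convergence removes the truncation after the weak limit.\<close>

lemma cost2_weakly_lsc:
  fixes \<gamma>s :: "nat \<Rightarrow> ('a::euclidean_space \<times> 'a) measure"
  assumes conv: "weakly_converges \<gamma>s \<gamma>"
    and \<gamma>: "\<And>n. prob_space (\<gamma>s n)" "\<And>n. sets (\<gamma>s n) = sets borel" "prob_space \<gamma>" "sets \<gamma> = sets borel"
    and cost: "\<And>n. cost2 (\<gamma>s n) \<le> ennreal C" and "C \<ge> 0"
  shows "cost2 \<gamma> \<le> ennreal C"
proof -
  define f where "f N p = min ((norm (fst p - snd p))\<^sup>2) (real N)" for N and p :: "'a \<times> 'a"
  have cont: "continuous_on UNIV (f N)" for N
    unfolding f_def by (intro continuous_intros)
  have fb: "0 \<le> f N p" "f N p \<le> real N" "f N p \<le> (norm (fst p - snd p))\<^sup>2" for N p by (auto simp: f_def)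
  have bdd: "bounded (range (f N))" for N
    using fb by (intro boundedI[of _ "real N"]) auto
  have fm: "f N \<in> borel_measurable M" if "sets M = sets borel" for M N
    using measurable_borelD[OF borel_measurable_continuous_onI[OF cont] that] .
  have nn: "(\<integral>\<^sup>+ p. ennreal (f N p) \<partial>M) = ennreal (integral\<^sup>L M (f N))"
    if "prob_space M" "sets M = sets borel" for M N
  proof (rule nn_integral_eq_integral)
    interpret prob_space M by fact
    show "integrable M (f N)"
      by (rule integrable_const_bound[where B = "real N"]) (use fm[OF that(2)] fb in auto)
  qed (use fb in auto)
  have "integral\<^sup>L (\<gamma>s n) (f N) \<le> C" for n N
  proof -
    have "ennreal (integral\<^sup>L (\<gamma>s n) (f N)) \<le> cost2 (\<gamma>s n)"
      unfolding nn[OF \<gamma>(1,2), symmetric] cost2_def using fb by (intro nn_integral_mono ennreal_leI)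
    then show ?thesis using cost[of n] \<open>C \<ge> 0\<close> order_trans ennreal_le_iff by blast
  qed
  moreover have lim: "(\<lambda>n. integral\<^sup>L (\<gamma>s n) (f N)) \<longlonglongrightarrow> integral\<^sup>L \<gamma> (f N)" for N
    using conv cont bdd unfolding weakly_converges_def by blast
  ultimately have le: "integral\<^sup>L \<gamma> (f N) \<le> C" for N
    by (intro LIMSEQ_le_const2[OF lim]) auto
  have "(\<lambda>N. \<integral>\<^sup>+ p. ennreal (f N p) \<partial>\<gamma>) \<longlonglongrightarrow> cost2 \<gamma>"
    unfolding cost2_def
  proof (rule nn_integral_LIMSEQ)
    show "incseq (\<lambda>N p. ennreal (f N p))"
      by (auto simp: incseq_def le_fun_def f_def intro!: ennreal_leI)
    show "(\<lambda>p. ennreal (f N p)) \<in> borel_measurable \<gamma>" for N using fm[OF \<gamma>(4)] by simp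
    fix p :: "'a \<times> 'a"
    obtain N0 :: nat where "(norm (fst p - snd p))\<^sup>2 \<le> real N0" using real_arch_simple by blast
    then show "(\<lambda>N. ennreal (f N p)) \<longlonglongrightarrow> ennreal ((norm (fst p - snd p))\<^sup>2)"
      by (intro tendsto_eventually eventually_sequentiallyI[of N0]) (auto simp: f_def)
  qed
  then show ?thesis
    by (rule LIMSEQ_le_const2) (auto simp: nn[OF \<gamma>(3,4)] le intro!: ennreal_leI)
qed

text \<open>The strict bound yields couplings of cost below \<open>C\<close> without any attainment.
  They are tight because their marginals are, and a weak limit of them couples the limits.\<close>

lemma W2sq_weakly_lsc:
  fixes \<mu>s \<nu>s :: "nat \<Rightarrow> 'a::euclidean_space measure"
  assumes Pm: "\<And>n. \<mu>s n \<in> Pm" "\<And>n. \<nu>s n \<in> Pm" "\<mu> \<in> Pm" "\<nu> \<in> Pm"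
    and conv: "weakly_converges \<mu>s \<mu>" "weakly_converges \<nu>s \<nu>"
    and tight: "uniformly_tight (range \<mu>s)" "uniformly_tight (range \<nu>s)"
    and less: "\<And>n. W2sq (\<mu>s n) (\<nu>s n) < ennreal C" and "C \<ge> 0"
  shows "W2sq \<mu> \<nu> \<le> ennreal C"
proof -
  have "\<exists>\<gamma>\<in>couplings (\<mu>s n) (\<nu>s n). cost2 \<gamma> < ennreal C" for n
    using less[of n] by (simp add: W2sq_def INF_less_iff)
  then obtain \<gamma>s where \<gamma>s: "\<And>n. \<gamma>s n \<in> couplings (\<mu>s n) (\<nu>s n)" "\<And>n. cost2 (\<gamma>s n) < ennreal C"
    by metis
  have D: "prob_space (\<gamma>s n)" "sets (\<gamma>s n) = sets borel" "distr (\<gamma>s n) borel fst = \<mu>s n"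
    "distr (\<gamma>s n) borel snd = \<nu>s n" for n
    using \<gamma>s(1)[of n] by (auto simp: couplings_def)
  obtain r \<gamma> where r: "strict_mono r" and \<gamma>: "prob_space \<gamma>" "sets \<gamma> = sets borel"
    and w: "weakly_converges (\<gamma>s \<circ> r) \<gamma>"
    using prokhorov[OF D(1,2) uniformly_tight_couplings[OF \<gamma>s(1) tight]] by blast
  interpret prob_space \<gamma> by fact
  \<comment> \<open>Projections are continuous, so marginals pass to the weak limit, where
    uniqueness identifies them.\<close>
  have marginal: "distr \<gamma> borel f = \<rho>"
    if "continuous_on UNIV f" "\<And>n. distr (\<gamma>s n) borel f = \<rho>s n" "weakly_converges \<rho>s \<rho>" "\<rho> \<in> Pm"
    for f :: "'a \<times> 'a \<Rightarrow> 'a" and \<rho>s \<rho>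
  proof (rule weakly_converges_unique)
    show "weakly_converges (\<rho>s \<circ> r) (distr \<gamma> borel f)"
      using weakly_converges_distr[OF w _ \<gamma>(2) that(1)] D(2) that(2) by (simp add: o_def)
    show "weakly_converges (\<rho>s \<circ> r) \<rho>" using weakly_converges_subseq[OF that(3) r] .
    have "f \<in> borel_measurable \<gamma>"
      using measurable_borelD[OF borel_measurable_continuous_onI[OF that(1)] \<gamma>(2)] .
    then show "prob_space (distr \<gamma> borel f)" by (rule prob_space_distr)
  qed (use that(4) in \<open>auto simp: Pm_def\<close>)
  have "distr \<gamma> borel fst = \<mu>" "distr \<gamma> borel snd = \<nu>"
    using marginal[OF _ D(3) conv(1) Pm(3)] marginal[OF _ D(4) conv(2) Pm(4)]
    by (simp_all add: continuous_on_fst continuous_on_snd)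
  then have "\<gamma> \<in> couplings \<mu> \<nu>" using \<gamma> by (simp add: couplings_def)
  moreover have "cost2 \<gamma> \<le> ennreal C"
    using cost2_weakly_lsc[OF w _ _ \<gamma>] D \<gamma>s(2) \<open>C \<ge> 0\<close> by (simp add: less_imp_le)
  ultimately show ?thesis unfolding W2sq_def by (metis INF_lower2)
qed

text \<open>By Tonelli, a density whose integral over almost every fibre is 1 in both directions
  leaves both marginals of the product unchanged.\<close>

lemma nn_integral_density_marginals:
  assumes "sigma_finite_measure P" "sigma_finite_measure Q"
    and k[measurable]: "k \<in> borel_measurable (P \<Otimes>\<^sub>M Q)"
    and kQ: "AE p in P. (\<integral>\<^sup>+ q. k (p, q) \<partial>Q) = 1" and kP: "AE q in Q. (\<integral>\<^sup>+ p. k (p, q) \<partial>P) = 1"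
  shows "F \<in> borel_measurable P \<Longrightarrow> (\<integral>\<^sup>+ z. F (fst z) \<partial>density (P \<Otimes>\<^sub>M Q) k) = (\<integral>\<^sup>+ p. F p \<partial>P)"
    and "G \<in> borel_measurable Q \<Longrightarrow> (\<integral>\<^sup>+ z. G (snd z) \<partial>density (P \<Otimes>\<^sub>M Q) k) = (\<integral>\<^sup>+ q. G q \<partial>Q)"
proof -
  interpret P: sigma_finite_measure P by fact
  interpret Q: sigma_finite_measure Q by fact
  interpret pair_sigma_finite P Q ..
  show "(\<integral>\<^sup>+ z. F (fst z) \<partial>density (P \<Otimes>\<^sub>M Q) k) = (\<integral>\<^sup>+ p. F p \<partial>P)" if [measurable]: "F \<in> borel_measurable P"
  proof -
    have "(\<integral>\<^sup>+ z. F (fst z) \<partial>density (P \<Otimes>\<^sub>M Q) k) = (\<integral>\<^sup>+ z. k z * F (fst z) \<partial>(P \<Otimes>\<^sub>M Q))"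
      by (rule nn_integral_density) measurable
    also have "\<dots> = (\<integral>\<^sup>+ p. \<integral>\<^sup>+ q. k (p, q) * F p \<partial>Q \<partial>P)"
      by (subst Q.nn_integral_fst[symmetric]) auto
    also have "\<dots> = (\<integral>\<^sup>+ p. (\<integral>\<^sup>+ q. k (p, q) \<partial>Q) * F p \<partial>P)"
      by (intro nn_integral_cong nn_integral_multc) measurable
    also have "\<dots> = (\<integral>\<^sup>+ p. F p \<partial>P)"
      using kQ by (intro nn_integral_cong_AE) (auto elim!: eventually_mono)
    finally show ?thesis .
  qed
  show "(\<integral>\<^sup>+ z. G (snd z) \<partial>density (P \<Otimes>\<^sub>M Q) k) = (\<integral>\<^sup>+ q. G q \<partial>Q)" if [measurable]: "G \<in> borel_measurable Q"
  proof -
    have "(\<integral>\<^sup>+ z. G (snd z) \<partial>density (P \<Otimes>\<^sub>M Q) k) = (\<integral>\<^sup>+ z. k z * G (snd z) \<partial>(P \<Otimes>\<^sub>M Q))"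
      by (rule nn_integral_density) measurable
    also have "\<dots> = (\<integral>\<^sup>+ q. \<integral>\<^sup>+ p. k (p, q) * G q \<partial>P \<partial>Q)"
      by (subst nn_integral_snd[symmetric]) auto
    also have "\<dots> = (\<integral>\<^sup>+ q. (\<integral>\<^sup>+ p. k (p, q) \<partial>P) * G q \<partial>Q)"
      by (intro nn_integral_cong nn_integral_multc) measurable
    also have "\<dots> = (\<integral>\<^sup>+ q. G q \<partial>Q)"
      using kP by (intro nn_integral_cong_AE) (auto elim!: eventually_mono)
    finally show ?thesis .
  qed
qed

text \<open>Points are labelled by the first member of a dense sequence within distance 1, so points
  with equal label are both near the same member.\<close>

lemma countable_partition_small:
  obtains c :: "'a::euclidean_space \<Rightarrow> nat" where "c \<in> measurable borel (count_space UNIV)"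
    "\<And>x y. c x = c y \<Longrightarrow> norm (x - y) \<le> 2"
proof -
  obtain S :: "'a set" where S: "countable S" "\<And>U. open U \<Longrightarrow> U \<noteq> {} \<Longrightarrow> \<exists>y\<in>S. y \<in> U"
    using countable_dense_setE by metis
  have "S \<noteq> {}" using S(2)[of UNIV] by auto
  then have range: "range (from_nat_into S) = S" using S(1) by (rule range_from_nat_into)
  define c where "c x = (LEAST n. norm (from_nat_into S n - x) < 1)" for x
  have near: "norm (from_nat_into S (c x) - x) < 1" for x
  proof -
    obtain y where "y \<in> S" "y \<in> ball x 1" using S(2)[of "ball x 1"] by auto
    then obtain n where "norm (from_nat_into S n - x) < 1"
      using range by (metis dist_norm mem_ball norm_minus_commute rangeE)
    then show ?thesis unfolding c_def by (rule LeastI)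
  qed
  have "c \<in> measurable borel (count_space UNIV)"
    unfolding c_def by measurable
  moreover have "norm (x - y) \<le> 2" if "c x = c y" for x y
    using near[of x] near[of y] that
      norm_triangle_ineq4[of "from_nat_into S (c x) - y" "from_nat_into S (c x) - x"] by simp
  ultimately show ?thesis using that by blast
qed

text \<open>Two couplings sharing a marginal are glued along a countable partition of the shared space into
  sets of bounded diameter instead of by disintegration. This preserves finiteness of the cost,
  which is all that is needed to see that generalized geodesics stay in \<^term>\<open>P2 \<omega>0\<close>.\<close>

lemma W2sq_finite_trans:
  fixes \<mu> \<nu> \<rho> :: "'a::euclidean_space measure"
  assumes fin: "W2sq \<mu> \<nu> < \<infinity>" "W2sq \<nu> \<rho> < \<infinity>"
  shows "W2sq \<mu> \<rho> < \<infinity>"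
proof -
  obtain P where P: "P \<in> couplings \<mu> \<nu>" "cost2 P < \<infinity>" using fin(1) by (auto simp: W2sq_def INF_less_iff)
  obtain Q where Q: "Q \<in> couplings \<nu> \<rho>" "cost2 Q < \<infinity>" using fin(2) by (auto simp: W2sq_def INF_less_iff)
  have PD: "prob_space P" "sets P = sets borel" "distr P borel fst = \<mu>" "distr P borel snd = \<nu>"
    using P by (auto simp: couplings_def)
  have QD: "prob_space Q" "sets Q = sets borel" "distr Q borel fst = \<nu>" "distr Q borel snd = \<rho>"
    using Q by (auto simp: couplings_def)
  interpret P: prob_space P by fact
  interpret Q: prob_space Q by fact
  note [measurable] = borel_measurable_coordinates[THEN measurable_borelD, OF PD(2)]
    borel_measurable_coordinates[THEN measurable_borelD, OF QD(2)]
  have spP: "space P = UNIV" using sets_eq_imp_space_eq[OF PD(2)] by simp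
  have spQ: "space Q = UNIV" using sets_eq_imp_space_eq[OF QD(2)] by simp
  interpret N: prob_space \<nu> unfolding PD(4)[symmetric] by (rule P.prob_space_distr) measurable
  have sN: "sets \<nu> = sets borel" unfolding PD(4)[symmetric] by simp
  obtain c :: "'a \<Rightarrow> nat" where c[measurable]: "c \<in> measurable borel (count_space UNIV)"
    and c2: "\<And>x y. c x = c y \<Longrightarrow> norm (x - y) \<le> 2"
    using countable_partition_small by blast
  define m where "m n = measure \<nu> (c -` {n})" for n
  have cn: "c -` {n} \<in> sets borel" for n using measurable_sets[OF c, of "{n}"] by simp
  have mP: "emeasure P {p. c (snd p) = n} = ennreal (m n)" for n
    using emeasure_distr[of snd P borel "c -` {n}"] cn N.emeasure_eq_measure[of "c -` {n}"]
    by (simp add: PD(4) spP m_def vimage_def)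
  have mQ: "emeasure Q {q. c (fst q) = n} = ennreal (m n)" for n
    using emeasure_distr[of fst Q borel "c -` {n}"] cn N.emeasure_eq_measure[of "c -` {n}"]
    by (simp add: QD(3) spQ m_def vimage_def)
  \<comment> \<open>On a cell of mass zero the weight \<open>1 / m\<close> is 0 by convention and
    the fibre integral would be 0 instead of 1; such cells are negligible.\<close>
  have AEP: "AE p in P. m (c (snd p)) \<noteq> 0"
  proof -
    have "AE p in P. m n = 0 \<longrightarrow> c (snd p) \<noteq> n" for n
    proof (cases "m n = 0")
      case True
      then have "{p. c (snd p) = n} \<in> null_sets P"
        using mP[of n] by (auto simp: null_sets_def PD(2))
      then show ?thesis by (rule AE_not_in[THEN eventually_mono]) auto
    qed simp
    then have "AE p in P. \<forall>n. m n = 0 \<longrightarrow> c (snd p) \<noteq> n" by (simp add: AE_all_countable)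
    then show ?thesis by eventually_elim auto
  qed
  have AEQ: "AE q in Q. m (c (fst q)) \<noteq> 0"
  proof -
    have "AE q in Q. m n = 0 \<longrightarrow> c (fst q) \<noteq> n" for n
    proof (cases "m n = 0")
      case True
      then have "{q. c (fst q) = n} \<in> null_sets Q"
        using mQ[of n] by (auto simp: null_sets_def QD(2))
      then show ?thesis by (rule AE_not_in[THEN eventually_mono]) auto
    qed simp
    then have "AE q in Q. \<forall>n. m n = 0 \<longrightarrow> c (fst q) \<noteq> n" by (simp add: AE_all_countable)
    then show ?thesis by eventually_elim auto
  qed
  \<comment> \<open>Given the cell of the shared coordinate, the two couplings are made independent;
    dividing by the mass of the cell normalizes the conditional product.\<close>
  define k where "k z = ennreal (1 / m (c (snd (fst z)))) * indicator {z. c (snd (fst z)) = c (fst (snd z))} z"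
    for z :: "('a \<times> 'a) \<times> ('a \<times> 'a)"
  have sPQ: "sets (P \<Otimes>\<^sub>M Q) = sets borel"
    by (simp only: sets_pair_measure_cong[OF PD(2) QD(2)] borel_prod)
  have mm: "(\<lambda>z. m (c (snd (fst z)))) \<in> borel_measurable (borel :: (('a \<times> 'a) \<times> ('a \<times> 'a)) measure)"
    by measurable
  have km: "k \<in> borel_measurable (P \<Otimes>\<^sub>M Q)"
  proof (rule measurable_borelD[OF _ sPQ])
    have "{z :: ('a \<times> 'a) \<times> ('a \<times> 'a). c (snd (fst z)) = c (fst (snd z))} =
        (\<Union>n. (\<lambda>z. snd (fst z)) -` (c -` {n}) \<inter> (\<lambda>z. fst (snd z)) -` (c -` {n}))" by auto
    also have "\<dots> \<in> sets borel"
      using measurable_sets[of "\<lambda>z. snd (fst z)" "borel :: (('a \<times> 'a) \<times> 'a \<times> 'a) measure" borel, OF _ cn]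
        measurable_sets[of "\<lambda>z. fst (snd z)" "borel :: (('a \<times> 'a) \<times> 'a \<times> 'a) measure" borel, OF _ cn]
      by (intro sets.countable_UN) auto
    finally show "k \<in> borel_measurable borel"
      unfolding k_def using mm by (intro borel_measurable_times_ennreal borel_measurable_indicator) simp_all
  qed
  have kQ: "AE p in P. (\<integral>\<^sup>+ q. k (p, q) \<partial>Q) = 1"
    using AEP
  proof eventually_elim
    fix p :: "'a \<times> 'a" assume m: "m (c (snd p)) \<noteq> 0"
    have "(\<integral>\<^sup>+ q. k (p, q) \<partial>Q) = (\<integral>\<^sup>+ q. ennreal (1 / m (c (snd p))) * indicator {q. c (fst q) = c (snd p)} q \<partial>Q)"
      by (intro nn_integral_cong) (auto simp: k_def indicator_def)
    also have "\<dots> = ennreal (1 / m (c (snd p))) * ennreal (m (c (snd p)))"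
      by (subst nn_integral_cmult_indicator) (auto simp: mQ QD(2))
    also have "\<dots> = 1" using m by (simp add: ennreal_mult[symmetric] m_def)
    finally show "(\<integral>\<^sup>+ q. k (p, q) \<partial>Q) = 1" .
  qed
  have kP: "AE q in Q. (\<integral>\<^sup>+ p. k (p, q) \<partial>P) = 1"
    using AEQ
  proof eventually_elim
    fix q :: "'a \<times> 'a" assume m: "m (c (fst q)) \<noteq> 0"
    have "(\<integral>\<^sup>+ p. k (p, q) \<partial>P) = (\<integral>\<^sup>+ p. ennreal (1 / m (c (fst q))) * indicator {p. c (snd p) = c (fst q)} p \<partial>P)"
      by (intro nn_integral_cong) (auto simp: k_def indicator_def)
    also have "\<dots> = ennreal (1 / m (c (fst q))) * ennreal (m (c (fst q)))"
      by (subst nn_integral_cmult_indicator) (auto simp: mP PD(2))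
    also have "\<dots> = 1" using m by (simp add: ennreal_mult[symmetric] m_def)
    finally show "(\<integral>\<^sup>+ p. k (p, q) \<partial>P) = 1" .
  qed
  define w where "w = density (P \<Otimes>\<^sub>M Q) k"
  note marg = nn_integral_density_marginals[OF P.sigma_finite_measure_axioms Q.sigma_finite_measure_axioms km kQ kP,
      folded w_def]
  have sw: "sets w = sets borel" by (simp add: w_def sPQ)
  have spw: "space w = UNIV" using sets_eq_imp_space_eq[OF sw] by simp
  have "emeasure w (space w) = 1"
    using marg(1)[of "\<lambda>_. 1"] P.emeasure_space_1 by simp
  then have pw: "prob_space w" by (rule prob_spaceI)
  have f: "(\<lambda>z. fst (fst z)) \<in> borel_measurable (borel :: (('a \<times> 'a) \<times> ('a \<times> 'a)) measure)"
    and g: "(\<lambda>z. snd (snd z)) \<in> borel_measurable (borel :: (('a \<times> 'a) \<times> ('a \<times> 'a)) measure)"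
    by measurable
  have d1: "distr w borel (\<lambda>z. fst (fst z)) = \<mu>"
  proof (rule measure_eqI)
    fix A assume A: "A \<in> sets (distr w borel (\<lambda>z. fst (fst z)))"
    have "emeasure (distr w borel (\<lambda>z. fst (fst z))) A = (\<integral>\<^sup>+ z. indicator A (fst (fst z)) \<partial>w)"
      using A measurable_borelD[OF f sw] by (subst nn_integral_distr[symmetric]) auto
    also have "\<dots> = (\<integral>\<^sup>+ p. indicator A (fst p) \<partial>P)"
      using A by (intro marg(1)) simp
    also have "\<dots> = (\<integral>\<^sup>+ x. indicator A x \<partial>distr P borel fst)"
      using A by (subst nn_integral_distr) auto
    finally show "emeasure (distr w borel (\<lambda>z. fst (fst z))) A = emeasure \<mu> A"
      using A by (simp add: PD(3)) (simp flip: PD(3))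
  qed (simp flip: PD(3))
  have d2: "distr w borel (\<lambda>z. snd (snd z)) = \<rho>"
  proof (rule measure_eqI)
    fix A assume A: "A \<in> sets (distr w borel (\<lambda>z. snd (snd z)))"
    have "emeasure (distr w borel (\<lambda>z. snd (snd z))) A = (\<integral>\<^sup>+ z. indicator A (snd (snd z)) \<partial>w)"
      using A measurable_borelD[OF g sw] by (subst nn_integral_distr[symmetric]) auto
    also have "\<dots> = (\<integral>\<^sup>+ p. indicator A (snd p) \<partial>Q)"
      using A by (intro marg(2)) simp
    also have "\<dots> = (\<integral>\<^sup>+ x. indicator A x \<partial>distr Q borel snd)"
      using A by (subst nn_integral_distr) auto
    finally show "emeasure (distr w borel (\<lambda>z. snd (snd z))) A = emeasure \<rho> A"
      using A by (simp add: QD(4)) (simp flip: QD(4))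
  qed (simp flip: QD(4))
  have "W2sq \<mu> \<rho> \<le> (\<integral>\<^sup>+ z. ennreal ((norm (fst (fst z) - snd (snd z)))\<^sup>2) \<partial>w)"
    using W2sq_le[OF pw sw f g] by (simp add: d1 d2)
  \<comment> \<open>The constants come from \<open>(A + 2 + B)^2 \<le> 3 * (A^2 + 4 + B^2)\<close>,
    where 2 bounds the gap between two points of one cell.\<close>
  also have "\<dots> \<le> (\<integral>\<^sup>+ z. ennreal 3 * ennreal ((norm (fst (fst z) - snd (fst z)))\<^sup>2)
      + (ennreal 12 + ennreal 3 * ennreal ((norm (fst (snd z) - snd (snd z)))\<^sup>2)) \<partial>w)"
  proof (rule nn_integral_mono_AE)
    have "AE z in w. c (snd (fst z)) = c (fst (snd z))"
      unfolding w_def AE_density[OF km] by (auto simp: k_def indicator_def split: if_splits)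
    then show "AE z in w. ennreal ((norm (fst (fst z) - snd (snd z)))\<^sup>2) \<le>
        ennreal 3 * ennreal ((norm (fst (fst z) - snd (fst z)))\<^sup>2)
      + (ennreal 12 + ennreal 3 * ennreal ((norm (fst (snd z) - snd (snd z)))\<^sup>2))"
    proof eventually_elim
      fix z :: "('a \<times> 'a) \<times> ('a \<times> 'a)" assume "c (snd (fst z)) = c (fst (snd z))"
      then have n: "norm (snd (fst z) - fst (snd z)) \<le> 2" by (rule c2)
      define A B where "A = norm (fst (fst z) - snd (fst z))" and "B = norm (fst (snd z) - snd (snd z))"
      have "norm (fst (fst z) - snd (snd z)) \<le> A + norm (snd (fst z) - snd (snd z))"
        unfolding A_def using norm_triangle_ineq[of "fst (fst z) - snd (fst z)" "snd (fst z) - snd (snd z)"] by simp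
      moreover have "norm (snd (fst z) - snd (snd z)) \<le> norm (snd (fst z) - fst (snd z)) + B"
        unfolding B_def using norm_triangle_ineq[of "snd (fst z) - fst (snd z)" "fst (snd z) - snd (snd z)"] by simp
      ultimately have "norm (fst (fst z) - snd (snd z)) \<le> A + 2 + B" using n by linarith
      then have "(norm (fst (fst z) - snd (snd z)))\<^sup>2 \<le> (A + 2 + B)\<^sup>2" by (intro power_mono) auto
      also have "\<dots> \<le> 3 * A\<^sup>2 + (12 + 3 * B\<^sup>2)"
        using zero_le_power2[of "A - 2"] zero_le_power2[of "B - 2"] zero_le_power2[of "A - B"]
        by (simp add: power2_eq_square algebra_simps)
      finally show "ennreal ((norm (fst (fst z) - snd (snd z)))\<^sup>2) \<le>
        ennreal 3 * ennreal ((norm (fst (fst z) - snd (fst z)))\<^sup>2)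
      + (ennreal 12 + ennreal 3 * ennreal ((norm (fst (snd z) - snd (snd z)))\<^sup>2))"
        unfolding A_def[symmetric] B_def[symmetric]
        by (simp only: ennreal_mult[symmetric] ennreal_plus[symmetric] zero_le_power2 zero_le_numeral
            add_nonneg_nonneg mult_nonneg_nonneg ennreal_leI)
    qed
  qed
  also have "\<dots> = ennreal 3 * (\<integral>\<^sup>+ z. ennreal ((norm (fst (fst z) - snd (fst z)))\<^sup>2) \<partial>w)
      + (ennreal 12 * emeasure w (space w) + ennreal 3 * (\<integral>\<^sup>+ z. ennreal ((norm (fst (snd z) - snd (snd z)))\<^sup>2) \<partial>w))"
  proof -
    have F: "(\<lambda>z. ennreal ((norm (fst (fst z) - snd (fst z)))\<^sup>2)) \<in> borel_measurable w"
      "(\<lambda>z. ennreal ((norm (fst (snd z) - snd (snd z)))\<^sup>2)) \<in> borel_measurable w"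
      by (rule measurable_borelD[OF _ sw], measurable)+
    then show ?thesis by (subst nn_integral_add, simp, simp, subst nn_integral_add) (simp_all add: nn_integral_cmult)
  qed
  also have "(\<integral>\<^sup>+ z. ennreal ((norm (fst (fst z) - snd (fst z)))\<^sup>2) \<partial>w) = cost2 P"
    unfolding cost2_def by (rule marg(1)) measurable
  also have "(\<integral>\<^sup>+ z. ennreal ((norm (fst (snd z) - snd (snd z)))\<^sup>2) \<partial>w) = cost2 Q"
    unfolding cost2_def by (rule marg(2)) measurable
  also have "ennreal 3 * cost2 P + (ennreal 12 * emeasure w (space w) + ennreal 3 * cost2 Q) < \<infinity>"
    using P(2) Q(2) \<open>emeasure w (space w) = 1\<close> by (auto simp: ennreal_mult_less_top)
  finally show ?thesis .
qed

text \<open>The 3-plans provided by the convexity hypothesis replace the gluing lemma: they yield optimal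
  couplings and the triangle inequality.\<close>

locale wasserstein_space =
  fixes \<omega>0 :: "'a::euclidean_space measure"
  assumes base: "\<omega>0 \<in> Pm"
    and plans_exist: "\<And>\<omega> \<mu>0 \<mu>1. \<lbrakk>\<omega> \<in> P2 \<omega>0; \<mu>0 \<in> P2 \<omega>0; \<mu>1 \<in> P2 \<omega>0\<rbrakk> \<Longrightarrow> transport_plans \<omega> \<mu>0 \<mu>1 \<noteq> {}"
begin

section \<open>Metric structure and completeness of \<open>P2 \<omega>0\<close>\<close>

lemma base_in_P2: "\<omega>0 \<in> P2 \<omega>0"
  using base by (simp add: P2_iff W2sq_self)

lemma W2sq_finite:
  assumes "\<mu> \<in> P2 \<omega>0" "\<nu> \<in> P2 \<omega>0"
  shows "W2sq \<mu> \<nu> < \<infinity>"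
proof -
  obtain w where w: "w \<in> transport_plans \<omega>0 \<mu> \<nu>" using plans_exist[OF base_in_P2 assms] by blast
  have "W2sq \<omega>0 \<mu> < \<infinity>" "W2sq \<omega>0 \<nu> < \<infinity>" using assms by (auto simp: P2_iff W2sq_commute)
  then obtain q where "W2sq \<mu> \<nu> \<le> ennreal q" using transport_plan_estimates[OF w] by metis
  then show ?thesis by (simp add: order_le_less_trans)
qed

sublocale Metric_space "P2 \<omega>0" W2d
proof
  show "0 \<le> W2d x y" for x y :: "'a measure" by (rule W2d_nonneg)
  show "W2d x y = W2d y x" for x y :: "'a measure" by (simp add: W2d_def W2sq_commute)
  show "W2d x y = 0 \<longleftrightarrow> x = y" if xy: "x \<in> P2 \<omega>0" "y \<in> P2 \<omega>0" for x y
  proof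
    assume "W2d x y = 0"
    then have "W2sq x y = 0" using W2sq_eq_W2d[OF W2sq_finite[OF xy]] by simp
    \<comment> \<open>A plan exists only as a triple, so the target is repeated; its first pair is
      an optimal coupling.\<close>
    moreover obtain w where "w \<in> transport_plans x y y" using plans_exist xy by blast
    then obtain \<gamma> where "\<gamma> \<in> optimal_couplings x y" by (auto simp: transport_plans_def)
    ultimately show "x = y" using W2sq_zero_imp_eq by blast
  next
    assume "x = y"
    then show "W2d x y = 0" using xy by (simp add: W2d_def W2sq_self P2_iff)
  qed
  show "W2d x z \<le> W2d x y + W2d y z" if xyz: "x \<in> P2 \<omega>0" "y \<in> P2 \<omega>0" "z \<in> P2 \<omega>0" for x y z
  proof -
    \<comment> \<open>The base is the intermediate point \<open>y\<close>, so that both legs of the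
      triangle are optimal in the same plan.\<close>
    obtain w where w: "w \<in> transport_plans y x z" using plans_exist xyz by blast
    obtain q where q: "q \<ge> 0" "W2sq x z \<le> ennreal q" "sqrt q \<le> W2d y x + W2d y z"
      using transport_plan_estimates[OF w W2sq_finite W2sq_finite] xyz by metis
    have "W2d x z \<le> sqrt q"
      unfolding W2d_def using q enn2real_mono[OF q(2)] by simp
    moreover have "W2d y x = W2d x y" by (simp add: W2d_def W2sq_commute)
    ultimately show ?thesis using q(3) by linarith
  qed
qed

text \<open>A Cauchy sequence stays in a ball, which is tight, so it has a weak limit along a
  subsequence. Lower semicontinuity upgrades the weak limit to a limit for the distance.\<close>

lemma mcomplete_W2d: mcomplete
  unfolding mcomplete_def
proof (intro allI impI)
  fix \<sigma> assume C: "MCauchy \<sigma>"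
  then have \<sigma>: "\<sigma> n \<in> P2 \<omega>0" for n by (auto simp: MCauchy_def)
  then have Pm: "\<sigma> n \<in> Pm" for n by (simp add: P2_iff)
  have sq: "W2sq x y < ennreal (c\<^sup>2)" if "x \<in> P2 \<omega>0" "y \<in> P2 \<omega>0" "W2d x y < c" for x y c
  proof -
    have "(W2d x y)\<^sup>2 < c\<^sup>2" using that(3) W2d_nonneg by (intro power_strict_mono) auto
    moreover have "0 < c" using that(3) W2d_nonneg[of x y] by linarith
    ultimately show ?thesis
      unfolding W2sq_eq_W2d[OF W2sq_finite[OF that(1,2)]] by (intro ennreal_lessI) auto
  qed
  obtain N1 where N1: "\<And>n. n \<ge> N1 \<Longrightarrow> W2d (\<sigma> n) (\<sigma> N1) < 1"
    using C unfolding MCauchy_def by (metis order_refl zero_less_one)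
  \<comment> \<open>Dropping the first \<open>N1\<close> terms leaves a sequence in one ball around
    \<open>\<omega>0\<close>.\<close>
  define \<tau> where "\<tau> n = \<sigma> (n + N1)" for n
  have \<tau>: "\<tau> n \<in> P2 \<omega>0" "\<tau> n \<in> Pm" for n using \<sigma> Pm by (auto simp: \<tau>_def)
  define B where "B = 1 + W2d (\<sigma> N1) \<omega>0"
  have "W2d (\<tau> n) \<omega>0 < B" for n
    using triangle[OF \<tau>(1)[of n] \<sigma>[of N1] base_in_P2] N1[of "n + N1"] by (simp add: B_def \<tau>_def)
  then have bd: "W2sq (\<tau> n) \<omega>0 < ennreal (B\<^sup>2)" for n by (intro sq \<tau> base_in_P2)
  have "uniformly_tight {\<mu>. W2sq \<mu> \<omega>0 < ennreal (B\<^sup>2)}"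
    using uniformly_tight_W2sq_bounded[OF base] by simp
  then have tight: "uniformly_tight (range (\<lambda>n. \<tau> (f n)))" for f :: "nat \<Rightarrow> nat"
    by (rule uniformly_tight_subset) (use bd in auto)
  have const: "uniformly_tight (range (\<lambda>n::nat. \<nu>))" if "\<nu> \<in> Pm" for \<nu> :: "'a measure"
    by (rule uniformly_tight_subset[OF uniformly_tight_W2sq_bounded[OF that, of 1]])
       (auto simp: W2sq_self[OF that])
  have const_conv: "weakly_converges (\<lambda>n. \<nu>) \<nu>" for \<nu> :: "'a measure"
    by (simp add: weakly_converges_def)
  obtain r \<mu> where r: "strict_mono r" and \<mu>: "prob_space \<mu>" "sets \<mu> = sets borel"
    and w: "weakly_converges (\<tau> \<circ> r) \<mu>"
    using prokhorov[of \<tau>] \<tau>(2) tight[of id] by (auto simp: Pm_def)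
  have \<mu>Pm: "\<mu> \<in> Pm" using \<mu> by (simp add: Pm_def)
  have "W2sq \<mu> \<omega>0 \<le> ennreal (B\<^sup>2)"
    using \<tau>(2) base \<mu>Pm w tight[of r] const[OF base] const_conv bd
    by (intro W2sq_weakly_lsc[of "\<tau> \<circ> r" "\<lambda>_. \<omega>0"]) (auto simp: o_def)
  then have \<mu>P2: "\<mu> \<in> P2 \<omega>0" using \<mu>Pm by (auto simp: P2_iff intro: order_le_less_trans)
  have "\<exists>N. \<forall>n\<ge>N. W2d (\<sigma> n) \<mu> < \<epsilon>" if "\<epsilon> > 0" for \<epsilon>
  proof -
    have "\<epsilon> / 2 > 0" using that by simp
    then obtain N where N: "\<And>n n'. n \<ge> N \<Longrightarrow> n' \<ge> N \<Longrightarrow> W2d (\<sigma> n) (\<sigma> n') < \<epsilon> / 2"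
      using C unfolding MCauchy_def by blast
    have "W2d (\<sigma> n) \<mu> < \<epsilon>" if "n \<ge> N" for n
    proof -
      have ge: "r (k + N) + N1 \<ge> N" for k
        using seq_suble[OF r, of "k + N"] by linarith
      have "weakly_converges ((\<tau> \<circ> r) \<circ> (\<lambda>k. k + N)) \<mu>"
        by (intro weakly_converges_subseq w) (auto simp: strict_mono_def)
      \<comment> \<open>One argument is frozen at \<open>\<sigma> n\<close> while the other runs
        along the subsequence: the Cauchy bound survives the weak limit.\<close>
      then have "W2sq (\<sigma> n) \<mu> \<le> ennreal ((\<epsilon> / 2)\<^sup>2)"
        using \<tau>(2) Pm \<mu>Pm tight[of "\<lambda>k. r (k + N)"] const[OF Pm] const_conv N[OF that ge] \<sigma> \<tau>(1)
        by (intro W2sq_weakly_lsc[of "\<lambda>_. \<sigma> n" "(\<tau> \<circ> r) \<circ> (\<lambda>k. k + N)"]) (auto simp: o_def \<tau>_def intro!: sq)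
      then have "W2d (\<sigma> n) \<mu> \<le> sqrt (enn2real (ennreal ((\<epsilon> / 2)\<^sup>2)))"
        unfolding W2d_def by (intro real_sqrt_le_mono enn2real_mono) auto
      then show ?thesis using \<open>\<epsilon> > 0\<close> by simp
    qed
    then show ?thesis by blast
  qed
  then have "limitin mtopology \<sigma> \<mu> sequentially"
    using \<mu>P2 \<sigma> W2d_nonneg by (auto simp: limitin_metric_dist_null LIMSEQ_iff)
  then show "\<exists>x. limitin mtopology \<sigma> x sequentially" by blast
qed

end

subsection \<open>Minimizing movements of convex energies\<close>

text \<open>Since \<open>(1 - x / 2) * (1 + x) \<ge> 1\<close> on [0, 1]. The lost factor 2 in the
  slope is why the recursion coefficient \<open>2 * a\<close> becomes \<open>4 * a\<close> in the
  exponent of the final estimate.\<close>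

lemma exp_neg_le_half: "0 \<le> x \<Longrightarrow> x \<le> 1 \<Longrightarrow> exp (- x) \<le> 1 - x / (2::real)"
proof -
  assume x: "0 \<le> x" "x \<le> 1"
  have "1 \<le> (1 - x / 2) * (1 + x)" using x mult_left_mono[of x 1 x] by (simp add: field_simps)
  also have "\<dots> \<le> (1 - x / 2) * exp x" using x by (intro mult_left_mono exp_ge_add_one_self) auto
  finally show ?thesis by (simp add: exp_minus field_simps)
qed

lemma one_le_exp_mult: "0 \<le> x \<Longrightarrow> x \<le> 1/2 \<Longrightarrow> 1 \<le> exp (2 * x) * (1 - x :: real)"
  using exp_neg_le_half[of "2 * x"] by (simp add: exp_minus field_simps)

text \<open>The right-hand side is a supersolution of the recursion: with \<open>m = h k / (h + k)\<close>, both decay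
  factors are at most \<open>exp (-4 a m) \<le> 1 - 2 a m\<close>, and \<open>a m \<le> 1/4\<close>.\<close>

lemma kobayashi_step:
  fixes a h k H K t s C D D1 D2 :: real
  assumes "a \<ge> 0" "h > 0" "k > 0" "a * h \<le> 1/2" "a * k \<le> 1/2" "h \<le> H" "k \<le> K" "C \<ge> 0"
    and "t \<ge> h" "s \<ge> k"
    and D1: "D1 \<le> C * ((t - h - s)\<^sup>2 + H * (t - h) + K * s) * exp (4 * a * (t - h + s))"
    and D2: "D2 \<le> C * ((t - (s - k))\<^sup>2 + H * t + K * (s - k)) * exp (4 * a * (t + (s - k)))"
    and rec: "(h + k - 2 * a * h * k) * D \<le> k * D1 + h * D2"
  shows "D \<le> C * ((t - s)\<^sup>2 + H * t + K * s) * exp (4 * a * (t + s))"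
proof -
  define m where "m = h * k / (h + k)"
  define F where "F = exp (4 * a * (t + s))"
  define b1 where "b1 = (t - h - s)\<^sup>2 + H * (t - h) + K * s"
  define b2 where "b2 = (t - (s - k))\<^sup>2 + H * t + K * (s - k)"
  define b where "b = (t - s)\<^sup>2 + H * t + K * s"
  have b12: "b1 \<ge> 0" "b2 \<ge> 0"
    using assms by (auto simp: b1_def b2_def intro!: add_nonneg_nonneg mult_nonneg_nonneg)
  have m: "0 \<le> m" "m \<le> h" "m \<le> k" "(h + k) * m = h * k"
    using assms by (auto simp: m_def field_simps)
  have am: "4 * a * m \<le> 1"
  proof -
    have "a * h * k \<le> k / 2" "a * h * k \<le> h / 2"
      using mult_right_mono[OF \<open>a * h \<le> 1/2\<close>, of k] mult_right_mono[OF \<open>a * k \<le> 1/2\<close>, of h] assms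
      by (auto simp: mult_ac)
    then have "4 * (a * h * k) \<le> h + k" by linarith
    then have "4 * (a * h * k) / (h + k) \<le> 1" using assms by simp
    then show ?thesis by (simp add: m_def mult.assoc)
  qed
  have e: "exp (- (4 * a * m)) \<le> 1 - 2 * a * m"
    using exp_neg_le_half[of "4 * a * m"] am m assms by simp
  have eh: "exp (- (4 * a * h)) \<le> 1 - 2 * a * m" "exp (- (4 * a * k)) \<le> 1 - 2 * a * m"
    using e m assms by (auto intro!: order_trans[OF _ e] mult_left_mono)
  have "(h + k) * (1 - 2 * a * m) = h + k - 2 * a * h * k"
  proof -
    have "(h + k) * (1 - 2 * a * m) = (h + k) - 2 * a * ((h + k) * m)" by (simp add: algebra_simps)
    then show ?thesis by (simp add: m(4))
  qed
  then have "(h + k) * (1 - 2 * a * m) * D \<le> k * D1 + h * D2" using rec by simp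
  also have "\<dots> \<le> k * (C * b1 * (F * (1 - 2 * a * m))) + h * (C * b2 * (F * (1 - 2 * a * m)))"
  proof (intro add_mono mult_left_mono)
    have "exp (4 * a * (t - h + s)) = F * exp (- (4 * a * h))"
      by (simp add: F_def exp_add[symmetric] algebra_simps)
    then have "exp (4 * a * (t - h + s)) \<le> F * (1 - 2 * a * m)"
      using eh by (simp add: F_def)
    then show "D1 \<le> C * b1 * (F * (1 - 2 * a * m))"
      using D1 b12 assms by (fold b1_def) (erule order_trans, intro mult_left_mono, auto)
    have "exp (4 * a * (t + (s - k))) = F * exp (- (4 * a * k))"
      by (simp add: F_def exp_add[symmetric] algebra_simps)
    then have "exp (4 * a * (t + (s - k))) \<le> F * (1 - 2 * a * m)"
      using eh by (simp add: F_def)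
    then show "D2 \<le> C * b2 * (F * (1 - 2 * a * m))"
      using D2 b12 assms by (fold b2_def) (erule order_trans, intro mult_left_mono, auto)
  qed (use assms in auto)
  also have "\<dots> = (1 - 2 * a * m) * (C * F) * (k * b1 + h * b2)" by (simp add: algebra_simps)
  also have "\<dots> \<le> (1 - 2 * a * m) * (C * F) * ((h + k) * b)"
  proof (rule mult_left_mono)
    \<comment> \<open>The quadratic part alone misses being a supersolution by
      \<open>h * k * (h + k)\<close>. The linear terms contribute \<open>h * k * (H + K)\<close>;
      compensating this defect is the reason for \<open>H * t + K * s\<close>.\<close>
    have "(h + k) * b - (k * b1 + h * b2) = h * k * ((H - h) + (K - k))"
      by (simp add: b_def b1_def b2_def power2_eq_square algebra_simps)
    moreover have "0 \<le> h * k * ((H - h) + (K - k))" using assms by auto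
    ultimately show "k * b1 + h * b2 \<le> (h + k) * b" by linarith
    show "0 \<le> (1 - 2 * a * m) * (C * F)"
      using am assms by (intro mult_nonneg_nonneg) (auto simp: F_def)
  qed
  finally have "((h + k) * (1 - 2 * a * m)) * D \<le> ((h + k) * (1 - 2 * a * m)) * (C * b * F)"
    by (simp add: mult_ac)
  moreover have "(h + k) * (1 - 2 * a * m) > 0" using am assms by (intro mult_pos_pos) auto
  ultimately have "D \<le> C * b * F" by (simp only: mult_le_cancel_left_pos)
  then show ?thesis by (simp add: b_def F_def)
qed

text \<open>\<open>D\<close> is the effective domain of the energy, \<open>e\<close> its real-valued restriction and \<open>a\<close> stands for \<open>\<lambda>\<^sup>-\<close>.
  The number \<open>q\<close> below is the squared plan distance of the generalized geodesic \<open>g\<close> with base \<open>x\<close>.\<close>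

locale convex_energy = Metric_space M d for M :: "'a set" and d +
  fixes D :: "'a set" and e :: "'a \<Rightarrow> real" and a :: real
  assumes D_subset: "D \<subseteq> M" and complete: mcomplete and a_nonneg: "a \<ge> 0"
    and sublevel_closed: "\<And>\<sigma> x c l. \<lbrakk>\<And>n. \<sigma> n \<in> D; \<And>n. e (\<sigma> n) \<le> c n; c \<longlonglongrightarrow> l; x \<in> M; (\<lambda>n. d (\<sigma> n) x) \<longlonglongrightarrow> 0\<rbrakk>
          \<Longrightarrow> x \<in> D \<and> e x \<le> l"
    and convex_curve: "\<And>x v0 v1. \<lbrakk>x \<in> D; v0 \<in> D; v1 \<in> D\<rbrakk> \<Longrightarrow> \<exists>g q. (d v0 v1)\<^sup>2 \<le> q \<and>
          (\<forall>\<alpha>\<in>{0..1}. g \<alpha> \<in> D \<and>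
            (d x (g \<alpha>))\<^sup>2 \<le> (1 - \<alpha>) * (d x v0)\<^sup>2 + \<alpha> * (d x v1)\<^sup>2 - \<alpha> * (1 - \<alpha>) * q \<and>
            e (g \<alpha>) \<le> (1 - \<alpha>) * e v0 + \<alpha> * e v1 + \<alpha> * (1 - \<alpha>) * (a / 2) * q)"
begin

section \<open>Slope, variational inequality and existence of minimizers\<close>

lemma convex_curveE:
  assumes "x \<in> D" "v0 \<in> D" "v1 \<in> D"
  obtains g q where "(d v0 v1)\<^sup>2 \<le> q" "\<And>\<alpha>. 0 \<le> \<alpha> \<Longrightarrow> \<alpha> \<le> 1 \<Longrightarrow> g \<alpha> \<in> D \<and>
        (d x (g \<alpha>))\<^sup>2 \<le> (1 - \<alpha>) * (d x v0)\<^sup>2 + \<alpha> * (d x v1)\<^sup>2 - \<alpha> * (1 - \<alpha>) * q \<and>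
        e (g \<alpha>) \<le> (1 - \<alpha>) * e v0 + \<alpha> * e v1 + \<alpha> * (1 - \<alpha>) * (a / 2) * q"
proof -
  obtain g q where "(d v0 v1)\<^sup>2 \<le> q" "\<forall>\<alpha>\<in>{0..1}. g \<alpha> \<in> D \<and>
        (d x (g \<alpha>))\<^sup>2 \<le> (1 - \<alpha>) * (d x v0)\<^sup>2 + \<alpha> * (d x v1)\<^sup>2 - \<alpha> * (1 - \<alpha>) * q \<and>
        e (g \<alpha>) \<le> (1 - \<alpha>) * e v0 + \<alpha> * e v1 + \<alpha> * (1 - \<alpha>) * (a / 2) * q"
    using convex_curve[OF assms] by blast
  then show ?thesis by (intro that[of q g]) simp_all
qed

text \<open>A relation instead of a function, so that the estimates apply to whichever minimizer the
  choice operator in \<open>Jstep\<close> selects.\<close>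

definition prox :: "real \<Rightarrow> 'a \<Rightarrow> 'a \<Rightarrow> bool" where
  "prox h x v \<longleftrightarrow> v \<in> D \<and> (\<forall>v'\<in>D. (d x v)\<^sup>2 / (2 * h) + e v \<le> (d x v')\<^sup>2 / (2 * h) + e v')"

text \<open>The limsup in the metric slope is at most \<open>L\<close>, restricted to the effective
  domain and written with real numbers; every \<open>L' > L\<close> is allowed its own
  radius.\<close>

definition local_slope_le :: "'a \<Rightarrow> real \<Rightarrow> bool" where
  "local_slope_le \<mu> L \<longleftrightarrow>
     (\<forall>L'>L. \<exists>\<delta>>0. \<forall>\<nu>\<in>D. 0 < d \<mu> \<nu> \<and> d \<mu> \<nu> < \<delta> \<longrightarrow> e \<mu> - e \<nu> \<le> L' * d \<mu> \<nu>)"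

text \<open>On the curve from \<open>\<mu>\<close> to \<open>\<nu>\<close> with base
  \<open>\<mu>\<close> itself, the point at parameter \<open>\<alpha>\<close> lies within
  \<open>\<alpha> * d \<mu> \<nu>\<close> of \<open>\<mu>\<close>. For small \<open>\<alpha>\<close>
  the local slope applies, and convexity lets the estimate be divided by \<open>\<alpha>\<close> and
  carried to \<open>\<nu>\<close>.\<close>

lemma global_slope:
  assumes \<mu>: "\<mu> \<in> D" "local_slope_le \<mu> L" and "L \<ge> 0" and \<nu>: "\<nu> \<in> D"
  shows "e \<mu> - e \<nu> \<le> L * d \<mu> \<nu> + a / 2 * (d \<mu> \<nu>)\<^sup>2"
proof -
  obtain g q where q: "(d \<mu> \<nu>)\<^sup>2 \<le> q" and g: "\<And>\<alpha>. 0 \<le> \<alpha> \<Longrightarrow> \<alpha> \<le> 1 \<Longrightarrow> g \<alpha> \<in> D \<and>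
        (d \<mu> (g \<alpha>))\<^sup>2 \<le> (1 - \<alpha>) * (d \<mu> \<mu>)\<^sup>2 + \<alpha> * (d \<mu> \<nu>)\<^sup>2 - \<alpha> * (1 - \<alpha>) * q \<and>
        e (g \<alpha>) \<le> (1 - \<alpha>) * e \<mu> + \<alpha> * e \<nu> + \<alpha> * (1 - \<alpha>) * (a / 2) * q"
    using convex_curveE[OF \<mu>(1) \<mu>(1) \<nu>] by metis
  have M: "\<mu> \<in> M" "\<nu> \<in> M" using \<mu> \<nu> D_subset by auto
  then have [simp]: "d \<mu> \<mu> = 0" by simp
  \<comment> \<open>The plan distance dominates the distance by assumption. With base
    \<open>\<mu>\<close> it is also bounded above, because the squared distance to the curve cannot
    be negative.\<close>
  have q_le: "(1 - \<alpha>) * q \<le> (d \<mu> \<nu>)\<^sup>2" if "0 < \<alpha>" "\<alpha> \<le> 1" for \<alpha>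
  proof -
    have "(d \<mu> (g \<alpha>))\<^sup>2 \<le> \<alpha> * ((d \<mu> \<nu>)\<^sup>2 - (1 - \<alpha>) * q)"
      using g[of \<alpha>] that unfolding \<open>d \<mu> \<mu> = 0\<close> by (auto simp: algebra_simps)
    then have "0 \<le> \<alpha> * ((d \<mu> \<nu>)\<^sup>2 - (1 - \<alpha>) * q)"
      using zero_le_power2[of "d \<mu> (g \<alpha>)"] by linarith
    then show ?thesis using that by (simp add: zero_le_mult_iff)
  qed
  have dg: "d \<mu> (g \<alpha>) \<le> \<alpha> * d \<mu> \<nu>" if "0 \<le> \<alpha>" "\<alpha> \<le> 1" for \<alpha>
  proof -
    have "(d \<mu> (g \<alpha>))\<^sup>2 \<le> \<alpha> * (d \<mu> \<nu>)\<^sup>2 - \<alpha> * (1 - \<alpha>) * q" using g[of \<alpha>] that by simp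
    also have "\<dots> \<le> \<alpha> * (d \<mu> \<nu>)\<^sup>2 - \<alpha> * (1 - \<alpha>) * (d \<mu> \<nu>)\<^sup>2"
      using q that by (intro diff_left_mono mult_left_mono) auto
    also have "\<dots> = (\<alpha> * d \<mu> \<nu>)\<^sup>2" by (simp add: power2_eq_square algebra_simps)
    finally show ?thesis using that by (simp add: power2_le_iff_abs_le abs_le_square_iff[symmetric])
  qed
  have main: "e \<mu> - e \<nu> \<le> L' * d \<mu> \<nu> + a / 2 * (d \<mu> \<nu>)\<^sup>2" if L': "L' > L" for L'
  proof -
    obtain \<delta> where "\<delta> > 0" and \<delta>: "\<And>\<nu>. \<nu> \<in> D \<Longrightarrow> 0 < d \<mu> \<nu> \<Longrightarrow> d \<mu> \<nu> < \<delta> \<Longrightarrow> e \<mu> - e \<nu> \<le> L' * d \<mu> \<nu>"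
      using \<mu>(2) L' unfolding local_slope_le_def by blast
    \<comment> \<open>Small enough to bring the curve within the radius \<open>\<delta>\<close>; the
      added 1 avoids dividing by a zero distance.\<close>
    define \<alpha> where "\<alpha> = min 1 (\<delta> / (2 * (d \<mu> \<nu> + 1)))"
    have pos: "d \<mu> \<nu> + 1 > 0" using nonneg[of \<mu> \<nu>] by linarith
    then have \<alpha>: "0 < \<alpha>" "\<alpha> \<le> 1" using \<open>\<delta> > 0\<close> by (auto simp: \<alpha>_def)
    have "\<alpha> * d \<mu> \<nu> < \<delta>"
    proof -
      have "\<alpha> * d \<mu> \<nu> \<le> \<alpha> * (d \<mu> \<nu> + 1)" using \<alpha> by (intro mult_left_mono) auto
      also have "\<dots> \<le> \<delta> / (2 * (d \<mu> \<nu> + 1)) * (d \<mu> \<nu> + 1)"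
        using pos by (intro mult_right_mono) (auto simp: \<alpha>_def)
      also have "\<dots> = \<delta> / 2"
      proof -
        have "\<delta> / (2 * p) * p = \<delta> / 2" if "p > 0" for p :: real using that by simp
        then show ?thesis using pos by blast
      qed
      finally show ?thesis using \<open>\<delta> > 0\<close> by linarith
    qed
    then have small: "d \<mu> (g \<alpha>) < \<delta>" using dg[of \<alpha>] \<alpha> by linarith
    have gD: "g \<alpha> \<in> D" using g \<alpha> by auto
    have "e \<mu> - e (g \<alpha>) \<le> L' * d \<mu> (g \<alpha>)"
    \<comment> \<open>The local slope only speaks of points at positive distance.\<close>
    proof (cases "d \<mu> (g \<alpha>) = 0")
      case True
      then have "\<mu> = g \<alpha>" using M gD D_subset by auto
      then show ?thesis using True by simp
    next
      case False
      then show ?thesis using \<delta>[OF gD] small nonneg[of \<mu> "g \<alpha>"] by linarith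
    qed
    also have "\<dots> \<le> L' * (\<alpha> * d \<mu> \<nu>)" using dg[of \<alpha>] \<alpha> L' \<open>L \<ge> 0\<close> by (intro mult_left_mono) auto
    finally have "e \<mu> - e (g \<alpha>) \<le> L' * (\<alpha> * d \<mu> \<nu>)" .
    moreover have "e (g \<alpha>) \<le> (1 - \<alpha>) * e \<mu> + \<alpha> * e \<nu> + \<alpha> * ((1 - \<alpha>) * q) * (a / 2)"
      using g[of \<alpha>] \<alpha> by (auto simp: mult_ac)
    moreover have "\<alpha> * ((1 - \<alpha>) * q) * (a / 2) \<le> \<alpha> * (d \<mu> \<nu>)\<^sup>2 * (a / 2)"
      using q_le[of \<alpha>] \<alpha> a_nonneg by (intro mult_right_mono mult_left_mono) auto
    ultimately have "\<alpha> * (e \<mu> - e \<nu>) \<le> \<alpha> * (L' * d \<mu> \<nu> + a / 2 * (d \<mu> \<nu>)\<^sup>2)"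
      by (simp add: algebra_simps)
    then show ?thesis using \<alpha> by simp
  qed
  have "e \<mu> - e \<nu> - a / 2 * (d \<mu> \<nu>)\<^sup>2 \<le> L * d \<mu> \<nu>"
  proof (rule field_le_epsilon)
    fix \<epsilon> :: real assume "\<epsilon> > 0"
    have pos: "d \<mu> \<nu> + 1 > 0" using nonneg[of \<mu> \<nu>] by linarith
    have "\<epsilon> / (d \<mu> \<nu> + 1) * d \<mu> \<nu> \<le> \<epsilon> / (d \<mu> \<nu> + 1) * (d \<mu> \<nu> + 1)"
      using pos \<open>\<epsilon> > 0\<close> by (intro mult_left_mono) auto
    also have "\<dots> = \<epsilon>" using pos by simp
    finally have "\<epsilon> / (d \<mu> \<nu> + 1) * d \<mu> \<nu> \<le> \<epsilon>" .
    moreover have "e \<mu> - e \<nu> \<le> (L + \<epsilon> / (d \<mu> \<nu> + 1)) * d \<mu> \<nu> + a / 2 * (d \<mu> \<nu>)\<^sup>2"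
      using pos \<open>\<epsilon> > 0\<close> by (intro main) auto
    ultimately show "e \<mu> - e \<nu> - a / 2 * (d \<mu> \<nu>)\<^sup>2 \<le> L * d \<mu> \<nu> + \<epsilon>"
      by (simp add: algebra_simps)
  qed
  then show ?thesis by linarith
qed

text \<open>The minimality of \<open>y\<close> is tested on the curve from \<open>y\<close> to
  \<open>v\<close> with base \<open>x\<close>. The gain is of order \<open>\<alpha>\<close>;
  dividing by it and letting \<open>\<alpha>\<close> tend to 0 is the first-order condition, with
  the convexity of the squared distance retained.\<close>

lemma prox_variational:
  assumes x: "x \<in> D" and h: "h > 0" "a * h < 1" and p: "prox h x y" and v: "v \<in> D"
  shows "(1 - a * h) * (d y v)\<^sup>2 - (d x v)\<^sup>2 + (d x y)\<^sup>2 \<le> 2 * h * (e v - e y)"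
proof -
  have y: "y \<in> D" using p by (simp add: prox_def)
  obtain g q where q: "(d y v)\<^sup>2 \<le> q" and g: "\<And>\<alpha>. 0 \<le> \<alpha> \<Longrightarrow> \<alpha> \<le> 1 \<Longrightarrow> g \<alpha> \<in> D \<and>
        (d x (g \<alpha>))\<^sup>2 \<le> (1 - \<alpha>) * (d x y)\<^sup>2 + \<alpha> * (d x v)\<^sup>2 - \<alpha> * (1 - \<alpha>) * q \<and>
        e (g \<alpha>) \<le> (1 - \<alpha>) * e y + \<alpha> * e v + \<alpha> * (1 - \<alpha>) * (a / 2) * q"
    using convex_curveE[OF x y v] by metis
  have le: "(1 - \<alpha>) * ((1 - a * h) * q) \<le> 2 * h * (e v - e y) + (d x v)\<^sup>2 - (d x y)\<^sup>2"
    if \<alpha>: "0 < \<alpha>" "\<alpha> \<le> 1" for \<alpha>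
  proof -
    have "(d x y)\<^sup>2 / (2 * h) + e y \<le> (d x (g \<alpha>))\<^sup>2 / (2 * h) + e (g \<alpha>)"
      using p g[of \<alpha>] \<alpha> by (simp add: prox_def)
    then have "(d x y)\<^sup>2 + 2 * h * e y \<le> (d x (g \<alpha>))\<^sup>2 + 2 * h * e (g \<alpha>)"
      using mult_left_mono[of _ _ "2 * h"] h by (fastforce simp: distrib_left)
    also have "\<dots> \<le> (1 - \<alpha>) * (d x y)\<^sup>2 + \<alpha> * (d x v)\<^sup>2 - \<alpha> * (1 - \<alpha>) * q
        + 2 * h * ((1 - \<alpha>) * e y + \<alpha> * e v + \<alpha> * (1 - \<alpha>) * (a / 2) * q)"
      using g[of \<alpha>] \<alpha> h by (intro add_mono mult_left_mono) auto
    finally have "\<alpha> * ((1 - \<alpha>) * ((1 - a * h) * q)) \<le> \<alpha> * (2 * h * (e v - e y) + (d x v)\<^sup>2 - (d x y)\<^sup>2)"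
      by (simp add: field_simps)
    then show ?thesis using \<alpha> by simp
  qed
  have "(1 - a * h) * q \<le> 2 * h * (e v - e y) + (d x v)\<^sup>2 - (d x y)\<^sup>2" (is "?l \<le> ?r")
  proof -
    \<comment> \<open>The limit from the right removes the factor
      \<open>1 - \<alpha>\<close>.\<close>
    have "((\<lambda>\<alpha>. (1 - \<alpha>) * ?l) \<longlongrightarrow> (1 - 0) * ?l) (at_right 0)"
      by (intro tendsto_intros)
    moreover have "\<forall>\<^sub>F \<alpha> in at_right 0. (1 - \<alpha>) * ?l \<le> ?r"
      by (auto simp: eventually_at_right_field intro!: exI[of _ 1] le)
    ultimately have "(1 - 0) * ?l \<le> ?r"
      by (intro tendsto_upperbound[of "\<lambda>\<alpha>. (1 - \<alpha>) * ?l" _ "at_right (0::real)"]) auto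
    then show ?thesis by simp
  qed
  moreover have "(1 - a * h) * (d y v)\<^sup>2 \<le> (1 - a * h) * q" using q h by (intro mult_left_mono) auto
  ultimately show ?thesis by linarith
qed

text \<open>\<open>global_slope\<close> bounds the functional below. Uniform convexity makes
  minimizing sequences Cauchy, so completeness replaces compactness.\<close>

lemma prox_exists:
  assumes x: "x \<in> D" and h: "h > 0" "a * h \<le> 1/2"
    and \<mu>: "\<mu> \<in> D" "local_slope_le \<mu> L" and "L \<ge> 0"
  shows "\<exists>v. prox h x v"
proof -
  define \<Phi> where "\<Phi> v = (d x v)\<^sup>2 / (2 * h) + e v" for v
  have M: "v \<in> M" if "v \<in> D" for v using that D_subset by auto
  have "bdd_below (\<Phi> ` D)"
  proof (rule bdd_belowI2)
    fix v assume v: "v \<in> D"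
    define r c where "r = d x v" and "c = d \<mu> x"
    have rc: "r \<ge> 0" "c \<ge> 0" by (auto simp: r_def c_def)
    have tri: "d \<mu> v \<le> r + c" using triangle[of \<mu> x v] M v x \<mu> by (auto simp: r_def c_def)
    have "e \<mu> - e v \<le> L * d \<mu> v + a / 2 * (d \<mu> v)\<^sup>2"
      using global_slope[OF \<mu> \<open>L \<ge> 0\<close> v] .
    also have "\<dots> \<le> L * (r + c) + a / 2 * (r + c)\<^sup>2"
      using tri \<open>L \<ge> 0\<close> a_nonneg by (intro add_mono mult_left_mono power_mono) auto
    finally have 1: "e v \<ge> e \<mu> - L * (r + c) - a / 2 * (r + c)\<^sup>2" by linarith
    \<comment> \<open>The step restriction lets the quadratic penalty absorb the quadratic loss of
      the energy and still keep half of itself.\<close>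
    have "a \<le> 1 / (2 * h)" using h by (simp add: field_simps)
    then have "a / 2 * r\<^sup>2 \<le> 1 / (4 * h) * r\<^sup>2" using mult_right_mono[of a "1 / (2*h)" "r\<^sup>2/2"] by simp
    then have 2: "r\<^sup>2 / (2 * h) - a / 2 * r\<^sup>2 \<ge> r\<^sup>2 / (4 * h)" by (simp add: field_simps)
    \<comment> \<open>Collects the coefficients of \<open>r\<close>, to complete the square.\<close>
    define b where "b = L + a * c"
    have "0 \<le> (r / (2 * h) - b)\<^sup>2 * h" using h by simp
    also have "\<dots> = r\<^sup>2 / (4 * h) - b * r + h * b\<^sup>2"
      using h by (simp add: power2_eq_square field_simps)
    finally have 3: "r\<^sup>2 / (4 * h) - b * r \<ge> - (h * b\<^sup>2)" by linarith
    have "\<Phi> v \<ge> e \<mu> - L * c - a / 2 * c\<^sup>2 - h * b\<^sup>2"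
      using 1 2 3 unfolding \<Phi>_def r_def[symmetric] b_def
      by (simp add: power2_eq_square algebra_simps)
    then show "e \<mu> - L * d \<mu> x - a / 2 * (d \<mu> x)\<^sup>2 - h * (L + a * d \<mu> x)\<^sup>2 \<le> \<Phi> v"
      by (simp add: c_def b_def)
  qed
  define I where "I = Inf (\<Phi> ` D)"
  have I_le: "I \<le> \<Phi> v" if "v \<in> D" for v
    unfolding I_def using \<open>bdd_below _\<close> that by (intro cInf_lower) auto
  have "\<exists>v\<in>D. \<Phi> v < I + 1 / real (Suc n)" for n
  proof -
    have "Inf (\<Phi> ` D) < I + 1 / real (Suc n)" by (simp add: I_def)
    then show ?thesis using \<open>bdd_below _\<close> x by (subst (asm) cInf_less_iff) auto
  qed
  then obtain \<sigma> where \<sigma>: "\<And>n. \<sigma> n \<in> D" "\<And>n. \<Phi> (\<sigma> n) < I + 1 / real (Suc n)" by metis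
  \<comment> \<open>The convexity modulus of \<open>\<Phi>\<close> on curves with base
    \<open>x\<close>: \<open>1 / h\<close> from the penalty, minus \<open>a\<close> from the
    energy.\<close>
  define c where "c = 1 / h - a"
  have pos: "c > 0" using h by (simp add: c_def field_simps)
  have mid: "c * (d v w)\<^sup>2 \<le> 4 * (\<Phi> v + \<Phi> w - 2 * I)" if vw: "v \<in> D" "w \<in> D" for v w
  proof -
    obtain g q where q: "(d v w)\<^sup>2 \<le> q" and g: "\<And>\<alpha>. 0 \<le> \<alpha> \<Longrightarrow> \<alpha> \<le> 1 \<Longrightarrow> g \<alpha> \<in> D \<and>
        (d x (g \<alpha>))\<^sup>2 \<le> (1 - \<alpha>) * (d x v)\<^sup>2 + \<alpha> * (d x w)\<^sup>2 - \<alpha> * (1 - \<alpha>) * q \<and>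
        e (g \<alpha>) \<le> (1 - \<alpha>) * e v + \<alpha> * e w + \<alpha> * (1 - \<alpha>) * (a / 2) * q"
      using convex_curveE[OF x vw] by metis
    have "(d x (g (1/2)))\<^sup>2 \<le> (d x v)\<^sup>2 / 2 + (d x w)\<^sup>2 / 2 - q / 4"
      and ge: "e (g (1/2)) \<le> e v / 2 + e w / 2 + a * q / 8" using g[of "1/2"] by auto
    then have "(d x (g (1/2)))\<^sup>2 / (2 * h) \<le> ((d x v)\<^sup>2 / 2 + (d x w)\<^sup>2 / 2 - q / 4) / (2 * h)"
      using h by (intro divide_right_mono) auto
    then have "\<Phi> (g (1/2)) \<le> ((d x v)\<^sup>2 / 2 + (d x w)\<^sup>2 / 2 - q / 4) / (2 * h) + (e v / 2 + e w / 2 + a * q / 8)"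
      using ge unfolding \<Phi>_def by linarith
    also have "\<dots> = \<Phi> v / 2 + \<Phi> w / 2 - c * q / 8"
      using h by (simp add: \<Phi>_def c_def field_simps)
    finally have "\<Phi> (g (1/2)) \<le> \<Phi> v / 2 + \<Phi> w / 2 - c * q / 8" .
    moreover have "I \<le> \<Phi> (g (1/2))" using I_le g[of "1/2"] by simp
    ultimately have "I \<le> \<Phi> v / 2 + \<Phi> w / 2 - c * q / 8" by (rule order_trans[rotated])
    then have "c * q \<le> 4 * (\<Phi> v + \<Phi> w - 2 * I)" by (simp add: field_simps)
    moreover have "c * (d v w)\<^sup>2 \<le> c * q"
      using q pos by (intro mult_left_mono) auto
    ultimately show ?thesis by linarith
  qed
  have "MCauchy \<sigma>"
    unfolding MCauchy_def
  proof (intro conjI allI impI)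
    show "range \<sigma> \<subseteq> M" using \<sigma> M by auto
    fix \<epsilon> :: real assume "\<epsilon> > 0"
    then have "c * \<epsilon>\<^sup>2 / 8 > 0" using pos by simp
    then obtain N where "1 / real (Suc N) < c * \<epsilon>\<^sup>2 / 8"
      using nat_approx_posE by metis
    then have N: "8 * (1 / real (Suc N)) < c * \<epsilon>\<^sup>2" by simp
    show "\<exists>N. \<forall>n n'. N \<le> n \<longrightarrow> N \<le> n' \<longrightarrow> d (\<sigma> n) (\<sigma> n') < \<epsilon>"
    proof (intro exI allI impI)
      fix n n' assume "N \<le> n" "N \<le> n'"
      then have "1 / real (Suc n) \<le> 1 / real (Suc N)" "1 / real (Suc n') \<le> 1 / real (Suc N)"
        by (auto intro!: divide_left_mono)
      then have "4 * (\<Phi> (\<sigma> n) + \<Phi> (\<sigma> n') - 2 * I) < c * \<epsilon>\<^sup>2"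
        using N \<sigma>(2)[of n] \<sigma>(2)[of n'] unfolding right_diff_distrib distrib_left by linarith
      then have "c * (d (\<sigma> n) (\<sigma> n'))\<^sup>2 < c * \<epsilon>\<^sup>2"
        using mid[OF \<sigma>(1)[of n] \<sigma>(1)[of n']] by linarith
      then have "(d (\<sigma> n) (\<sigma> n'))\<^sup>2 < \<epsilon>\<^sup>2" using pos by (simp only: mult_less_cancel_left_pos)
      then show "d (\<sigma> n) (\<sigma> n') < \<epsilon>" using \<open>\<epsilon> > 0\<close> by (auto intro: power2_less_imp_less)
    qed
  qed
  then obtain v where "limitin mtopology \<sigma> v sequentially" using complete by (auto simp: mcomplete_def)
  then have v: "v \<in> M" and lim: "(\<lambda>n. d (\<sigma> n) v) \<longlonglongrightarrow> 0"
    by (auto simp: limitin_metric_dist_null)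
  have dlim: "(\<lambda>n. d x (\<sigma> n)) \<longlonglongrightarrow> d x v"
  proof (rule LIMSEQ_I)
    fix r :: real assume "r > 0"
    then obtain N where N: "\<And>n. n \<ge> N \<Longrightarrow> d (\<sigma> n) v < r"
      using LIMSEQ_D[OF lim] by auto
    have "norm (d x (\<sigma> n) - d x v) < r" if "n \<ge> N" for n
      using N[OF that] triangle[of x "\<sigma> n" v] triangle[of x v "\<sigma> n"] v M[OF x] M[OF \<sigma>(1)[of n]]
        commute[of v "\<sigma> n"] by (simp add: abs_less_iff)
    then show "\<exists>N. \<forall>n\<ge>N. norm (d x (\<sigma> n) - d x v) < r" by blast
  qed
  have clim: "(\<lambda>n. I + 1 / real (Suc n) - (d x (\<sigma> n))\<^sup>2 / (2 * h)) \<longlonglongrightarrow> I + 0 - (d x v)\<^sup>2 / (2 * h)"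
    using h by (intro tendsto_intros dlim lim_1_over_n[THEN LIMSEQ_Suc]) auto
  \<comment> \<open>The upper bounds passed to \<open>sublevel_closed\<close> move with
    \<open>n\<close>: they are the near-infimum minus the penalty, and converge because the
    distances to \<open>x\<close> do.\<close>
  have "v \<in> D \<and> e v \<le> I + 0 - (d x v)\<^sup>2 / (2 * h)"
  proof (rule sublevel_closed[OF \<sigma>(1) _ clim v lim])
    show "e (\<sigma> n) \<le> I + 1 / real (Suc n) - (d x (\<sigma> n))\<^sup>2 / (2 * h)" for n
      using \<sigma>(2)[of n] by (simp add: \<Phi>_def)
  qed
  then have "prox h x v" using I_le by (force simp: prox_def \<Phi>_def)
  then show ?thesis by blast
qed

section \<open>Displacement and comparison of discrete flows\<close>

definition prox_chain :: "real list \<Rightarrow> (nat \<Rightarrow> 'a) \<Rightarrow> bool" where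
  "prox_chain hs x \<longleftrightarrow> (\<forall>i<length hs. prox (hs ! i) (x i) (x (Suc i)))"

lemma prox_chain_mem: "prox_chain hs x \<Longrightarrow> x 0 \<in> D \<Longrightarrow> i \<le> length hs \<Longrightarrow> x i \<in> D"
  by (cases i) (auto simp: prox_chain_def prox_def)

text \<open>The variational inequality is tested with the starting point, and
  \<open>global_slope\<close> bounds the energy dropped so far. Each step then satisfies
  \<open>(1 - a * h) * v \<le> u + h * L\<close>, with \<open>u\<close> and \<open>v\<close> the old
  and new distances to the start.\<close>

lemma prox_chain_displacement:
  assumes x: "prox_chain hs x" "x 0 \<in> D" "local_slope_le (x 0) L" "L \<ge> 0"
    and hs: "\<And>h. h \<in> set hs \<Longrightarrow> 0 < h \<and> a * h \<le> 1/2" and "i \<le> length hs"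
  shows "d (x i) (x 0) \<le> L * sum_list (take i hs) * exp (2 * a * sum_list (take i hs))"
  using \<open>i \<le> length hs\<close>
proof (induction i)
  case 0
  then show ?case using x D_subset by auto
next
  case (Suc i)
  define h T where "h = hs ! i" and "T = sum_list (take i hs)"
  have h: "h > 0" "a * h \<le> 1/2" using hs[of h] Suc by (auto simp: h_def)
  have T: "T \<ge> 0" unfolding T_def
    using hs by (intro sum_list_nonneg) (auto dest!: in_set_takeD intro: less_imp_le)
  have sum: "sum_list (take (Suc i) hs) = T + h" using Suc by (simp add: take_Suc_conv_app_nth T_def h_def)
  have D: "x i \<in> D" "x (Suc i) \<in> D" using prox_chain_mem[OF x(1,2)] Suc by auto
  define u v where "u = d (x i) (x 0)" and "v = d (x (Suc i)) (x 0)"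
  have nn: "u \<ge> 0" "v \<ge> 0" by (auto simp: u_def v_def)
  have p: "prox h (x i) (x (Suc i))" using x(1) Suc by (simp add: prox_chain_def h_def)
  have "(1 - a * h) * v\<^sup>2 - u\<^sup>2 + (d (x i) (x (Suc i)))\<^sup>2 \<le> 2 * h * (e (x 0) - e (x (Suc i)))"
    unfolding u_def v_def by (rule prox_variational[OF D(1) _ _ p x(2)]) (use h in auto)
  also have "\<dots> \<le> 2 * h * (L * v + a / 2 * v\<^sup>2)"
    using global_slope[OF x(2,3,4) D(2)] h commute[of "x 0"] by (intro mult_left_mono) (auto simp: v_def)
  finally have 1: "(1 - a * h) * v\<^sup>2 - u\<^sup>2 + (d (x i) (x (Suc i)))\<^sup>2 \<le> 2 * h * (L * v + a / 2 * v\<^sup>2)" .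
  have "x i \<in> M" "x (Suc i) \<in> M" "x 0 \<in> M" using D x(2) D_subset by auto
  then have "\<bar>v - u\<bar> \<le> d (x i) (x (Suc i))"
    using triangle[of "x (Suc i)" "x i" "x 0"] triangle[of "x i" "x (Suc i)" "x 0"]
      commute[of "x i" "x (Suc i)"] by (simp add: u_def v_def abs_le_iff)
  \<comment> \<open>Keeping this term is what makes the bound work up to \<open>a h = 1/2\<close>.\<close>
  then have "(v - u)\<^sup>2 \<le> (d (x i) (x (Suc i)))\<^sup>2" by (simp add: power2_le_iff_abs_le)
  then have "2 * v * ((1 - a * h) * v) \<le> 2 * v * (u + h * L)"
    using 1 by (simp add: power2_eq_square algebra_simps)
  then have v: "(1 - a * h) * v \<le> u + h * L"
    using nn h x(4) by (cases "v = 0") auto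
  define G where "G = exp (2 * a * T)"
  have G: "G \<ge> 1" using T a_nonneg by (simp add: G_def)
  have "v \<le> exp (2 * (a * h)) * (1 - a * h) * v"
    using one_le_exp_mult[of "a * h"] h a_nonneg nn mult_right_mono[of 1 _ v] by simp
  also have "\<dots> = exp (2 * (a * h)) * ((1 - a * h) * v)" by simp
  also have "\<dots> \<le> exp (2 * (a * h)) * (L * T * G + h * L * G)"
  proof (intro mult_left_mono order_trans[OF v] add_mono)
    show "u \<le> L * T * G" using Suc by (simp add: u_def T_def G_def)
    show "h * L \<le> h * L * G" using G h x(4) mult_left_mono[of 1 G "h * L"] by simp
  qed auto
  also have "\<dots> = L * (T + h) * exp (2 * a * (T + h))"
    by (simp add: G_def exp_add algebra_simps)
  finally show ?case by (simp add: sum v_def)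
qed

text \<open>The recursion refers to both \<open>(i - 1, j)\<close> and \<open>(i, j - 1)\<close>,
  hence the induction on \<open>i + j\<close>. If one index is 0, that chain sits at
  \<open>\<mu>\<close> and the displacement bound applies to the other.\<close>

lemma prox_chain_compare:
  assumes x: "prox_chain hs x" "x 0 = \<mu>" and y: "prox_chain ks y" "y 0 = \<mu>"
    and \<mu>: "\<mu> \<in> D" "local_slope_le \<mu> L" "L \<ge> 0"
    and hs: "\<And>h. h \<in> set hs \<Longrightarrow> 0 < h \<and> a * h \<le> 1/2 \<and> h \<le> H"
    and ks: "\<And>k. k \<in> set ks \<Longrightarrow> 0 < k \<and> a * k \<le> 1/2 \<and> k \<le> K"
    and "H \<ge> 0" "K \<ge> 0" "i \<le> length hs" "j \<le> length ks"
  defines "T \<equiv> \<lambda>i. sum_list (take i hs)" and "S \<equiv> \<lambda>j. sum_list (take j ks)"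
  shows "(d (x i) (y j))\<^sup>2 \<le> L\<^sup>2 * ((T i - S j)\<^sup>2 + H * T i + K * S j) * exp (4 * a * (T i + S j))"
  using \<open>i \<le> length hs\<close> \<open>j \<le> length ks\<close>
proof (induction "i + j" arbitrary: i j rule: less_induct)
  case less
  have T: "T i \<ge> 0" and S: "S j \<ge> 0" for i j unfolding T_def S_def
    using hs ks by (auto intro!: sum_list_nonneg dest!: in_set_takeD intro: less_imp_le)
  \<comment> \<open>Fits a displacement bound under the supersolution: squaring doubles the
    exponent, and \<open>r\<close> is the linear term available as slack.\<close>
  have bd: "u\<^sup>2 \<le> L\<^sup>2 * (t\<^sup>2 + r) * exp (4 * a * t)"
    if "0 \<le> u" "u \<le> L * t * exp (2 * a * t)" "r \<ge> 0" for u t r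
  proof -
    have "u\<^sup>2 \<le> (L * t * exp (2 * a * t))\<^sup>2" using that by (intro power_mono) auto
    also have "\<dots> = L\<^sup>2 * t\<^sup>2 * exp (4 * a * t)"
      by (simp add: power_mult_distrib exp_double[symmetric])
    also have "\<dots> \<le> L\<^sup>2 * (t\<^sup>2 + r) * exp (4 * a * t)"
      using that by (intro mult_right_mono mult_left_mono) auto
    finally show ?thesis .
  qed
  consider "i = 0" | "j = 0" | i' j' where "i = Suc i'" "j = Suc j'"
    by (metis not0_implies_Suc)
  then show ?case
  proof cases
    case 1
    have "d (y j) \<mu> \<le> L * S j * exp (2 * a * S j)"
      using prox_chain_displacement[of ks y L j] y \<mu> ks less by (auto simp: S_def)
    then show ?thesis using bd[of "d (y j) \<mu>" "S j" "K * S j"] 1 x S[of j] \<open>K \<ge> 0\<close> commute[of \<mu>]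
      by (simp add: T_def)
  next
    case 2
    have "d (x i) \<mu> \<le> L * T i * exp (2 * a * T i)"
      using prox_chain_displacement[of hs x L i] x \<mu> hs less by (auto simp: T_def)
    then show ?thesis using bd[of "d (x i) \<mu>" "T i" "H * T i"] 2 y T[of i] \<open>H \<ge> 0\<close>
      by (simp add: S_def)
  next
    case 3
    define h k where "h = hs ! i'" and "k = ks ! j'"
    have h: "0 < h" "a * h \<le> 1/2" "h \<le> H" and k: "0 < k" "a * k \<le> 1/2" "k \<le> K"
      using hs[of h] ks[of k] less 3 by (auto simp: h_def k_def)
    have Ti: "T i = T i' + h" and Sj: "S j = S j' + k"
      using less 3 by (simp_all add: T_def S_def take_Suc_conv_app_nth h_def k_def)
    have D: "x i' \<in> D" "x i \<in> D" "y j' \<in> D" "y j \<in> D"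
      using prox_chain_mem[OF x(1)] prox_chain_mem[OF y(1)] x y \<mu> less 3 by auto
    have px: "prox h (x i') (x i)" and py: "prox k (y j') (y j)"
      using x(1) y(1) less 3 by (auto simp: prox_chain_def h_def k_def)
    define A where "A = (d (x i) (y j))\<^sup>2"
    define A1 where "A1 = (d (x i') (y j))\<^sup>2"
    define A2 where "A2 = (d (x i) (y j'))\<^sup>2"
    have 1: "(1 - a * h) * A - A1 \<le> 2 * h * (e (y j) - e (x i))"
      using prox_variational[OF D(1) h(1) _ px D(4)] h(2)
        zero_le_power2[of "d (x i') (x i)"] unfolding A_def A1_def by linarith
    have 2: "(1 - a * k) * A - A2 \<le> 2 * k * (e (x i) - e (y j))"
      using prox_variational[OF D(3) k(1) _ py D(2)] k(2)
        zero_le_power2[of "d (y j') (y j)"]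
      unfolding A_def A2_def commute[of "x i"] by linarith
    \<comment> \<open>The energies cancel.\<close>
    have rec: "(h + k - 2 * a * h * k) * A \<le> k * A1 + h * A2"
      using mult_left_mono[OF 1, of k] mult_left_mono[OF 2, of h] h k by (simp add: algebra_simps)
    have "A \<le> L\<^sup>2 * ((T i - S j)\<^sup>2 + H * T i + K * S j) * exp (4 * a * (T i + S j))"
    proof (rule kobayashi_step[where h = h and k = k and ?D1.0 = A1 and ?D2.0 = A2])
      show "A1 \<le> L\<^sup>2 * ((T i - h - S j)\<^sup>2 + H * (T i - h) + K * S j) * exp (4 * a * (T i - h + S j))"
        using less.hyps[of i' j] less.prems 3(1) unfolding A1_def Ti by simp
      show "A2 \<le> L\<^sup>2 * ((T i - (S j - k))\<^sup>2 + H * T i + K * (S j - k)) * exp (4 * a * (T i + (S j - k)))"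
        using less.hyps[of i j'] less.prems 3(2) unfolding A2_def Sj by simp
    qed (use h k T[of i'] S[of j'] a_nonneg rec Ti Sj in auto)
    then show ?thesis by (simp add: A_def)
  qed
qed


section \<open>Passage to the limit along uniform partitions\<close>

lemma prox_chain_foldl:
  assumes J: "\<And>h x. 0 < h \<Longrightarrow> a * h \<le> 1/2 \<Longrightarrow> x \<in> D \<Longrightarrow> prox h x (J h x)"
    and "\<mu> \<in> D" and hs: "\<And>h. h \<in> set hs \<Longrightarrow> 0 < h \<and> a * h \<le> 1/2"
  shows "prox_chain hs (\<lambda>i. foldl (\<lambda>x h. J h x) \<mu> (take i hs))"
proof -
  have "foldl (\<lambda>x h. J h x) \<mu> (take i hs) \<in> D" if "i \<le> length hs" for i
    using that
  proof (induction i)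
    case (Suc i)
    then show ?case using J[of "hs ! i"] hs[of "hs ! i"] by (simp add: take_Suc_conv_app_nth prox_def)
  qed (simp add: \<open>\<mu> \<in> D\<close>)
  then show ?thesis
    using J hs by (simp add: prox_chain_def take_Suc_conv_app_nth)
qed

text \<open>At equal final times the quadratic term of the comparison vanishes, leaving only the
  mesh sizes. Taking the root halves the exponent \<open>8 * a * t\<close> of the squared
  bound.\<close>

lemma discrete_flows_distance:
  assumes J: "\<And>h x. 0 < h \<Longrightarrow> a * h \<le> 1/2 \<Longrightarrow> x \<in> D \<Longrightarrow> prox h x (J h x)"
    and \<mu>: "\<mu> \<in> D" "local_slope_le \<mu> L" "L \<ge> 0"
    and hs: "\<And>h. h \<in> set hs \<Longrightarrow> 0 < h \<and> a * h \<le> 1/2 \<and> h \<le> H" "sum_list hs = t" "H \<ge> 0"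
    and ks: "\<And>k. k \<in> set ks \<Longrightarrow> 0 < k \<and> a * k \<le> 1/2 \<and> k \<le> K" "sum_list ks = t" "K \<ge> 0"
    and t: "t \<ge> 0"
  shows "foldl (\<lambda>x h. J h x) \<mu> hs \<in> D"
    and "d (foldl (\<lambda>x h. J h x) \<mu> hs) (foldl (\<lambda>x h. J h x) \<mu> ks) \<le> L * sqrt ((H + K) * t) * exp (4 * a * t)"
proof -
  have ch: "prox_chain hs (\<lambda>i. foldl (\<lambda>x h. J h x) \<mu> (take i hs))"
    and ck: "prox_chain ks (\<lambda>i. foldl (\<lambda>x h. J h x) \<mu> (take i ks))"
    using J \<mu>(1) hs(1) ks(1) by (intro prox_chain_foldl; blast)+
  show "foldl (\<lambda>x h. J h x) \<mu> hs \<in> D"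
    using prox_chain_mem[OF ch, of "length hs"] \<mu> by simp
  have "(d (foldl (\<lambda>x h. J h x) \<mu> hs) (foldl (\<lambda>x h. J h x) \<mu> ks))\<^sup>2 \<le> L\<^sup>2 * ((H + K) * t) * exp (4 * a * (t + t))"
    using prox_chain_compare[OF ch _ ck _ \<mu> hs(1) ks(1) hs(3) ks(3), of "length hs" "length ks"] hs(2) ks(2)
    by (simp add: distrib_right)
  also have "exp (4 * a * (t + t)) = (exp (4 * a * t))\<^sup>2" by (simp add: exp_double[symmetric])
  also have "L\<^sup>2 * ((H + K) * t) * (exp (4 * a * t))\<^sup>2 = (L * sqrt ((H + K) * t) * exp (4 * a * t))\<^sup>2"
    using hs(3) ks(3) t by (simp add: power_mult_distrib)
  finally show "d (foldl (\<lambda>x h. J h x) \<mu> hs) (foldl (\<lambda>x h. J h x) \<mu> ks) \<le> L * sqrt ((H + K) * t) * exp (4 * a * t)"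
    by (rule power2_le_imp_le) (use \<mu>(3) hs(3) ks(3) t in auto)
qed

lemma foldl_replicate: "foldl (\<lambda>x h. J h x) \<mu> (replicate n h) = (J h ^^ n) \<mu>"
  by (induction n arbitrary: \<mu>) (simp_all add: funpow_swap1)

text \<open>Uniform partitions compared with each other give a Cauchy sequence. Compared with an
  arbitrary partition, their own mesh \<open>t / n\<close> disappears in the limit, so only
  \<open>H\<close> remains. The index \<open>n0\<close> records from where on the iterates are known
  to lie in the space.\<close>

lemma exponential_formula:
  assumes J: "\<And>h x. 0 < h \<Longrightarrow> a * h \<le> 1/2 \<Longrightarrow> x \<in> D \<Longrightarrow> prox h x (J h x)"
    and \<mu>: "\<mu> \<in> D" "local_slope_le \<mu> L" "L \<ge> 0" and t: "t > 0"
  shows "\<exists>S n0. S \<in> M \<and> (\<forall>n\<ge>n0. (J (t / real n) ^^ n) \<mu> \<in> M) \<and>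
    (\<lambda>n. d ((J (t / real n) ^^ n) \<mu>) S) \<longlonglongrightarrow> 0 \<and>
    (\<forall>hs H. (\<forall>h\<in>set hs. 0 < h \<and> a * h \<le> 1/2 \<and> h \<le> H) \<and> sum_list hs = t \<and> H \<ge> 0 \<longrightarrow>
      foldl (\<lambda>x h. J h x) \<mu> hs \<in> M \<and> d S (foldl (\<lambda>x h. J h x) \<mu> hs) \<le> L * sqrt (H * t) * exp (4 * a * t))"
proof -
  define y where "y n = (J (t / real n) ^^ n) \<mu>" for n
  define C where "C = L * exp (4 * a * t)"
  have C: "C \<ge> 0" using \<mu>(3) by (simp add: C_def)
  \<comment> \<open>From here on \<open>t / n\<close> satisfies the step restriction; before that
    \<open>J\<close> need not return a minimizer.\<close>
  obtain n0 :: nat where n0: "real n0 > 2 * a * t" "n0 > 0"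
    using reals_Archimedean2[of "max 1 (2 * a * t)"] by (metis max_less_iff_conj of_nat_0_less_iff order_less_trans zero_less_one)
  have step: "0 < t / real n \<and> a * (t / real n) \<le> 1/2" if "n \<ge> n0" for n
  proof -
    have "real n \<ge> real n0" using that by simp
    then have "2 * a * t \<le> real n" "real n > 0" using n0 by linarith+
    then show ?thesis using t by (simp add: field_simps)
  qed
  have rep: "h \<in> set (replicate n (t / real n)) \<Longrightarrow> 0 < h \<and> a * h \<le> 1/2 \<and> h \<le> t / real n"
    and rsum: "sum_list (replicate n (t / real n)) = t" and rnn: "t / real n \<ge> 0" if "n \<ge> n0" for n h
    using step[OF that] that n0 by (auto simp: sum_list_replicate)
  have yD: "y n \<in> D" if "n \<ge> n0" for n
    using discrete_flows_distance(1)[OF J \<mu> rep[OF that] rsum[OF that] rnn[OF that] rep[OF that] rsum[OF that] rnn[OF that]] t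
    by (simp add: foldl_replicate y_def)
  have yy: "d (y n) (y n') \<le> C * sqrt ((t / real n + t / real n') * t)" if "n \<ge> n0" "n' \<ge> n0" for n n'
    using discrete_flows_distance(2)[OF J \<mu> rep[OF that(1)] rsum[OF that(1)] rnn[OF that(1)]
        rep[OF that(2)] rsum[OF that(2)] rnn[OF that(2)]] t
    by (simp add: foldl_replicate y_def C_def mult_ac)
  \<comment> \<open>The sequence is shifted because its early members may lie outside the
    space.\<close>
  have "MCauchy (\<lambda>n. y (n + n0))"
    unfolding MCauchy_def
  proof (intro conjI allI impI)
    show "range (\<lambda>n. y (n + n0)) \<subseteq> M" using yD D_subset by auto
    fix \<epsilon> :: real assume "\<epsilon> > 0"
    have "(\<lambda>n. C * sqrt ((t / real n + t / real n) * t)) \<longlonglongrightarrow> C * sqrt ((0 + 0) * t)"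
      by (intro tendsto_intros lim_const_over_n)
    then have "\<forall>\<^sub>F n in sequentially. C * sqrt ((t / real n + t / real n) * t) < \<epsilon>"
      using \<open>\<epsilon> > 0\<close> by (intro order_tendstoD) auto
    then obtain N where N: "\<And>n. n \<ge> N \<Longrightarrow> C * sqrt ((t / real n + t / real n) * t) < \<epsilon>"
      by (auto simp: eventually_sequentially)
    show "\<exists>N. \<forall>n n'. N \<le> n \<longrightarrow> N \<le> n' \<longrightarrow> d (y (n + n0)) (y (n' + n0)) < \<epsilon>"
    proof (intro exI allI impI)
      fix n n' assume nn: "N \<le> n" "N \<le> n'"
      have "d (y (n + n0)) (y (n' + n0)) \<le> C * sqrt ((t / real (n + n0) + t / real (n' + n0)) * t)"
        by (intro yy) auto
      also have "\<dots> \<le> C * sqrt ((t / real (N + n0) + t / real (N + n0)) * t)"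
        using nn n0 t C by (intro mult_left_mono real_sqrt_le_mono mult_right_mono add_mono divide_left_mono) auto
      also have "\<dots> < \<epsilon>" by (intro N) auto
      finally show "d (y (n + n0)) (y (n' + n0)) < \<epsilon>" .
    qed
  qed
  then obtain S where S: "S \<in> M" "(\<lambda>n. d (y (n + n0)) S) \<longlonglongrightarrow> 0"
    using complete by (auto simp: mcomplete_def limitin_metric_dist_null)
  have lim: "(\<lambda>n. d (y n) S) \<longlonglongrightarrow> 0" using S(2) by (rule LIMSEQ_offset)
  have est: "foldl (\<lambda>x h. J h x) \<mu> hs \<in> M \<and> d S (foldl (\<lambda>x h. J h x) \<mu> hs) \<le> L * sqrt (H * t) * exp (4 * a * t)"
    if hs: "\<And>h. h \<in> set hs \<Longrightarrow> 0 < h \<and> a * h \<le> 1/2 \<and> h \<le> H" "sum_list hs = t" "H \<ge> 0" for hs H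
  proof -
    define X where "X = foldl (\<lambda>x h. J h x) \<mu> hs"
    have t0: "t \<ge> 0" using t by simp
    have X: "X \<in> M"
      using discrete_flows_distance(1)[OF J \<mu> hs hs t0] D_subset by (auto simp: X_def)
    have le: "d S X \<le> d (y n) S + C * sqrt ((t / real n + H) * t)" if n: "n \<ge> n0" for n
    proof -
      have "d S X \<le> d S (y n) + d (y n) X" using S(1) X yD[OF n] D_subset by (intro triangle) auto
      moreover have "d (y n) X \<le> C * sqrt ((t / real n + H) * t)"
        using discrete_flows_distance(2)[OF J \<mu> rep[OF n] rsum[OF n] rnn[OF n] hs t0]
        by (simp add: foldl_replicate y_def X_def C_def mult_ac)
      ultimately show ?thesis by (simp add: commute)
    qed
    have "(\<lambda>n. d (y n) S + C * sqrt ((t / real n + H) * t)) \<longlonglongrightarrow> 0 + C * sqrt ((0 + H) * t)"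
      by (intro tendsto_intros lim lim_const_over_n)
    then have "d S X \<le> 0 + C * sqrt ((0 + H) * t)"
      using le by (intro LIMSEQ_le_const) auto
    then show ?thesis using X by (simp add: X_def C_def mult_ac)
  qed
  show ?thesis
    using S(1) yD D_subset lim est unfolding y_def by (intro exI[of _ S] exI[of _ n0]) blast
qed

end

subsection \<open>The exponential formula\<close>

text \<open>It remains to read the extended-real data as real data of the abstract setting, and to
  show that the choice operators in \<open>Jstep\<close> and \<open>Sflow\<close> pick the intended
  objects.\<close>

theorem theoremA4:
  fixes \<omega>0 :: "'a::euclidean_space measure"
    and E :: "'a measure \<Rightarrow> ereal"
    and lam :: real
    and \<mu> :: "'a measure"
  assumes "\<omega>0 \<in> Pm"
    and "\<forall>\<nu>\<in>P2 \<omega>0. E \<nu> \<noteq> - \<infinity>"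
    and "proper_fun \<omega>0 E"
    and "coercive \<omega>0 E"
    and "W2_lsc \<omega>0 E"
    and "lambda_convex_gg \<omega>0 E lam"
    and "\<mu> \<in> P2 \<omega>0" and "E \<mu> < \<infinity>" and "slope \<omega>0 E \<mu> < \<infinity>"
  shows "(\<forall>T>0. \<forall>\<epsilon>>0. \<exists>\<delta>>0. \<forall>t hs. 0 < t \<and> t \<le> T \<and> admissible_steps t hs \<and> Max (set hs) < \<delta>
            \<longrightarrow> W2 (Sflow \<omega>0 E t \<mu>) (disc_flow \<omega>0 E hs \<mu>) < ennreal \<epsilon>)
       \<and> (\<forall>t hs. 0 < t \<and> admissible_steps t hs \<and>
            (max 0 (- lam) = 0 \<or> Max (set hs) \<le> 1 / (2 * max 0 (- lam)))
            \<longrightarrow> enn2ereal (W2 (Sflow \<omega>0 E t \<mu>) (disc_flow \<omega>0 E hs \<mu>))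
                \<le> ereal (2 * sqrt ((Max (set hs))\<^sup>2 + 3 * Max (set hs) * t) * exp (4 * max 0 (- lam) * t))
                   * slope \<omega>0 E \<mu>)"
proof -
  define a where "a = max 0 (- lam)"
  have a: "a \<ge> 0" "- lam \<le> a" by (auto simp: a_def)
  interpret W: wasserstein_space \<omega>0
  proof
    show "\<omega>0 \<in> Pm" by fact
    show "transport_plans \<omega> \<mu>0 \<mu>1 \<noteq> {}" if "\<omega> \<in> P2 \<omega>0" "\<mu>0 \<in> P2 \<omega>0" "\<mu>1 \<in> P2 \<omega>0" for \<omega> \<mu>0 \<mu>1
      using assms(6) that unfolding lambda_convex_gg_def by blast
  qed
  define D where "D = {\<nu> \<in> P2 \<omega>0. E \<nu> < \<infinity>}"
  define e where "e \<nu> = real_of_ereal (E \<nu>)" for \<nu>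
  have E: "E \<nu> = ereal (e \<nu>)" if "\<nu> \<in> D" for \<nu>
    using that assms(2) by (auto simp: D_def e_def ereal_real)
  have DP: "\<nu> \<in> P2 \<omega>0" if "\<nu> \<in> D" for \<nu> using that by (simp add: D_def)
  have W2d: "W2 x y = ennreal (W2d x y)" "W2sq x y = ennreal ((W2d x y)\<^sup>2)"
    if "x \<in> P2 \<omega>0" "y \<in> P2 \<omega>0" for x y
    using W2_eq_W2d W2sq_eq_W2d W.W2sq_finite[OF that] by auto
  interpret convex_energy "P2 \<omega>0" W2d D e a
  proof
    show "D \<subseteq> P2 \<omega>0" by (auto simp: D_def)
    show "W.mcomplete" by (rule W.mcomplete_W2d)
    show "0 \<le> a" by fact
  next
    fix \<sigma> x c l assume \<sigma>: "\<And>n. \<sigma> n \<in> D" and le: "\<And>n. e (\<sigma> n) \<le> c n" and c: "c \<longlonglongrightarrow> l"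
      and x: "x \<in> P2 \<omega>0" and lim: "(\<lambda>n. W2d (\<sigma> n) x) \<longlonglongrightarrow> 0"
    have "(\<lambda>n. W2 (\<sigma> n) x) \<longlonglongrightarrow> 0"
      using tendsto_ennrealI[OF lim] by (simp add: W2d(1)[OF DP[OF \<sigma>] x])
    then have "E x \<le> liminf (\<lambda>n. E (\<sigma> n))"
      using assms(5) DP[OF \<sigma>] x unfolding W2_lsc_def by blast
    also have "\<dots> \<le> liminf (\<lambda>n. ereal (c n))"
      using le by (intro Liminf_mono) (simp add: E[OF \<sigma>])
    also have "\<dots> = ereal l" using c by (intro lim_imp_Liminf) auto
    finally have Ex: "E x \<le> ereal l" .
    then have "x \<in> D" using x by (auto simp: D_def)
    then show "x \<in> D \<and> e x \<le> l" using Ex E by simp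
  next
    fix x v0 v1 assume D: "x \<in> D" "v0 \<in> D" "v1 \<in> D"
    note P = D[THEN DP]
    obtain w where w: "w \<in> transport_plans x v0 v1" and conv: "\<And>\<alpha>. \<alpha> \<in> {0..1} \<Longrightarrow> E (gen_geod w \<alpha>) \<le>
        ereal (1 - \<alpha>) * E v0 + ereal \<alpha> * E v1 - ereal (\<alpha> * (1 - \<alpha>) * lam / 2) * enn2ereal (W2plan_sq w)"
      using assms(6) P unfolding lambda_convex_gg_def by blast
    obtain q where q: "q \<ge> 0" "W2plan_sq w = ennreal q" "W2sq v0 v1 \<le> ennreal q"
      and dist: "\<And>\<alpha>. W2sq x (gen_geod w \<alpha>) \<le>
        ennreal ((1 - \<alpha>) * (W2d x v0)\<^sup>2 + \<alpha> * (W2d x v1)\<^sup>2 - \<alpha> * (1 - \<alpha>) * q)"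
      and nn: "\<And>\<alpha>. 0 \<le> (1 - \<alpha>) * (W2d x v0)\<^sup>2 + \<alpha> * (W2d x v1)\<^sup>2 - \<alpha> * (1 - \<alpha>) * q"
      and Pm: "\<And>\<alpha>. gen_geod w \<alpha> \<in> Pm"
      by (rule transport_plan_estimates[OF w W.W2sq_finite[OF P(1,2)] W.W2sq_finite[OF P(1,3)]]) (rule that)
    have "gen_geod w \<alpha> \<in> D \<and>
        (W2d x (gen_geod w \<alpha>))\<^sup>2 \<le> (1 - \<alpha>) * (W2d x v0)\<^sup>2 + \<alpha> * (W2d x v1)\<^sup>2 - \<alpha> * (1 - \<alpha>) * q \<and>
        e (gen_geod w \<alpha>) \<le> (1 - \<alpha>) * e v0 + \<alpha> * e v1 + \<alpha> * (1 - \<alpha>) * (a / 2) * q"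
      if \<alpha>: "\<alpha> \<in> {0..1}" for \<alpha>
    proof -
      define g where "g = gen_geod w \<alpha>"
      have "W2sq g x < \<infinity>"
        using dist[of \<alpha>] unfolding g_def W2sq_commute[of _ x] by (simp add: order_le_less_trans)
      \<comment> \<open>The glued coupling enters here: the curve is at finite distance from its
        base \<open>x\<close>, and \<open>x\<close> is at finite distance from
        \<open>\<omega>0\<close>.\<close>
      then have gP: "g \<in> P2 \<omega>0"
        using W2sq_finite_trans[of g x \<omega>0] P(1) Pm[of \<alpha>] by (simp add: P2_iff g_def)
      have "E g \<le> ereal ((1 - \<alpha>) * e v0 + \<alpha> * e v1 - \<alpha> * (1 - \<alpha>) * lam / 2 * q)"
        using conv[OF \<alpha>] q(1,2) by (simp add: E D g_def)
      moreover from this have gD: "g \<in> D" using gP by (auto simp: D_def)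
      ultimately have "e g \<le> (1 - \<alpha>) * e v0 + \<alpha> * e v1 - \<alpha> * (1 - \<alpha>) * lam / 2 * q"
        by (simp add: E)
      \<comment> \<open>The plan distance is nonnegative, so \<open>lam\<close> may be lowered to
        \<open>- a\<close>.\<close>
      also have "\<dots> \<le> (1 - \<alpha>) * e v0 + \<alpha> * e v1 + \<alpha> * (1 - \<alpha>) * (a / 2) * q"
        using mult_left_mono[OF a(2), of "\<alpha> * (1 - \<alpha>) / 2 * q"] \<alpha> q(1) by (simp add: mult_ac)
      finally have "e g \<le> (1 - \<alpha>) * e v0 + \<alpha> * e v1 + \<alpha> * (1 - \<alpha>) * (a / 2) * q" .
      moreover have "(W2d x g)\<^sup>2 \<le> (1 - \<alpha>) * (W2d x v0)\<^sup>2 + \<alpha> * (W2d x v1)\<^sup>2 - \<alpha> * (1 - \<alpha>) * q"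
        using dist[of \<alpha>] nn[of \<alpha>] by (simp add: W2d(2)[OF P(1) gP] flip: g_def)
      ultimately show ?thesis using gD by (simp add: g_def)
    qed
    moreover have "(W2d v0 v1)\<^sup>2 \<le> q" using q by (simp add: W2d(2)[OF P(2,3)])
    ultimately show "\<exists>g q. (W2d v0 v1)\<^sup>2 \<le> q \<and> (\<forall>\<alpha>\<in>{0..1}. g \<alpha> \<in> D \<and>
        (W2d x (g \<alpha>))\<^sup>2 \<le> (1 - \<alpha>) * (W2d x v0)\<^sup>2 + \<alpha> * (W2d x v1)\<^sup>2 - \<alpha> * (1 - \<alpha>) * q \<and>
        e (g \<alpha>) \<le> (1 - \<alpha>) * e v0 + \<alpha> * e v1 + \<alpha> * (1 - \<alpha>) * (a / 2) * q)"
      by blast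
  qed
  have \<mu>D: "\<mu> \<in> D" using assms by (simp add: D_def)
  define L where "L = real_of_ereal (slope \<omega>0 E \<mu>)"
  have slope0: "slope \<omega>0 E \<mu> \<ge> 0" unfolding slope_def by (intro INF_greatest) simp
  then have L: "slope \<omega>0 E \<mu> = ereal L" "L \<ge> 0"
    using assms(9) by (auto simp: L_def ereal_real real_of_ereal_pos)
  have slope: "local_slope_le \<mu> L"
    unfolding local_slope_le_def
  proof (intro allI impI)
    fix L' assume "L' > L"
    then have "slope \<omega>0 E \<mu> < ereal L'" by (simp add: L)
    then obtain \<delta> :: real where \<delta>: "\<delta> > 0" "sup 0 (SUP \<nu>\<in>{\<nu>\<in>P2 \<omega>0. 0 < W2 \<mu> \<nu> \<and> W2 \<mu> \<nu> < ennreal \<delta>}.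
       max 0 (E \<mu> - E \<nu>) / enn2ereal (W2 \<mu> \<nu>)) < ereal L'"
      unfolding slope_def INF_less_iff by auto
    have "e \<mu> - e \<nu> \<le> L' * W2d \<mu> \<nu>" if \<nu>: "\<nu> \<in> D" "0 < W2d \<mu> \<nu>" "W2d \<mu> \<nu> < \<delta>" for \<nu>
    proof -
      have "\<nu> \<in> {\<nu>\<in>P2 \<omega>0. 0 < W2 \<mu> \<nu> \<and> W2 \<mu> \<nu> < ennreal \<delta>}"
        using \<nu> DP[OF \<nu>(1)] W2d(1)[OF DP[OF \<mu>D] DP[OF \<nu>(1)]] \<delta>(1)
        by (simp add: ennreal_lessI del: W.zero)
      then have "max 0 (E \<mu> - E \<nu>) / enn2ereal (W2 \<mu> \<nu>) \<le> (SUP \<nu>\<in>{\<nu>\<in>P2 \<omega>0. 0 < W2 \<mu> \<nu> \<and> W2 \<mu> \<nu> < ennreal \<delta>}.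
          max 0 (E \<mu> - E \<nu>) / enn2ereal (W2 \<mu> \<nu>))" by (rule SUP_upper)
      also have "\<dots> \<le> ereal L'" using \<delta>(2) by (meson le_sup_iff less_imp_le)
      finally have "max 0 (E \<mu> - E \<nu>) / enn2ereal (W2 \<mu> \<nu>) \<le> ereal L'" .
      moreover have "max 0 (E \<mu> - E \<nu>) = ereal (max 0 (e \<mu> - e \<nu>))"
        by (simp add: E[OF \<mu>D] E[OF \<nu>(1)] max_def zero_ereal_def)
      moreover have "enn2ereal (W2 \<mu> \<nu>) = ereal (W2d \<mu> \<nu>)"
        using \<nu>(2) by (simp add: W2d(1) DP \<mu>D \<nu>(1))
      moreover have "r / p \<le> q" if "ereal r / ereal p \<le> ereal q" "p > 0" for r p q using that by simp
      ultimately have "max 0 (e \<mu> - e \<nu>) / W2d \<mu> \<nu> \<le> L'" using \<nu>(2) by metis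
      then have "max 0 (e \<mu> - e \<nu>) \<le> L' * W2d \<mu> \<nu>" using \<nu>(2) by (simp add: pos_divide_le_eq)
      then show ?thesis by simp
    qed
    then show "\<exists>\<delta>>0. \<forall>\<nu>\<in>D. 0 < W2d \<mu> \<nu> \<and> W2d \<mu> \<nu> < \<delta> \<longrightarrow> e \<mu> - e \<nu> \<le> L' * W2d \<mu> \<nu>"
      using \<delta>(1) by blast
  qed
  have J: "prox h x (Jstep \<omega>0 E h x)" if h: "0 < h" "a * h \<le> 1/2" and x: "x \<in> D" for h x
  proof -
    define \<Phi> where "\<Phi> \<nu> = ereal (1 / (2 * h)) * enn2ereal (W2sq x \<nu>) + E \<nu>" for \<nu>
    have \<Phi>: "\<Phi> \<nu> = ereal ((W2d x \<nu>)\<^sup>2 / (2 * h) + e \<nu>)" if "\<nu> \<in> D" for \<nu>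
      using that DP x by (simp add: \<Phi>_def E W2d(2))
    have \<Phi>inf: "\<Phi> \<nu> = \<infinity>" if "\<nu> \<in> P2 \<omega>0" "\<nu> \<notin> D" for \<nu>
    proof -
      have "E \<nu> = \<infinity>" using that by (simp add: D_def)
      then show ?thesis by (simp add: \<Phi>_def W2d(2)[OF DP[OF x] that(1)])
    qed
    obtain v where v: "prox h x v" using prox_exists[OF x h \<mu>D slope L(2)] by blast
    have "v \<in> P2 \<omega>0 \<and> (\<forall>\<nu>'\<in>P2 \<omega>0. \<Phi> v \<le> \<Phi> \<nu>')"
    proof (intro conjI ballI)
      show "v \<in> P2 \<omega>0" using v DP by (simp add: prox_def)
      show "\<Phi> v \<le> \<Phi> \<nu>'" if "\<nu>' \<in> P2 \<omega>0" for \<nu>'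
        using v that by (cases "\<nu>' \<in> D") (auto simp: prox_def \<Phi> \<Phi>inf)
    qed
    then have *: "Jstep \<omega>0 E h x \<in> P2 \<omega>0 \<and> (\<forall>\<nu>'\<in>P2 \<omega>0. \<Phi> (Jstep \<omega>0 E h x) \<le> \<Phi> \<nu>')"
      unfolding Jstep_def \<Phi>_def by (rule someI)
    \<comment> \<open>Comparison with \<open>x\<close>, where the functional is finite, forces the
      selected minimizer into the effective domain.\<close>
    have "\<Phi> (Jstep \<omega>0 E h x) \<le> \<Phi> x" using * DP[OF x] by blast
    then have "Jstep \<omega>0 E h x \<in> D" using * \<Phi>inf \<Phi>[OF x] by fastforce
    then show ?thesis using * DP \<Phi> unfolding prox_def by (metis ereal_less_eq(3))
  qed
  have key: "enn2ereal (W2 (Sflow \<omega>0 E t \<mu>) (disc_flow \<omega>0 E hs \<mu>)) \<le> ereal (L * sqrt (Max (set hs) * t) * exp (4 * a * t))"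
    if t: "t > 0" and adm: "admissible_steps t hs" and small: "a * Max (set hs) \<le> 1/2" for t hs
  proof -
    obtain S n0 where S: "S \<in> P2 \<omega>0" and yP: "\<forall>n\<ge>n0. (Jstep \<omega>0 E (t / real n) ^^ n) \<mu> \<in> P2 \<omega>0"
      and lim: "(\<lambda>n. W2d ((Jstep \<omega>0 E (t / real n) ^^ n) \<mu>) S) \<longlonglongrightarrow> 0"
      and est: "\<forall>hs H. (\<forall>h\<in>set hs. 0 < h \<and> a * h \<le> 1/2 \<and> h \<le> H) \<and> sum_list hs = t \<and> H \<ge> 0 \<longrightarrow>
        foldl (\<lambda>x h. Jstep \<omega>0 E h x) \<mu> hs \<in> P2 \<omega>0 \<and>
        W2d S (foldl (\<lambda>x h. Jstep \<omega>0 E h x) \<mu> hs) \<le> L * sqrt (H * t) * exp (4 * a * t)"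
      using exponential_formula[OF J \<mu>D slope L(2) t] by blast
    define y where "y n = (Jstep \<omega>0 E (t / real n) ^^ n) \<mu>" for n
    \<comment> \<open>Only eventually: for small \<open>n\<close> the iterate may lie outside
      \<open>P2 \<omega>0\<close>, where \<open>W2\<close> and \<open>W2d\<close> need not
      agree.\<close>
    have ev: "\<forall>\<^sub>F n in sequentially. W2 (y n) \<nu> = ennreal (W2d (y n) \<nu>)" if "\<nu> \<in> P2 \<omega>0" for \<nu>
      using yP that by (intro eventually_sequentiallyI[of n0] W2d(1)) (auto simp: y_def)
    have "Sflow \<omega>0 E t \<mu> = S"
      unfolding Sflow_def
    proof (rule the_equality)
      have "(\<lambda>n. ennreal (W2d (y n) S)) \<longlonglongrightarrow> 0" using tendsto_ennrealI[OF lim] by (simp add: y_def)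
      then have "(\<lambda>n. W2 (y n) S) \<longlonglongrightarrow> 0" using tendsto_cong[OF ev[OF S]] by blast
      then show "S \<in> P2 \<omega>0 \<and> (\<lambda>n. W2 ((Jstep \<omega>0 E (t / real n) ^^ n) \<mu>) S) \<longlonglongrightarrow> 0"
        using S by (simp add: y_def)
    next
      \<comment> \<open>The definite description needs uniqueness: a second limit is at distance 0
        from \<open>S\<close> by the triangle inequality.\<close>
      fix \<nu> assume "\<nu> \<in> P2 \<omega>0 \<and> (\<lambda>n. W2 ((Jstep \<omega>0 E (t / real n) ^^ n) \<mu>) \<nu>) \<longlonglongrightarrow> 0"
      then have \<nu>: "\<nu> \<in> P2 \<omega>0" "(\<lambda>n. W2 (y n) \<nu>) \<longlonglongrightarrow> 0" by (auto simp: y_def)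
      then have "(\<lambda>n. ennreal (W2d (y n) \<nu>)) \<longlonglongrightarrow> ennreal 0" using tendsto_cong[OF ev[OF \<nu>(1)]] by simp
      then have "(\<lambda>n. W2d (y n) \<nu>) \<longlonglongrightarrow> 0" using W2d_nonneg by (subst (asm) tendsto_ennreal_iff) auto
      then have "(\<lambda>n. W2d (y n) \<nu> + W2d (y n) S) \<longlonglongrightarrow> 0 + 0" using lim by (intro tendsto_add) (auto simp: y_def)
      moreover have "W2d \<nu> S \<le> W2d (y n) \<nu> + W2d (y n) S" if "n \<ge> n0" for n
        using W.triangle[OF \<nu>(1) yP[rule_format, OF that] S] W.commute[of \<nu>] by (simp add: y_def)
      ultimately have "W2d \<nu> S \<le> 0 + 0" by (intro LIMSEQ_le_const) auto
      then show "\<nu> = S" using W.zero[OF \<nu>(1) S] W2d_nonneg[of \<nu> S] by simp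
    qed
    moreover have "disc_flow \<omega>0 E hs \<mu> \<in> P2 \<omega>0 \<and>
        W2d S (disc_flow \<omega>0 E hs \<mu>) \<le> L * sqrt (Max (set hs) * t) * exp (4 * a * t)"
      unfolding disc_flow_def
    proof (rule est[rule_format], intro conjI[OF ballI conjI])
      have hs: "hs \<noteq> []" "\<And>h. h \<in> set hs \<Longrightarrow> 0 < h" using adm by (auto simp: admissible_steps_def)
      show "0 < h \<and> a * h \<le> 1 / 2 \<and> h \<le> Max (set hs)" if "h \<in> set hs" for h
        using hs that small mult_left_mono[OF Max_ge[of "set hs" h] a(1)] by auto
      show "sum_list hs = t" using adm by (simp add: admissible_steps_def)
      show "0 \<le> Max (set hs)" using hs Max_in[of "set hs"] by (auto intro: less_imp_le)
    qed
    ultimately show ?thesis using S by (simp add: W2d(1) W2d_nonneg)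
  qed
  have maxpos: "0 < Max (set hs)" if "admissible_steps t hs" for t hs
    using that Max_in[of "set hs"] by (auto simp: admissible_steps_def)
  show ?thesis
  proof (intro conjI allI impI, goal_cases)
    case (1 T \<epsilon>)
    \<comment> \<open>The added 1 keeps \<open>B\<close> positive when the slope is 0.\<close>
    define B where "B = L * exp (4 * a * T) + 1"
    have B: "B > 0" using L by (simp add: B_def add_nonneg_pos)
    \<comment> \<open>The first entry yields \<open>a * M \<le> 1/2\<close>, with
      \<open>a + 1\<close> to cover \<open>a = 0\<close>; the second yields
      \<open>M * t < (\<epsilon> / B)^2\<close> simultaneously for all
      \<open>t \<le> T\<close>.\<close>
    define \<delta> where "\<delta> = min (1 / (2 * (a + 1))) ((\<epsilon> / B)\<^sup>2 / T)"
    have \<delta>: "\<delta> > 0" using 1 B a by (simp add: \<delta>_def)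
    show ?case
    proof (intro exI[of _ \<delta>] conjI \<delta> allI impI, elim conjE)
      fix t hs assume t: "0 < t" "t \<le> T" and adm: "admissible_steps t hs" and H: "Max (set hs) < \<delta>"
      define M where "M = Max (set hs)"
      have M: "M > 0" using maxpos[OF adm] by (simp add: M_def)
      have "a * M \<le> (a + 1) * (1 / (2 * (a + 1)))"
        using H a M by (intro mult_mono) (auto simp: M_def \<delta>_def)
      also have "\<dots> = 1/2" using a by (simp add: field_simps)
      finally have "a * M \<le> 1/2" .
      then have "enn2ereal (W2 (Sflow \<omega>0 E t \<mu>) (disc_flow \<omega>0 E hs \<mu>)) \<le> ereal (L * sqrt (M * t) * exp (4 * a * t))"
        using key[OF t(1) adm] by (simp add: M_def)
      then have le: "W2 (Sflow \<omega>0 E t \<mu>) (disc_flow \<omega>0 E hs \<mu>) \<le> ennreal (L * sqrt (M * t) * exp (4 * a * t))"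
        using L(2) M t by (simp add: less_eq_ennreal.rep_eq)
      have "M * t < (\<epsilon> / B)\<^sup>2"
      proof -
        have "M * t \<le> M * T" using M t by simp
        also have "\<dots> < (\<epsilon> / B)\<^sup>2 / T * T" using H 1 by (intro mult_strict_right_mono) (auto simp: M_def \<delta>_def)
        finally show ?thesis using 1 by simp
      qed
      then have s: "sqrt (M * t) < \<epsilon> / B" using 1 B by (intro real_less_lsqrt) auto
      have "L * exp (4 * a * t) \<le> L * exp (4 * a * T)"
        using L a t by (intro mult_left_mono) (auto intro: mult_left_mono)
      then have "L * exp (4 * a * t) * sqrt (M * t) \<le> B * sqrt (M * t)"
        using M t by (intro mult_right_mono) (auto simp: B_def)
      also have "\<dots> < B * (\<epsilon> / B)" using s B by (intro mult_strict_left_mono) auto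
      finally have "L * sqrt (M * t) * exp (4 * a * t) < \<epsilon>" using B by (simp add: mult_ac)
      then show "W2 (Sflow \<omega>0 E t \<mu>) (disc_flow \<omega>0 E hs \<mu>) < ennreal \<epsilon>"
        using le 1 by (meson ennreal_lessI le_less_trans)
    qed
  next
    case (2 t hs)
    define M where "M = Max (set hs)"
    have t: "t > 0" and adm: "admissible_steps t hs" using 2 by auto
    have M: "M > 0" using maxpos[OF adm] by (simp add: M_def)
    have "a * M \<le> 1/2"
    proof (cases "a = 0")
      case False
      then have "M \<le> 1 / (2 * a)" "a > 0" using 2 a by (auto simp: M_def a_def)
      then show ?thesis by (simp add: field_simps)
    qed simp
    then have "enn2ereal (W2 (Sflow \<omega>0 E t \<mu>) (disc_flow \<omega>0 E hs \<mu>)) \<le> ereal (L * sqrt (M * t) * exp (4 * a * t))"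
      using key[OF t adm] by (simp add: M_def)
    \<comment> \<open>The bound already proved is sharper: \<open>M * t\<close> is one of the terms
      under the larger root.\<close>
    also have "L * sqrt (M * t) * exp (4 * a * t) \<le> L * (2 * sqrt (M\<^sup>2 + 3 * M * t)) * exp (4 * a * t)"
    proof (intro mult_right_mono mult_left_mono)
      have "M * t \<le> M\<^sup>2 + 3 * M * t" using M t by simp
      then have "sqrt (M * t) \<le> sqrt (M\<^sup>2 + 3 * M * t)" by (rule real_sqrt_le_mono)
      moreover have "0 \<le> sqrt (M\<^sup>2 + 3 * M * t)" using M t by simp
      ultimately show "sqrt (M * t) \<le> 2 * sqrt (M\<^sup>2 + 3 * M * t)" by linarith
    qed (use L in auto)
    finally show ?case unfolding L(1) by (simp add: M_def a_def mult_ac)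
  qed
qed

end
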